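(* There exists an injective superalgebra homomorphism $\varphi$ from $U_q^{+}=U_q^{+}(C(2)^{(2)})$ to the $q$-shuffle superalgebra $(\mathbb{V},\star)$ that sends $A\mapsto x$ and $B\mapsto y$.
   Context: Ground field $\mathbb{F}=\mathbb{Q}(q)$, $q$ an indeterminate; $\{n\}_q=\frac{q^{-n}-(-1)^nq^n}{q+q^{-1}}$. $U_q^{+}=U_q^{+}(C(2)^{(2)})$ is the positive part of the quantum affine superalgebra $U_q(C(2)^{(2)})$: the unital associative $\mathbb{F}$-superalgebra with odd generators $A=e_{\delta-\alpha}$, $B=e_{\alpha}$ and the cubic $q$-Serre relations $A^3B+\{3\}_qA^2BA-\{3\}_qABA^2-BA^3=0$ and $B^3A+\{3\}_qB^2AB-\{3\}_qBAB^2-AB^3=0$. $\mathbb{V}$ is the free associative unital $\mathbb{F}$-algebra on noncommuting $x,y$; words in $x,y$ form a basis; the trivial (empty) word is $1$; juxtaposition denotes concatenation. The $q$-shuffle superproduct $\star$ is the bilinear product on $\mathbb{V}$ with $1\star v=v\star 1=v$ and, for nontrivial words $u=u_1\cdots u_r$, $v=v_1\cdots v_s$ (letters $u_i,v_j\in\{x,y\}$), recursively $$u\star v=u_1\big((u_2\cdots u_r)\star v\big)+(-1)^r v_1\big(u\star(v_2\cdots v_s)\big)q^{\langle u_1,v_1\rangle+\cdots+\langle u_r,v_1\rangle},$$ where $\langle x,x\rangle=\langle y,y\rangle=2$, $\langle x,y\rangle=\langle y,x\rangle=-2$ (e.g. $x\star y=xy-q^{-2}yx$, $x\star x=(1-q^2)xx$).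 This makes $\mathbb{V}$ an associative superalgebra with $x,y$ odd, called the $q$-shuffle superalgebra. *)

theory Defs
  imports
    "HOL-Computational_Algebra.Polynomial"
    "HOL-Computational_Algebra.Fraction_Field"
    "HOL-Library.Poly_Mapping"
    "HOL-Library.Z2"
begin

section \<open>Superalgebras\<close>

text \<open>
  A superalgebra is an associative unital algebra with a grading by the integers modulo 2;
  \<open>part 0\<close> is the even part and \<open>part 1\<close> the odd part. The product is a
  parameter of the locale rather than \<open>(*)\<close>, since the free algebra on two letters
  will carry both concatenation and the shuffle product.
\<close>

locale superalgebra = vector_space scale
  for scale :: "'k::field \<Rightarrow> 'a::ab_group_add \<Rightarrow> 'a" +
  fixes mult :: "'a \<Rightarrow> 'a \<Rightarrow> 'a"
    and unit :: 'a
    and part :: "bit \<Rightarrow> 'a set"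
  assumes mult_assoc: "mult (mult a b) c = mult a (mult b c)"
    and mult_add_left: "mult (a + b) c = mult a c + mult b c"
    and mult_add_right: "mult a (b + c) = mult a b + mult a c"
    and mult_scale_left: "mult (scale k a) b = scale k (mult a b)"
    and mult_scale_right: "mult a (scale k b) = scale k (mult a b)"
    and unit_left: "mult unit a = a"
    and unit_right: "mult a unit = a"
    and subspace_part: "subspace (part i)"
    and part_inter: "part 0 \<inter> part 1 = {0}"
    and part_sum: "\<exists>b\<in>part 0. \<exists>c\<in>part 1. a = b + c"
    and unit_part: "unit \<in> part 0"
    and mult_part: "a \<in> part i \<Longrightarrow> b \<in> part j \<Longrightarrow> mult a b \<in> part (i + j)"

locale superalgebra_hom =
  S: superalgebra scale1 mult1 unit1 part1 +
  T: superalgebra scale2 mult2 unit2 part2 +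
  Vector_Spaces.linear scale1 scale2 f
  for scale1 :: "'k::field \<Rightarrow> 'a::ab_group_add \<Rightarrow> 'a"
    and mult1 :: "'a \<Rightarrow> 'a \<Rightarrow> 'a" and unit1 :: 'a and part1 :: "bit \<Rightarrow> 'a set"
    and scale2 :: "'k \<Rightarrow> 'b::ab_group_add \<Rightarrow> 'b"
    and mult2 :: "'b \<Rightarrow> 'b \<Rightarrow> 'b" and unit2 :: 'b and part2 :: "bit \<Rightarrow> 'b set"
    and f :: "'a \<Rightarrow> 'b" +
  assumes hom_mult: "f (mult1 a b) = mult2 (f a) (f b)"
    and hom_unit: "f unit1 = unit2"
    and hom_part: "a \<in> part1 i \<Longrightarrow> f a \<in> part2 i"


section \<open>The ground field\<close>

type_synonym qfield = "rat poly fract"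

definition q :: qfield where
  "q = Fract [:0, 1:] 1"

definition qbrace :: "nat \<Rightarrow> qfield" where
  "qbrace n = (q powi (- int n) - (-1) ^ n * q ^ n) / (q + inverse q)"


section \<open>Free superalgebras on odd generators\<close>

text \<open>
  Words are wrapped in a type of their own, on which \<open>+\<close> is concatenation and \<open>0\<close> the
  empty word. The product \<open>(*)\<close> of the library on finitely supported functions
  \<open>'a word \<Rightarrow>\<^sub>0 qfield\<close> is then the one of the free unital algebra on \<open>'a\<close>.
  All generators are odd, so the parity of a word is its length modulo 2.
\<close>

datatype 'a word = Word (letters: "'a list")

instantiation word :: (type) monoid_add
begin

definition zero_word :: "'a word" where
  "0 = Word []"

definition plus_word :: "'a word \<Rightarrow> 'a word \<Rightarrow> 'a word" where
  "u + v = Word (letters u @ letters v)"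

instance
  by standard (simp_all add: zero_word_def plus_word_def)

end

type_synonym 'a free_algebra = "'a word \<Rightarrow>\<^sub>0 qfield"

definition of_word :: "'a list \<Rightarrow> 'a free_algebra" where
  "of_word w = Poly_Mapping.single (Word w) 1"

definition fscale :: "qfield \<Rightarrow> 'a free_algebra \<Rightarrow> 'a free_algebra" where
  "fscale c = Poly_Mapping.map ((*) c)"

definition fpart :: "bit \<Rightarrow> 'a free_algebra set" where
  "fpart i = {p. \<forall>w\<in>Poly_Mapping.keys p. of_nat (length (letters w)) = i}"

lemma lookup_fscale [simp]:
  "Poly_Mapping.lookup (fscale c p) w = c * Poly_Mapping.lookup p w"
  unfolding fscale_def by transfer (simp add: when_def)

lemma fscale_conv_mult: "fscale c p = Poly_Mapping.single 0 c * p"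
  unfolding fscale_def by (rule mult_map_scale_conv_mult)

lemma fscale_single [simp]:
  "fscale c (Poly_Mapping.single w d) = Poly_Mapping.single w (c * d)"
  by (simp add: fscale_conv_mult mult_single)

interpretation fvs: vector_space fscale
  by standard (auto intro!: poly_mapping_eqI simp: lookup_add algebra_simps)

lemma of_word_Nil: "of_word [] = 1"
  by (simp add: of_word_def flip: zero_word_def)

lemma of_word_append: "of_word (u @ v) = of_word u * of_word v"
  by (simp add: of_word_def mult_single plus_word_def)

lemma of_word_expand:
  "p = (\<Sum>w\<in>Poly_Mapping.keys p. fscale (Poly_Mapping.lookup p w) (of_word (letters w)))"
proof (rule poly_mapping_eqI)
  fix v
  show "Poly_Mapping.lookup p v = Poly_Mapping.lookup
      (\<Sum>w\<in>Poly_Mapping.keys p. fscale (Poly_Mapping.lookup p w) (of_word (letters w))) v"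
    by (simp add: lookup_sum of_word_def lookup_single when_def in_keys_iff
        if_distrib[of "\<lambda>x. _ * x"] cong: if_cong)
qed

lemma free_algebra_induct [case_names mono scale add]:
  assumes mono: "\<And>w. P (of_word w)"
    and scale: "\<And>c p. P p \<Longrightarrow> P (fscale c p)"
    and add: "\<And>p r. P p \<Longrightarrow> P r \<Longrightarrow> P (p + r)"
  shows "P p"
proof -
  have "P (fscale 0 (of_word []))"
    by (intro scale mono)
  then have zero: "P 0"
    by simp
  have "P (\<Sum>w\<in>W. fscale (Poly_Mapping.lookup p w) (of_word (letters w)))" if "finite W" for W
    using that by (induction W rule: finite_induct) (auto intro: zero mono scale add)
  from this[OF finite_keys[of p]] show ?thesis
    by (simp flip: of_word_expand)
qed

lemma fscale_mult_left: "fscale c p * r = fscale c (p * r)"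
  by (simp add: fscale_conv_mult mult.assoc)

lemma fscale_mult_right: "p * fscale c r = fscale c (p * r)"
proof (induction p rule: free_algebra_induct)
  case (mono w)
  have "Poly_Mapping.single (Word w) 1 * Poly_Mapping.single 0 c =
      Poly_Mapping.single 0 c * Poly_Mapping.single (Word w) (1::qfield)"
    by (simp add: mult_single)
  then show ?case
    by (simp add: fscale_conv_mult of_word_def flip: mult.assoc)
next
  case (scale d p)
  then show ?case
    by (metis fscale_mult_left fvs.scale_left_commute)
next
  case (add p r)
  then show ?case
    by (simp add: distrib_right fvs.scale_right_distrib)
qed

lemma of_word_fpart: "of_word w \<in> fpart (of_nat (length w))"
  by (simp add: fpart_def of_word_def)

lemma fpart_subspace: "fvs.subspace (fpart i)"
  unfolding fvs.subspace_def
proof (intro conjI ballI allI)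
  fix p r :: "'a free_algebra" assume "p \<in> fpart i" "r \<in> fpart i"
  then show "p + r \<in> fpart i"
    using keys_add[of p r] by (auto simp: fpart_def)
qed (auto simp: fpart_def in_keys_iff)

lemma fpart_mult: "p \<in> fpart i \<Longrightarrow> r \<in> fpart j \<Longrightarrow> p * r \<in> fpart (i + j)"
  using keys_mult[of p r] by (fastforce simp: fpart_def plus_word_def)

lift_definition fproj :: "bit \<Rightarrow> ('a word \<Rightarrow>\<^sub>0 'b::zero) \<Rightarrow> ('a word \<Rightarrow>\<^sub>0 'b)" is
  "\<lambda>i p w. if of_nat (length (letters w)) = i then p w else 0"
  by (erule rev_finite_subset) auto

lemma lookup_fproj [simp]: "Poly_Mapping.lookup (fproj i p) w =
    (if of_nat (length (letters w)) = i then Poly_Mapping.lookup p w else 0)"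
  by transfer simp

lemma fproj_fpart: "fproj i p \<in> fpart i"
  by (auto simp: fpart_def in_keys_iff split: if_splits)

lemma fproj_sum: "fproj 0 p + fproj 1 p = p"
  by (rule poly_mapping_eqI) (simp add: lookup_add)

lemma fproj_same: "p \<in> fpart i \<Longrightarrow> fproj i p = p"
  by (rule poly_mapping_eqI) (auto simp: fpart_def in_keys_iff)

lemma fproj_other: "p \<in> fpart i \<Longrightarrow> j \<noteq> i \<Longrightarrow> fproj j p = 0"
  by (rule poly_mapping_eqI) (auto simp: fpart_def in_keys_iff)

lemma fproj_add: "fproj i (p + r) = fproj i p + fproj i r"
  by (rule poly_mapping_eqI) (simp add: lookup_add)

lemma fproj_diff: "fproj i (p - r) = fproj i p - fproj i r"
  by (rule poly_mapping_eqI) (simp add: lookup_minus)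

lemma fproj_zero: "fproj i 0 = 0"
  by (rule poly_mapping_eqI) simp

lemma fproj_mult:
  fixes p r :: "'a free_algebra"
  shows "fproj i (p * r) = fproj 0 p * fproj i r + fproj 1 p * fproj (i + 1) r"
proof -
  let ?f = "\<lambda>a b. fproj a p * fproj b r"
  have m: "?f a b \<in> fpart (a + b)" for a b
    by (intro fpart_mult fproj_fpart)
  have "p * r = (fproj 0 p + fproj 1 p) * (fproj 0 r + fproj 1 r)"
    by (simp add: fproj_sum)
  also have "\<dots> = ?f 0 0 + ?f 0 1 + (?f 1 0 + ?f 1 1)"
    by (simp add: distrib_left distrib_right add_ac)
  finally have "fproj i (p * r) =
      fproj i (?f 0 0) + fproj i (?f 0 1) + (fproj i (?f 1 0) + fproj i (?f 1 1))"
    by (simp only: fproj_add)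
  then show ?thesis
    using m[of 0 0] m[of 0 1] m[of 1 0] m[of 1 1]
    by (cases i) (simp_all add: fproj_same fproj_other)
qed

lemma superalgebra_free: "superalgebra fscale (*) 1 fpart"
proof
  fix p :: "'a free_algebra"
  show "\<exists>b\<in>fpart 0. \<exists>c\<in>fpart 1. p = b + c"
    using fproj_fpart fproj_sum by metis
next
  show "fpart 0 \<inter> fpart 1 = {0 :: 'a free_algebra}"
    by (auto simp: fpart_def in_keys_iff intro!: poly_mapping_eqI)
next
  show "(1 :: 'a free_algebra) \<in> fpart 0"
    using of_word_fpart[of "[]"] by (simp add: of_word_Nil)
qed (rule fpart_mult | simp add: algebra_simps fscale_mult_left fscale_mult_right fpart_subspace)+


section \<open>The positive part of the quantum affine superalgebra\<close>

datatype generator = Gen_A | Gen_B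

abbreviation "fA \<equiv> of_word [Gen_A]"
abbreviation "fB \<equiv> of_word [Gen_B]"

definition serre_relator :: "'a free_algebra \<Rightarrow> 'a free_algebra \<Rightarrow> 'a free_algebra" where
  "serre_relator a b =
     a ^ 3 * b + fscale (qbrace 3) (a ^ 2 * b * a) - fscale (qbrace 3) (a * b * a ^ 2) - b * a ^ 3"

text \<open>
  Scalars need no rule of their own below: a scalar multiple is a product with a multiple
  of the empty word.
\<close>

inductive_set serre_ideal :: "generator free_algebra set" where
  relator_AB: "serre_relator fA fB \<in> serre_ideal"
| relator_BA: "serre_relator fB fA \<in> serre_ideal"
| zero: "0 \<in> serre_ideal"
| add: "p \<in> serre_ideal \<Longrightarrow> r \<in> serre_ideal \<Longrightarrow> p + r \<in> serre_ideal"
| mult_left: "p \<in> serre_ideal \<Longrightarrow> r * p \<in> serre_ideal"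
| mult_right: "p \<in> serre_ideal \<Longrightarrow> p * r \<in> serre_ideal"

lemma serre_ideal_uminus: "p \<in> serre_ideal \<Longrightarrow> - p \<in> serre_ideal"
  using serre_ideal.mult_left[of p "- 1"] by simp

lemma serre_ideal_diff: "p \<in> serre_ideal \<Longrightarrow> r \<in> serre_ideal \<Longrightarrow> p - r \<in> serre_ideal"
  using serre_ideal.add[OF _ serre_ideal_uminus] by fastforce

lemma serre_ideal_fscale: "p \<in> serre_ideal \<Longrightarrow> fscale c p \<in> serre_ideal"
  by (simp add: fscale_conv_mult serre_ideal.mult_left)

lemma serre_relator_fpart:
  assumes "a \<in> fpart 1" "b \<in> fpart 1"
  shows "serre_relator a b \<in> fpart 0"
proof -
  have *: "a * a * a * b \<in> fpart (1 + 1 + 1 + 1)" "a * a * b * a \<in> fpart (1 + 1 + 1 + 1)"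
    "a * b * (a * a) \<in> fpart (1 + 1 + (1 + 1))" "b * (a * a * a) \<in> fpart (1 + (1 + 1 + 1))"
    by (intro fpart_mult assms)+
  then show ?thesis
    by (auto simp: serre_relator_def power2_eq_square power3_eq_cube
        intro!: fvs.subspace_add fvs.subspace_diff fvs.subspace_scale fpart_subspace)
qed

lemma serre_ideal_fproj: "p \<in> serre_ideal \<Longrightarrow> fproj i p \<in> serre_ideal"
proof (induction arbitrary: i rule: serre_ideal.induct)
  case relator_AB
  have "serre_relator fA fB \<in> fpart 0"
    using of_word_fpart[of "[Gen_A]"] of_word_fpart[of "[Gen_B]"] by (intro serre_relator_fpart) auto
  then show ?case
    by (cases i) (auto simp: fproj_same fproj_other intro: serre_ideal.intros)
next
  case relator_BA
  have "serre_relator fB fA \<in> fpart 0"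
    using of_word_fpart[of "[Gen_A]"] of_word_fpart[of "[Gen_B]"] by (intro serre_relator_fpart) auto
  then show ?case
    by (cases i) (auto simp: fproj_same fproj_other intro: serre_ideal.intros)
qed (auto simp: fproj_zero fproj_add fproj_mult intro: serre_ideal.intros)

lemma lookup_mult_empty:
  fixes p r :: "'a free_algebra"
  shows "Poly_Mapping.lookup (p * r) 0 = Poly_Mapping.lookup p 0 * Poly_Mapping.lookup r 0"
proof (induction p rule: free_algebra_induct)
  case (mono u)
  show ?case
  proof (induction r rule: free_algebra_induct)
    case (mono v)
    show ?case
      unfolding of_word_append[symmetric]
      by (auto simp: lookup_single when_def zero_word_def of_word_def)
  qed (auto simp: fscale_mult_right lookup_add algebra_simps)
qed (auto simp: fscale_mult_left lookup_add algebra_simps)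

lemma lookup_of_word_Cons_empty [simp]: "Poly_Mapping.lookup (of_word (a # w)) 0 = 0"
  by (simp add: of_word_def lookup_single zero_word_def)

lemma serre_ideal_lookup_empty: "p \<in> serre_ideal \<Longrightarrow> Poly_Mapping.lookup p 0 = 0"
  by (induction rule: serre_ideal.induct)
    (simp_all add: serre_relator_def lookup_add lookup_minus lookup_mult_empty)

quotient_type uqplus = "generator free_algebra" / "\<lambda>p r. p - r \<in> serre_ideal"
proof (rule equivpI)
  show "reflp (\<lambda>p r. p - r \<in> serre_ideal)"
    by (rule reflpI) (simp add: serre_ideal.zero)
  show "symp (\<lambda>p r. p - r \<in> serre_ideal)"
    by (rule sympI) (metis minus_diff_eq serre_ideal_uminus)
  show "transp (\<lambda>p r. p - r \<in> serre_ideal)"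
  proof (rule transpI)
    fix p r s :: "generator free_algebra"
    assume "p - r \<in> serre_ideal" "r - s \<in> serre_ideal"
    then have "(p - r) + (r - s) \<in> serre_ideal"
      by (rule serre_ideal.add)
    then show "p - s \<in> serre_ideal"
      by simp
  qed
qed

instantiation uqplus :: ring_1
begin

lift_definition zero_uqplus :: uqplus is 0 .

lift_definition one_uqplus :: uqplus is 1 .

lift_definition plus_uqplus :: "uqplus \<Rightarrow> uqplus \<Rightarrow> uqplus" is "(+)"
  by (drule serre_ideal.add, assumption) (simp add: algebra_simps)

lift_definition minus_uqplus :: "uqplus \<Rightarrow> uqplus \<Rightarrow> uqplus" is "(-)"
  by (drule serre_ideal_diff, assumption) (simp add: algebra_simps)

lift_definition uminus_uqplus :: "uqplus \<Rightarrow> uqplus" is uminus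
  by (drule serre_ideal_uminus) (simp add: algebra_simps)

lift_definition times_uqplus :: "uqplus \<Rightarrow> uqplus \<Rightarrow> uqplus" is "(*)"
proof -
  fix a b c d :: "generator free_algebra"
  assume "a - b \<in> serre_ideal" "c - d \<in> serre_ideal"
  then have "(a - b) * c + b * (c - d) \<in> serre_ideal"
    by (intro serre_ideal.intros)
  then show "a * c - b * d \<in> serre_ideal"
    by (simp add: algebra_simps)
qed

instance
proof
  show "(0::uqplus) \<noteq> 1"
    by transfer (use serre_ideal_lookup_empty in fastforce)
qed (transfer, simp add: algebra_simps serre_ideal.zero)+

end

lift_definition uq_A :: uqplus is fA .

lift_definition uq_B :: uqplus is fB .

lift_definition uq_scale :: "qfield \<Rightarrow> uqplus \<Rightarrow> uqplus" is fscale
  by (drule serre_ideal_fscale) (simp add: fvs.scale_right_diff_distrib)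

definition uq_part :: "bit \<Rightarrow> uqplus set" where
  "uq_part i = abs_uqplus ` fpart i"

lemma uqplus_cases: obtains p where "x = abs_uqplus p"
  using Quotient_abs_rep[OF Quotient_uqplus, of x, symmetric] by (rule that)

lemma vector_space_uqplus: "vector_space uq_scale"
proof
  fix a b :: qfield and x y :: uqplus
  obtain p where x: "x = abs_uqplus p"
    by (rule uqplus_cases)
  obtain r where y: "y = abs_uqplus r"
    by (rule uqplus_cases)
  show "uq_scale a (x + y) = uq_scale a x + uq_scale a y"
    "uq_scale (a + b) x = uq_scale a x + uq_scale b x"
    "uq_scale a (uq_scale b x) = uq_scale (a * b) x"
    "uq_scale 1 x = x"
    unfolding x y uq_scale.abs_eq plus_uqplus.abs_eq
    by (simp_all only: fvs.vector_space_assms)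
qed

lemma superalgebra_uqplus: "superalgebra uq_scale (*) 1 uq_part"
proof -
  interpret F: superalgebra fscale "(*)" 1 "fpart :: bit \<Rightarrow> generator free_algebra set"
    by (rule superalgebra_free)
  interpret U: vector_space uq_scale
    by (rule vector_space_uqplus)
  show ?thesis
  proof
    fix i
    have "0 \<in> uq_part i"
      unfolding uq_part_def
      by (rule image_eqI[of _ _ 0]) (auto simp: zero_uqplus.abs_eq fvs.subspace_0 fpart_subspace)
    moreover have "x + y \<in> uq_part i" if "x \<in> uq_part i" "y \<in> uq_part i" for x y
      using that unfolding uq_part_def
      by (auto simp: plus_uqplus.abs_eq intro!: imageI fvs.subspace_add fpart_subspace)
    moreover have "uq_scale c x \<in> uq_part i" if "x \<in> uq_part i" for c x
      using that unfolding uq_part_def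
      by (auto simp: uq_scale.abs_eq intro!: imageI fvs.subspace_scale fpart_subspace)
    ultimately show "U.subspace (uq_part i)"
      by (simp add: U.subspace_def)
  next
    have "abs_uqplus p = 0" if "p \<in> fpart 0" "r \<in> fpart 1" "abs_uqplus p = abs_uqplus r" for p r
    proof -
      have "p - r \<in> serre_ideal"
        using that(3) by (simp add: uqplus.abs_eq_iff)
      then have "fproj 0 (p - r) \<in> serre_ideal"
        by (rule serre_ideal_fproj)
      moreover have "fproj 0 (p - r) = p"
        using that by (simp add: fproj_diff fproj_same fproj_other)
      ultimately show ?thesis
        by (simp add: zero_uqplus.abs_eq uqplus.abs_eq_iff)
    qed
    moreover have "0 \<in> uq_part i" for i
      unfolding uq_part_def
      by (rule image_eqI[of _ _ 0]) (auto simp: zero_uqplus.abs_eq fvs.subspace_0 fpart_subspace)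
    ultimately show "uq_part 0 \<inter> uq_part 1 = {0}"
      unfolding uq_part_def by blast
  next
    fix x :: uqplus
    obtain p where "x = abs_uqplus p"
      by (rule uqplus_cases)
    then have "x = abs_uqplus (fproj 0 p) + abs_uqplus (fproj 1 p)"
      by (simp add: plus_uqplus.abs_eq fproj_sum)
    then show "\<exists>b\<in>uq_part 0. \<exists>c\<in>uq_part 1. x = b + c"
      unfolding uq_part_def using fproj_fpart by blast
  next
    show "1 \<in> uq_part 0"
      unfolding uq_part_def using F.unit_part by (simp add: one_uqplus.abs_eq)
  next
    fix x y i j assume "x \<in> uq_part i" "y \<in> uq_part j"
    then obtain p r where "p \<in> fpart i" "r \<in> fpart j" "x = abs_uqplus p" "y = abs_uqplus r"
      unfolding uq_part_def by blast
    then show "x * y \<in> uq_part (i + j)"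
      unfolding uq_part_def using fpart_mult[of p i r j] by (simp only: times_uqplus.abs_eq imageI)
  next
    fix k x y
    obtain p where x: "x = abs_uqplus p"
      by (rule uqplus_cases)
    obtain r where y: "y = abs_uqplus r"
      by (rule uqplus_cases)
    show "uq_scale k x * y = uq_scale k (x * y)" "x * uq_scale k y = uq_scale k (x * y)"
      unfolding x y uq_scale.abs_eq times_uqplus.abs_eq
      by (simp_all only: fscale_mult_left fscale_mult_right)
  qed (simp_all only: mult.assoc distrib_left distrib_right mult_1_left mult_1_right)
qed


section \<open>The q-shuffle superalgebra\<close>

datatype letter = Letter_x | Letter_y

type_synonym shuffle_space = "letter free_algebra"

definition form :: "letter \<Rightarrow> letter \<Rightarrow> int" where
  "form a b = (if a = b then 2 else - 2)"

fun shuffle_word :: "letter list \<Rightarrow> letter list \<Rightarrow> shuffle_space" where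
  "shuffle_word [] v = of_word v"
| "shuffle_word u [] = of_word u"
| "shuffle_word (a # u) (b # v) =
     of_word [a] * shuffle_word u (b # v)
     + fscale ((-1) ^ length (a # u) * q powi (\<Sum>c\<leftarrow>a # u. form c b))
         (of_word [b] * shuffle_word (a # u) v)"

definition shuffle :: "shuffle_space \<Rightarrow> shuffle_space \<Rightarrow> shuffle_space" (infixl \<open>\<star>\<close> 70) where
  "f \<star> g = (\<Sum>u\<in>Poly_Mapping.keys f. \<Sum>v\<in>Poly_Mapping.keys g.
     fscale (Poly_Mapping.lookup f u * Poly_Mapping.lookup g v)
       (shuffle_word (letters u) (letters v)))"

lemma shuffle_superset:
  assumes "finite U" "Poly_Mapping.keys f \<subseteq> U" "finite V" "Poly_Mapping.keys g \<subseteq> V"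
  shows "f \<star> g = (\<Sum>u\<in>U. \<Sum>v\<in>V.
    fscale (Poly_Mapping.lookup f u * Poly_Mapping.lookup g v)
      (shuffle_word (letters u) (letters v)))"
proof -
  let ?h = "\<lambda>u v. fscale (Poly_Mapping.lookup f u * Poly_Mapping.lookup g v)
      (shuffle_word (letters u) (letters v))"
  have "f \<star> g = (\<Sum>u\<in>Poly_Mapping.keys f. \<Sum>v\<in>V. ?h u v)"
    unfolding shuffle_def
    by (intro sum.cong refl sum.mono_neutral_left assms) (auto simp: in_keys_iff)
  also have "\<dots> = (\<Sum>u\<in>U. \<Sum>v\<in>V. ?h u v)"
    by (intro sum.mono_neutral_left assms) (auto simp: in_keys_iff)
  finally show ?thesis .
qed

lemma shuffle_add_left: "(f + f') \<star> g = f \<star> g + f' \<star> g"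
proof -
  define U where "U = Poly_Mapping.keys f \<union> Poly_Mapping.keys f'"
  have U: "finite U" "Poly_Mapping.keys f \<subseteq> U" "Poly_Mapping.keys f' \<subseteq> U"
    "Poly_Mapping.keys (f + f') \<subseteq> U"
    using keys_add[of f f'] by (auto simp: U_def)
  show ?thesis
    unfolding U(2-4)[THEN shuffle_superset[OF U(1) _ finite_keys subset_refl]]
    by (simp add: lookup_add distrib_right fvs.scale_left_distrib sum.distrib)
qed

lemma shuffle_add_right: "f \<star> (g + g') = f \<star> g + f \<star> g'"
proof -
  define U where "U = Poly_Mapping.keys g \<union> Poly_Mapping.keys g'"
  have U: "finite U" "Poly_Mapping.keys g \<subseteq> U" "Poly_Mapping.keys g' \<subseteq> U"
    "Poly_Mapping.keys (g + g') \<subseteq> U"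
    using keys_add[of g g'] by (auto simp: U_def)
  show ?thesis
    unfolding U(2-4)[THEN shuffle_superset[OF finite_keys subset_refl U(1)]]
    by (simp add: lookup_add distrib_left fvs.scale_left_distrib sum.distrib)
qed

lemma keys_fscale: "Poly_Mapping.keys (fscale c p) \<subseteq> Poly_Mapping.keys p"
  by (auto simp: in_keys_iff)

lemma shuffle_scale_left: "fscale c f \<star> g = fscale c (f \<star> g)"
  unfolding shuffle_superset[OF finite_keys keys_fscale finite_keys subset_refl]
  by (simp add: shuffle_def fvs.scale_sum_right mult_ac)

lemma shuffle_scale_right: "f \<star> fscale c g = fscale c (f \<star> g)"
  unfolding shuffle_superset[OF finite_keys subset_refl finite_keys keys_fscale]
  by (simp add: shuffle_def fvs.scale_sum_right mult_ac)

lemmas shuffle_bilinear =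
  shuffle_add_left shuffle_add_right shuffle_scale_left shuffle_scale_right

lemma shuffle_of_word: "of_word u \<star> of_word v = shuffle_word u v"
  by (simp add: shuffle_def of_word_def)

lemma shuffle_word_Nil_right: "shuffle_word u [] = of_word u"
  by (cases u) auto

lemma shuffle_one_left: "1 \<star> f = f"
  by (induction f rule: free_algebra_induct)
    (simp_all add: shuffle_bilinear shuffle_of_word flip: of_word_Nil)

lemma shuffle_one_right: "f \<star> 1 = f"
  by (induction f rule: free_algebra_induct)
    (simp_all add: shuffle_bilinear shuffle_of_word shuffle_word_Nil_right flip: of_word_Nil)

lemma q_neq_0: "q \<noteq> 0"
  by (simp add: q_def eq_fract Zero_fract_def)

text \<open>The operator \<open>twist b\<close> scales a word by the factor that it
  contributes when \<open>b\<close> is moved across it.\<close>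

definition cross :: "letter \<Rightarrow> letter list \<Rightarrow> qfield" where
  "cross b w = (-1) ^ length w * q powi (\<Sum>c\<leftarrow>w. form c b)"

lift_definition rescale :: "('a \<Rightarrow> 'b::mult_zero) \<Rightarrow> ('a \<Rightarrow>\<^sub>0 'b) \<Rightarrow> ('a \<Rightarrow>\<^sub>0 'b)" is
  "\<lambda>h p w. h w * p w"
  by (erule rev_finite_subset) auto

lemma lookup_rescale [simp]: "Poly_Mapping.lookup (rescale h p) w = h w * Poly_Mapping.lookup p w"
  by transfer simp

definition twist :: "letter \<Rightarrow> shuffle_space \<Rightarrow> shuffle_space" where
  "twist b = rescale (cross b \<circ> letters)"

lemma twist_add: "twist b (p + r) = twist b p + twist b r"
  unfolding twist_def by (rule poly_mapping_eqI) (simp add: lookup_add distrib_left)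

lemma twist_scale: "twist b (fscale c p) = fscale c (twist b p)"
  unfolding twist_def by (rule poly_mapping_eqI) simp

lemma twist_of_word: "twist b (of_word w) = fscale (cross b w) (of_word w)"
  unfolding twist_def of_word_def
  by (rule poly_mapping_eqI) (auto simp: lookup_single when_def)

lemma cross_append: "cross b (u @ v) = cross b u * cross b v"
  by (simp add: cross_def power_add power_int_add q_neq_0)

lemma twist_mult: "twist b (p * r) = twist b p * twist b r"
proof (induction p rule: free_algebra_induct)
  case (mono u)
  show ?case
  proof (induction r rule: free_algebra_induct)
    case (mono v)
    show ?case
      unfolding of_word_append[symmetric] twist_of_word
      by (simp add: fscale_mult_left fscale_mult_right cross_append of_word_append)
  qed (simp_all add: fscale_mult_right twist_add twist_scale distrib_left)
qed (simp_all add: fscale_mult_left twist_add twist_scale distrib_right)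

lemma shuffle_word_rec:
  "shuffle_word (a # u) (b # v) = of_word [a] * shuffle_word u (b # v)
     + fscale (cross b (a # u)) (of_word [b] * shuffle_word (a # u) v)"
  by (simp add: cross_def)

lemma twist_shuffle_word:
  "twist b (shuffle_word u v) = fscale (cross b u * cross b v) (shuffle_word u v)"
proof (induction u v rule: shuffle_word.induct)
  case (3 a u c v)
  have cr: "cross b (a # u) = cross b [a] * cross b u" "cross b (c # v) = cross b [c] * cross b v"
    using cross_append[of b "[a]" u] cross_append[of b "[c]" v] by simp_all
  show ?case
    unfolding shuffle_word_rec twist_add twist_mult twist_scale twist_of_word 3
      fscale_mult_left fscale_mult_right fvs.scale_right_distrib fvs.scale_scale
    unfolding cr by (simp only: mult_ac)
qed (simp_all add: twist_of_word cross_def)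

lemma twist_shuffle: "twist b (f \<star> g) = twist b f \<star> twist b g"
proof (induction f rule: free_algebra_induct)
  case (mono u)
  show ?case
    by (induction g rule: free_algebra_induct)
      (simp_all add: shuffle_bilinear twist_add twist_scale twist_of_word shuffle_of_word
        twist_shuffle_word)
qed (simp_all add: shuffle_bilinear twist_add twist_scale)

lemma shuffle_rec:
  "(of_word [a] * f) \<star> (of_word [b] * g) =
     of_word [a] * (f \<star> (of_word [b] * g)) + of_word [b] * (twist b (of_word [a] * f) \<star> g)"
proof (induction f rule: free_algebra_induct)
  case (mono u)
  show ?case
  proof (induction g rule: free_algebra_induct)
    case (mono v)
    show ?case
      unfolding of_word_append[symmetric] twist_of_word
      by (simp add: shuffle_bilinear shuffle_of_word fscale_mult_right shuffle_word_rec
          del: shuffle_word.simps(3))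
  next
    case (scale c p)
    then show ?case
      by (simp add: shuffle_bilinear fscale_mult_right fvs.scale_right_distrib)
  next
    case (add p r)
    then show ?case
      by (simp add: shuffle_bilinear distrib_left algebra_simps)
  qed
next
  case (scale c p)
  then show ?case
    by (simp add: shuffle_bilinear twist_scale fscale_mult_right fvs.scale_right_distrib)
next
  case (add p r)
  then show ?case
    by (simp add: shuffle_bilinear twist_add distrib_left algebra_simps)
qed

lemma shuffle_assoc_of_word:
  "(of_word u \<star> of_word v) \<star> of_word w = of_word u \<star> (of_word v \<star> of_word w)"
proof (induction "length u + length v + length w" arbitrary: u v w rule: less_induct)
  case less
  show ?case
  proof (cases "u = [] \<or> v = [] \<or> w = []")
    case True
    then show ?thesis
      by (auto simp: of_word_Nil shuffle_one_left shuffle_one_right)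
  next
    case False
    then obtain a u' b v' c w' where uvw: "u = a # u'" "v = b # v'" "w = c # w'"
      by (metis neq_Nil_conv)
    let ?L = "of_word :: letter list \<Rightarrow> shuffle_space"
    have L: "?L u = ?L [a] * ?L u'" "?L v = ?L [b] * ?L v'" "?L w = ?L [c] * ?L w'"
      unfolding uvw of_word_append[symmetric] by simp_all
    have uv: "?L u \<star> ?L v = ?L [a] * (?L u' \<star> ?L v) + ?L [b] * (twist b (?L u) \<star> ?L v')"
      using shuffle_rec[of a "?L u'" b "?L v'"] by (simp only: L)
    have vw: "?L v \<star> ?L w = ?L [b] * (?L v' \<star> ?L w) + ?L [c] * (twist c (?L v) \<star> ?L w')"
      using shuffle_rec[of b "?L v'" c "?L w'"] by (simp only: L)
    have "(?L u \<star> ?L v) \<star> ?L w =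
        ?L [a] * ((?L u' \<star> ?L v) \<star> ?L w) + ?L [b] * ((twist b (?L u) \<star> ?L v') \<star> ?L w)
        + ?L [c] * (twist c (?L u \<star> ?L v) \<star> ?L w')"
      unfolding uv unfolding L(3) shuffle_add_left shuffle_rec twist_add
      by (simp add: shuffle_add_left distrib_left add_ac)
    moreover have "?L u \<star> (?L v \<star> ?L w) =
        ?L [a] * (?L u' \<star> (?L v \<star> ?L w)) + ?L [b] * (twist b (?L u) \<star> (?L v' \<star> ?L w))
        + ?L [c] * (twist c (?L u) \<star> (twist c (?L v) \<star> ?L w'))"
      unfolding vw unfolding L(1) shuffle_add_right shuffle_rec
      by (simp add: shuffle_add_right distrib_left add_ac)
    moreover have "(?L u' \<star> ?L v) \<star> ?L w = ?L u' \<star> (?L v \<star> ?L w)"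
      "(?L u \<star> ?L v') \<star> ?L w = ?L u \<star> (?L v' \<star> ?L w)"
      "(?L u \<star> ?L v) \<star> ?L w' = ?L u \<star> (?L v \<star> ?L w')"
      by (intro less; simp add: uvw)+
    ultimately show ?thesis
      by (simp add: twist_shuffle twist_of_word shuffle_bilinear)
  qed
qed

lemma shuffle_assoc: "(f \<star> g) \<star> h = f \<star> (g \<star> h)"
proof (induction f rule: free_algebra_induct)
  case (mono u)
  show ?case
  proof (induction g rule: free_algebra_induct)
    case (mono v)
    show ?case
      by (induction h rule: free_algebra_induct)
        (simp_all add: shuffle_bilinear shuffle_assoc_of_word)
  qed (simp_all add: shuffle_bilinear)
qed (simp_all add: shuffle_bilinear)

lemma shuffle_word_fpart: "shuffle_word u v \<in> fpart (of_nat (length u) + of_nat (length v))"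
proof (induction u v rule: shuffle_word.induct)
  case (1 v)
  show ?case
    using of_word_fpart[of v] by (simp only: shuffle_word.simps list.size of_nat_0 add_0_left)
next
  case (2 a u)
  show ?case
    using of_word_fpart[of "a # u"]
    by (simp only: shuffle_word.simps list.size(3) of_nat_0 add_0_right)
next
  case (3 a u b v)
  let ?i = "of_nat (length (a # u)) + of_nat (length (b # v)) :: bit"
  have "of_nat (length [a]) + (of_nat (length u) + of_nat (length (b # v))) = ?i"
    "of_nat (length [b]) + (of_nat (length (a # u)) + of_nat (length v)) = ?i"
    by (cases "of_nat (length u) :: bit"; cases "of_nat (length v) :: bit"; simp)+
  with fpart_mult[OF of_word_fpart[of "[a]"] 3(1)] fpart_mult[OF of_word_fpart[of "[b]"] 3(2)]
  have "of_word [a] * shuffle_word u (b # v) \<in> fpart ?i"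
    "of_word [b] * shuffle_word (a # u) v \<in> fpart ?i"
    by (simp_all only:)
  then show ?case
    unfolding shuffle_word.simps
    by (intro fvs.subspace_add fvs.subspace_scale fpart_subspace)
qed

lemma shuffle_fpart:
  assumes "f \<in> fpart i" "g \<in> fpart j"
  shows "f \<star> g \<in> fpart (i + j)"
proof -
  have "shuffle_word (letters u) (letters v) \<in> fpart (i + j)"
    if "u \<in> Poly_Mapping.keys f" "v \<in> Poly_Mapping.keys g" for u v
    using that assms shuffle_word_fpart[of "letters u" "letters v"] by (auto simp: fpart_def)
  then show ?thesis
    unfolding shuffle_def
    by (intro fvs.subspace_sum fpart_subspace fvs.subspace_scale)
qed

lemma superalgebra_shuffle: "superalgebra fscale (\<star>) 1 fpart"
proof -
  interpret F: superalgebra fscale "(*)" 1 "fpart :: bit \<Rightarrow> shuffle_space set"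
    by (rule superalgebra_free)
  show ?thesis
    by standard (rule shuffle_fpart | simp add: shuffle_assoc shuffle_bilinear shuffle_one_left
        shuffle_one_right fpart_subspace F.part_inter F.part_sum F.unit_part)+
qed

lemma shuffle_xy:
  "of_word [Letter_x] \<star> of_word [Letter_y] =
     of_word [Letter_x, Letter_y] - fscale (q powi (- 2)) (of_word [Letter_y, Letter_x])"
  by (simp add: shuffle_of_word form_def flip: of_word_append)

lemma shuffle_xx:
  "of_word [Letter_x] \<star> of_word [Letter_x] = fscale (1 - q ^ 2) (of_word [Letter_x, Letter_x])"
  by (simp add: shuffle_of_word form_def fvs.scale_left_diff_distrib flip: of_word_append)

end

theory Submission
  imports Defs Complex_Main
begin

text \<open>
  Write \<open>tq = - q\<^sup>2\<close>. In the q-shuffle product a letter passing an equal letter picks up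
  \<open>tq\<close>, and a letter passing the other one picks up \<open>inverse tq\<close>. Let \<open>phi\<close> be the algebra
  homomorphism from the free algebra to the shuffle superalgebra that sends the two
  generators to the two letters. Both cubic relators are killed by \<open>phi\<close>, so \<open>phi\<close> descends
  to \<open>uqplus\<close>; everything else is the proof that the kernel of \<open>phi\<close> is no larger than the
  ideal of the relators (\<open>kernel_phi\<close>).

  The tool is deletion of a letter. Reading off the first letter of a shuffle product shows
  that the kernel is stable under the operator \<open>del_left g\<close>, which deletes each occurrence
  of \<open>g\<close> from a word with weight the factors picked up on the way to the front; reading off
  the last letter gives stability under its mirror image \<open>del_right g\<close>. Now specialise \<open>q\<close>
  to \<open>\<i>\<close>, where \<open>tq = 1\<close>. There both operators become the same derivation \<open>pd g\<close>, so their
  difference is divisible by \<open>tq - 1\<close>, and the quotient \<open>del_diff g\<close> is a third operator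
  that preserves the kernel and has a limit \<open>sd g\<close> at \<open>q = \<i>\<close>. Hence, by induction on the
  length of words, if \<open>u\<close> lies in the kernel and its coefficients are regular at \<open>\<i>\<close>, then
  the value \<open>v\<close> of \<open>u\<close> at \<open>\<i>\<close> is annihilated by all \<open>pd g\<close> and \<open>sd g\<close> modulo the classical
  Serre relations.

  The classical algebra is the enveloping algebra of the positive part of the affine Lie
  algebra of \<open>sl\<^sub>2\<close>, and here such a \<open>v\<close> must be a scalar (\<open>common_kernel_scalar\<close>), hence
  zero, as elements of the kernel have no constant term. The Serre relations give root
  vectors \<open>ra n\<close>, \<open>rb n\<close>, \<open>rd n\<close>, whose brackets are those of \<open>e t\<^sup>n\<close>, \<open>f t\<^bsup>n+1\<^esup>\<close>,
  \<open>h t\<^bsup>n+1\<^esup>\<close> in the loop algebra, up to normalisation. On root vectors \<open>sd\<close> acts as lowering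
  by a simple root, so that for each root vector a composition of operators \<open>sd\<close> ending in a
  \<open>pd\<close> detects this root vector and kills all later ones. Applying these compositions in
  order of height removes one root vector after the other from an ordered expansion of \<open>v\<close>.

  So every integral element of the kernel becomes, at \<open>\<i>\<close>, a combination of the classical
  relators. For words of bounded length there are only finitely many products of relators
  with words, and Gaussian elimination over the ring of functions regular at \<open>\<i>\<close> lifts this
  to the ground field (\<open>span_lift\<close>, a form of Nakayama's lemma).
\<close>

section \<open>Root vectors from the cubic Serre relations\<close>

definition comm :: "'u::ring \<Rightarrow> 'u \<Rightarrow> 'u" where
  "comm u v = u * v - v * u"

lemma comm_self [simp]: "comm u u = 0"
  and comm_zero [simp]: "comm 0 u = 0" "comm u 0 = 0"
  by (simp_all add: comm_def)

lemma comm_one [simp]: "comm 1 u = 0" "comm u 1 = (0 :: 'u :: ring_1)"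
  by (simp_all add: comm_def)

lemma comm_swap: "comm v u = - comm u v"
  by (simp add: comm_def)

lemma comm_minus_left: "comm (- u) v = - comm u v"
  and comm_minus_right: "comm u (- v) = - comm u v"
  by (simp_all add: comm_def)

lemma jacobi: "comm u (comm v w) = comm (comm u v) w + comm v (comm u w)"
  by (simp add: comm_def algebra_simps)

text \<open>
  The derivation of the root vector relations cancels 2 and arbitrarily large integers
  \<open>n + 2\<close>; freeness from torsion stands for a ground field of characteristic 0.
\<close>

locale serre_pair =
  fixes x y :: "'u::ring_1"
  assumes torsion_free: "of_nat (Suc n) * u = 0 \<Longrightarrow> (u::'u) = 0"
    and serre_x: "comm x (comm x (comm x y)) = 0"
    and serre_y: "comm y (comm y (comm y x)) = 0"
begin

text \<open>
  In the loop algebra of \<open>sl\<^sub>2\<close> with \<open>x = e\<close> and \<open>y = f t\<close> these are \<open>ra n = 2\<^sup>n e t\<^sup>n\<close>,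
  \<open>rb n = 2\<^sup>n f t\<^bsup>n+1\<^esup>\<close> and \<open>rd n = 2\<^sup>n h t\<^bsup>n+1\<^esup>\<close>. The powers of 2 make all structure
  constants below \<open>\<plusminus>1\<close>.
\<close>

primrec ra :: "nat \<Rightarrow> 'u" where
  "ra 0 = x"
| "ra (Suc n) = comm (comm x y) (ra n)"

primrec rb :: "nat \<Rightarrow> 'u" where
  "rb 0 = y"
| "rb (Suc n) = comm (rb n) (comm x y)"

definition rd :: "nat \<Rightarrow> 'u" where
  "rd n = comm (ra n) y"

definition root_relations_upto :: "nat \<Rightarrow> bool" where
  "root_relations_upto n \<longleftrightarrow>
     (\<forall>i j. i + j \<le> n \<longrightarrow> comm (ra i) (ra j) = 0) \<and>
     (\<forall>i j. i + j \<le> n \<longrightarrow> comm (rb i) (rb j) = 0) \<and>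
     (\<forall>i j. i + j \<le> n \<longrightarrow> comm (ra i) (rb j) = rd (i + j)) \<and>
     (\<forall>i j. Suc (i + j) \<le> n \<longrightarrow> comm (rd i) (ra j) = ra (Suc (i + j))) \<and>
     (\<forall>i j. Suc (i + j) \<le> n \<longrightarrow> comm (rd i) (rb j) = - rb (Suc (i + j)))"

text \<open>
  With \<open>s p = comm (r p) (r (Suc n - p))\<close> the assumption says that a shift of \<open>p\<close> by any
  \<open>k + 1\<close> changes the sign of \<open>s\<close>. Shifts by 1 and by 2 then contradict each other unless
  \<open>s = 0\<close>; for \<open>n = 0\<close> there is no room for a shift by 2, and the Serre relation enters.
\<close>

lemma comm_family_zero:
  fixes r :: "nat \<Rightarrow> 'u"
  assumes shift: "\<And>k p l. k + p + l = n \<Longrightarrow> comm (r (Suc (k + p))) (r l) + comm (r p) (r (Suc (k + l))) = 0"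
    and base: "comm (r 0) (r 1) = 0" and "i + j = Suc n"
  shows "comm (r i) (r j) = 0"
proof -
  define s where "s p = comm (r p) (r (Suc n - p))" for p
  have s: "s (Suc (k + p)) = - s p" if "k + p \<le> n" for k p
  proof -
    have "Suc n - Suc (k + p) = n - k - p" "Suc n - p = Suc (k + (n - k - p))"
      using that by auto
    then show ?thesis
      using shift[of k p "n - k - p"] that by (simp add: s_def eq_neg_iff_add_eq_0)
  qed
  have "s 0 = 0"
  proof (cases "n = 0")
    case True
    with base show ?thesis
      by (simp add: s_def)
  next
    case False
    (* Two unit shifts give s 2 = s 0, a single shift by two gives s 2 = - s 0. *)
    then have "s 0 = - s 0"
      using s[of 0 0] s[of 0 1] s[of 1 0] by (simp add: numeral_2_eq_2)
    then have "of_nat (Suc 1) * s 0 = 0"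
      by (simp add: mult_2 eq_neg_iff_add_eq_0)
    then show ?thesis
      by (rule torsion_free)
  qed
  then have "s p = 0" if "p \<le> Suc n" for p
    using that s[of 0] by (induction p) auto
  from this[of i] assms(3) show ?thesis
    by (auto simp: s_def) (metis assms(3) diff_add_inverse)
qed

text \<open>
  Each relation of level \<open>n + 1\<close> comes from the Jacobi identity for a bracket that can be
  expanded in two ways. The order matters: first the action of \<open>rd\<close> on \<open>ra\<close> and \<open>rb\<close>, where
  writing \<open>rd k\<close> as a bracket moves the whole index to one side; then the brackets
  \<open>comm (ra i) (rb j)\<close>, whose differences are brackets \<open>comm (rd k) (rd l)\<close>; last the
  brackets within one family.
\<close>

lemma root_relations_step:
  assumes "root_relations_upto n"
  shows "root_relations_upto (Suc n)"
proof -
  have aa: "comm (ra i) (ra j) = 0" and bb: "comm (rb i) (rb j) = 0"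
    and ab: "comm (ra i) (rb j) = rd (i + j)" if "i + j \<le> n" for i j
    using assms that by (auto simp: root_relations_upto_def)
  have da: "comm (rd i) (ra j) = ra (Suc (i + j))" if "Suc (i + j) \<le> Suc n" for i j
  proof (cases "i + j = n")
    case True
    have *: "comm (rd k) (ra l) = comm (rd n) (ra 0)" if "k + l = n" for k l
    proof -
      have "comm (comm (ra 0) (rb k)) (ra l) = - comm (ra 0) (comm (ra l) (rb k))"
        using jacobi[of "ra l" "ra 0" "rb k"] aa[of l 0] that
          comm_swap[of "ra l" "comm (ra 0) (rb k)"] by simp
      then show ?thesis
        using that ab[of 0 k] ab[of l k] by (simp add: comm_swap[of x "rd n"] add.commute)
    qed
    show ?thesis
      using *[of i j] *[of 0 n] True by (simp add: rd_def)
  next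
    case False
    then show ?thesis
      using assms that by (auto simp: root_relations_upto_def)
  qed
  have db: "comm (rd i) (rb j) = - rb (Suc (i + j))" if "Suc (i + j) \<le> Suc n" for i j
  proof (cases "i + j = n")
    case True
    have *: "comm (rd k) (rb l) = comm (rd n) (rb 0)" if "k + l = n" for k l
    proof -
      have "comm (rb l) (comm (ra k) (rb 0)) = - comm (comm (ra k) (rb l)) (rb 0)"
        using jacobi[of "rb l" "ra k" "rb 0"] bb[of l 0] that comm_swap[of "rb l" "ra k"]
        by (simp add: comm_minus_left)
      then show ?thesis
        using that ab[of k 0] ab[of k l] by (simp add: comm_swap[of "rb l" "rd _"])
    qed
    show ?thesis
      using *[of i j] *[of 0 n] True by (simp add: rd_def comm_swap[of "comm x y"])
  next
    case False
    then show ?thesis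
      using assms that by (auto simp: root_relations_upto_def)
  qed
  have ab': "comm (ra i) (rb j) = rd (i + j)" if "i + j \<le> Suc n" for i j
  proof (cases "i + j = Suc n")
    case True
    (* Neighbouring values of g differ by the same c; antisymmetry of comm (rd 0) (rd n) gives (n + 1) c = - c. *)
    define g where "g p = comm (ra p) (rb (Suc n - p))" for p
    have dd: "comm (rd k) (rd l) = g (Suc (k + p)) - g p" if "k + l = n" "p \<le> l" for k l p
    proof -
      have "comm (rd k) (comm (ra p) (rb (l - p))) =
          comm (ra (Suc (k + p))) (rb (l - p)) - comm (ra p) (rb (Suc (k + (l - p))))"
        using that jacobi[of "rd k" "ra p" "rb (l - p)"]
        by (simp add: da db comm_minus_right)
      moreover have "Suc n - Suc (k + p) = l - p" "Suc n - p = Suc (k + (l - p))"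
        using that by auto
      ultimately show ?thesis
        using that by (simp add: ab g_def)
    qed
    define c where "c = comm (rd 0) (rd n)"
    have step: "g (Suc p) = g p + c" if "p \<le> n" for p
      using dd[of 0 n p] that by (simp add: c_def algebra_simps)
    have gp: "g p = g 0 + of_nat p * c" if "p \<le> Suc n" for p
      using that by (induction p) (simp_all add: step algebra_simps)
    have "- c = g (Suc n) - g 0"
      using dd[of n 0 0] comm_swap[of "rd n" "rd 0"] by (simp add: c_def)
    then have "of_nat (Suc n) * c = - c"
      using gp[of "Suc n"] by (simp del: of_nat_Suc)
    then have "of_nat (Suc (Suc n)) * c = 0"
      by (simp add: of_nat_Suc[of "Suc n"] distrib_right del: of_nat_Suc)
    then have "c = 0"
      by (rule torsion_free)
    then have "g p = rd (Suc n)" if "p \<le> Suc n" for p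
      using gp[of p] gp[of "Suc n"] that by (simp add: g_def rd_def)
    from this[of i] True show ?thesis
      by (auto simp: g_def) (metis Suc_diff_le add_diff_cancel_left' diff_add_inverse g_def le_add1)
  qed (use that ab in auto)
  have aa': "comm (ra i) (ra j) = 0" if "i + j \<le> Suc n" for i j
  proof (cases "i + j = Suc n")
    case True
    show ?thesis
    proof (rule comm_family_zero[OF _ _ True])
      show "comm (ra 0) (ra 1) = 0"
        using serre_x by (simp add: comm_swap[of "comm x y" x] comm_minus_right)
      show "comm (ra (Suc (k + p))) (ra l) + comm (ra p) (ra (Suc (k + l))) = 0" if "k + p + l = n" for k p l
        using that jacobi[of "rd k" "ra p" "ra l"] aa[of p l] by (simp add: da)
    qed
  qed (use that aa in auto)
  have bb': "comm (rb i) (rb j) = 0" if "i + j \<le> Suc n" for i j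
  proof (cases "i + j = Suc n")
    case True
    show ?thesis
    proof (rule comm_family_zero[OF _ _ True])
      show "comm (rb 0) (rb 1) = 0"
        using serre_y by (simp add: comm_swap[of y x] comm_minus_right comm_swap[of y "comm x y"])
      show "comm (rb (Suc (k + p))) (rb l) + comm (rb p) (rb (Suc (k + l))) = 0" if "k + p + l = n" for k p l
      proof -
        have "- comm (rb (Suc (k + p))) (rb l) = comm (rb p) (rb (Suc (k + l)))"
          using that jacobi[of "rd k" "rb p" "rb l"] bb[of p l]
          by (simp add: db comm_minus_left comm_minus_right del: rb.simps)
        then show ?thesis
          by (metis add.right_inverse)
      qed
    qed
  qed (use that bb in auto)
  show ?thesis
    unfolding root_relations_upto_def using aa' bb' ab' da db by blast
qed

lemma root_relations_all: "root_relations_upto n"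
proof (induction n)
  case 0
  show ?case
    by (simp add: root_relations_upto_def rd_def)
qed (rule root_relations_step)

lemma comm_ra_ra: "comm (ra i) (ra j) = 0"
  and comm_rb_rb: "comm (rb i) (rb j) = 0"
  and comm_ra_rb: "comm (ra i) (rb j) = rd (i + j)"
  and comm_rd_ra: "comm (rd i) (ra j) = ra (Suc (i + j))"
  and comm_rd_rb: "comm (rd i) (rb j) = - rb (Suc (i + j))"
  using root_relations_all[of "Suc (i + j)"] by (simp_all add: root_relations_upto_def)

lemma comm_rd_rd: "comm (rd i) (rd j) = 0"
  using jacobi[of "rd i" "ra j" "rb 0"]
  by (simp add: comm_ra_rb comm_rd_ra comm_rd_rb comm_minus_right add.commute
      del: ra.simps rb.simps)

end

section \<open>Deletion operators on root vectors\<close>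

lemma mod3_cases:
  obtains m where "j = 3 * m" | m where "j = 3 * m + 1" | m where "j = 3 * m + (2::nat)"
proof -
  have "j = 3 * (j div 3) + j mod 3" "j mod 3 < 3"
    by simp_all
  then have "j = 3 * (j div 3) \<or> j = 3 * (j div 3) + 1 \<or> j = 3 * (j div 3) + 2"
    by linarith
  with that show ?thesis
    by blast
qed

lemma nat_2_cases: obtains "n = 0" | "n = Suc 0" | k where "n = Suc (Suc k)"
  by (metis not0_implies_Suc)

primrec other :: "generator \<Rightarrow> generator" where
  "other Gen_A = Gen_B" | "other Gen_B = Gen_A"

text \<open>
  The operators model deletion of a generator \<open>g\<close> from words: \<open>pd g\<close> deletes each occurrence
  once, \<open>wd g\<close> multiplies a word by its weight (number of letters \<open>g\<close> minus number of other
  letters), and \<open>sd g\<close> deletes an occurrence with coefficient the weight of what precedes it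
  minus the weight of what follows. The last two terms of the product rule for \<open>sd\<close> account
  for the weight of the other factor; they vanish on elements killed by \<open>pd\<close>, where \<open>sd\<close> is
  a derivation.
\<close>

locale serre_operators = serre_pair x y for x y :: "'u::ring_1" +
  fixes sc :: "'k::ring_1 \<Rightarrow> 'u"
    and pd wd sd :: "generator \<Rightarrow> 'u \<Rightarrow> 'u"
  assumes sc_add: "sc (c + d) = sc c + sc d"
    and sc_mult: "sc (c * d) = sc c * sc d"
    and sc_one: "sc 1 = 1"
    and sc_central: "u * sc c = sc c * u"
    and pd_add: "pd g (u + v) = pd g u + pd g v"
    and pd_sc: "pd g (sc c) = 0"
    and pd_mult: "pd g (u * v) = pd g u * v + u * pd g v"
    and pd_x: "pd g x = (if g = Gen_A then 1 else 0)"
    and pd_y: "pd g y = (if g = Gen_B then 1 else 0)"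
    and wd_add: "wd g (u + v) = wd g u + wd g v"
    and wd_mult: "wd g (u * v) = wd g u * v + u * wd g v"
    and wd_x: "wd g x = (if g = Gen_A then x else - x)"
    and wd_y: "wd g y = (if g = Gen_B then y else - y)"
    and sd_add: "sd g (u + v) = sd g u + sd g v"
    and sd_sc: "sd g (sc c) = 0"
    and sd_mult: "sd g (u * v) = sd g u * v + u * sd g v + wd g u * pd g v - pd g u * wd g v"
    and sd_x: "sd g x = 0"
    and sd_y: "sd g y = 0"
begin

lemma sc_zero: "sc 0 = 0"
  using sc_add[of 0 0] by simp

lemma sc_minus: "sc (- c) = - sc c"
  using sc_add[of c "- c"] by (simp add: sc_zero eq_neg_iff_add_eq_0 add.commute)

lemma pd_zero [simp]: "pd g 0 = 0" and wd_zero: "wd g 0 = 0" and sd_zero [simp]: "sd g 0 = 0"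
  using pd_add[of g 0 0] wd_add[of g 0 0] sd_add[of g 0 0] by auto

lemma pd_minus: "pd g (- u) = - pd g u" and wd_minus: "wd g (- u) = - wd g u"
  and sd_minus: "sd g (- u) = - sd g u"
  using pd_add[of g u "- u"] wd_add[of g u "- u"] sd_add[of g u "- u"]
  by (simp_all add: wd_zero eq_neg_iff_add_eq_0 add.commute)

lemma pd_diff: "pd g (u - v) = pd g u - pd g v" and wd_diff: "wd g (u - v) = wd g u - wd g v"
  and sd_diff: "sd g (u - v) = sd g u - sd g v"
  using pd_add[of g u "- v"] wd_add[of g u "- v"] sd_add[of g u "- v"]
  by (simp_all add: pd_minus wd_minus sd_minus)

lemma pd_comm: "pd g (comm u v) = comm (pd g u) v + comm u (pd g v)"
  by (simp add: comm_def pd_diff pd_mult)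

lemma pd_commutator: "pd g (comm x y) = 0"
  by (cases g) (simp_all add: pd_comm pd_x pd_y)

lemma pd_ra_Suc: "pd g (ra (Suc n)) = 0"
  by (induction n; cases g) (simp_all add: pd_comm pd_x pd_y)

lemma pd_rb_Suc: "pd g (rb (Suc n)) = 0"
  by (induction n; cases g) (simp_all add: pd_comm pd_x pd_y)

lemma pd_rd: "pd g (rd n) = 0"
  by (cases n; cases g) (simp_all add: rd_def pd_commutator pd_comm[of _ _ y] pd_ra_Suc pd_y pd_x
      del: ra.simps(2))

lemma sd_comm:
  assumes "pd g u = 0" "pd g v = 0"
  shows "sd g (comm u v) = comm (sd g u) v + comm u (sd g v)"
  using assms by (simp add: comm_def sd_diff sd_mult algebra_simps)

text \<open>
  On root vectors, here and below, \<open>sd Gen_A\<close> behaves like the bracket with a root vector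
  opposite to \<open>x\<close>: it subtracts the root of \<open>x\<close> and gives zero where the difference is no
  root. Likewise \<open>sd Gen_B\<close> subtracts the root of \<open>y\<close>.
\<close>

lemma sd_A_commutator: "sd Gen_A (comm x y) = 2 * y"
  by (simp add: comm_def sd_diff sd_mult sd_x sd_y pd_x pd_y wd_x wd_y mult_2)

lemma sd_B_commutator: "sd Gen_B (comm x y) = - 2 * x"
  by (simp add: comm_def sd_diff sd_mult sd_x sd_y pd_x pd_y wd_x wd_y mult_2)

lemma wd_commutator: "wd g (comm x y) = 0"
  by (cases g) (simp_all add: comm_def wd_diff wd_mult wd_x wd_y)

lemma sd_A_rb: "sd Gen_A (rb n) = 0"
proof (induction n)
  case (Suc n)
  have "pd Gen_A (rb n) = 0"
    by (cases n) (simp_all add: pd_y pd_rb_Suc del: rb.simps(2))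
  moreover have "comm (rb n) y = 0"
    using comm_rb_rb[of n 0] by simp
  ultimately show ?case
    using Suc by (simp add: sd_comm pd_commutator sd_A_commutator mult_2) (simp add: comm_def algebra_simps)
qed (simp add: sd_y)

lemma sd_B_ra: "sd Gen_B (ra n) = 0"
proof (induction n)
  case (Suc n)
  have "pd Gen_B (ra n) = 0"
    by (cases n) (simp_all add: pd_x pd_ra_Suc del: ra.simps(2))
  moreover have "comm x (ra n) = 0"
    using comm_ra_ra[of 0 n] by simp
  ultimately show ?case
    using Suc by (simp add: sd_comm pd_commutator sd_B_commutator mult_2) (simp add: comm_def algebra_simps)
qed (simp add: sd_x)

lemma sd_A_ra_Suc: "sd Gen_A (ra (Suc n)) = - 2 * rd n"
proof (induction n)
  case 0
  have "sd Gen_A (comm (comm x y) x) = comm (2 * y) x"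
    by (simp add: comm_def[of _ x] sd_diff sd_mult[of _ "comm x y" x] sd_mult[of _ x "comm x y"]
        sd_x pd_x pd_commutator wd_commutator sd_A_commutator)
  then show ?case
    by (simp add: rd_def comm_def algebra_simps mult_2)
next
  case (Suc n)
  have "sd Gen_A (ra (Suc (Suc n))) =
      comm (2 * y) (ra (Suc n)) + comm (comm x y) (- 2 * rd n)"
    unfolding ra.simps(2)[of "Suc n"]
    by (simp only: sd_comm pd_commutator pd_ra_Suc sd_A_commutator Suc.IH)
  also have "comm (comm x y) (- 2 * rd n) = - 2 * comm (rd 0) (rd n)"
    by (simp add: rd_def) (simp add: comm_def algebra_simps mult_2 mult_2_right)
  also have "comm (2 * y) (ra (Suc n)) = - 2 * rd (Suc n)"
    by (simp add: rd_def del: ra.simps) (simp add: comm_def algebra_simps mult_2 mult_2_right)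
  finally show ?case
    by (simp only: comm_rd_rd) simp
qed

lemma sd_B_rb_Suc: "sd Gen_B (rb (Suc n)) = 2 * rd n"
proof (induction n)
  case 0
  have "sd Gen_B (comm y (comm x y)) = comm y (- 2 * x)"
    by (simp add: comm_def[of y] sd_diff sd_mult[of _ "comm x y" y] sd_mult[of _ y "comm x y"]
        sd_y pd_y pd_commutator wd_commutator sd_B_commutator)
  then show ?case
    by (simp add: rd_def comm_def algebra_simps mult_2 mult_2_right)
next
  case (Suc n)
  have "sd Gen_B (rb (Suc (Suc n))) =
      comm (2 * rd n) (comm x y) + comm (rb (Suc n)) (- 2 * x)"
    unfolding rb.simps(2)[of "Suc n"]
    by (simp only: sd_comm pd_commutator pd_rb_Suc sd_B_commutator Suc.IH)
  also have "comm (2 * rd n) (comm x y) = 2 * comm (rd n) (rd 0)"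
    by (simp add: rd_def) (simp add: comm_def algebra_simps mult_2 mult_2_right)
  also have "comm (rb (Suc n)) (- 2 * x) = 2 * comm (ra 0) (rb (Suc n))"
    by (simp del: rb.simps) (simp add: comm_def algebra_simps mult_2 mult_2_right)
  finally show ?case
    by (simp only: comm_rd_rd comm_ra_rb) simp
qed

lemma sd_A_rd: "sd Gen_A (rd n) = 2 * rb n"
proof (cases n)
  case 0
  then show ?thesis
    by (simp add: rd_def sd_A_commutator)
next
  case (Suc m)
  have "sd Gen_A (rd n) = comm (- 2 * rd m) (rb 0)"
    unfolding Suc rd_def[of "Suc m"]
    by (subst sd_comm) (simp_all add: pd_ra_Suc pd_y sd_A_ra_Suc sd_y del: ra.simps)
  also have "\<dots> = - 2 * comm (rd m) (rb 0)"
    by (simp add: comm_def algebra_simps mult_2 mult_2_right)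
  finally show ?thesis
    by (simp only: comm_rd_rb Suc) simp
qed

lemma sd_B_rd: "sd Gen_B (rd n) = - 2 * ra n"
proof (cases n)
  case 0
  then show ?thesis
    by (simp add: rd_def sd_B_commutator)
next
  case (Suc m)
  have *: "rd n = comm x (rb n)"
    using comm_ra_rb[of 0 n] by simp
  have "sd Gen_B (rd n) = comm (ra 0) (2 * rd m)"
    unfolding Suc *[unfolded Suc]
    by (subst sd_comm) (simp_all add: pd_rb_Suc pd_x sd_B_rb_Suc sd_x del: rb.simps)
  also have "\<dots> = - 2 * comm (rd m) (ra 0)"
    by (simp add: comm_def algebra_simps mult_2 mult_2_right)
  finally show ?thesis
    by (simp only: comm_rd_ra Suc) simp
qed

end

section \<open>Ordered products of root vectors\<close>

context serre_operators
begin

text \<open>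
  One sequence \<open>ra 0, rb 0, rd 0, ra 1, rb 1, rd 1, \<dots>\<close> of all root vectors, ordered by
  height. A bracket of two of them comes strictly later than both, so that every final
  segment spans an ideal.
\<close>

definition root :: "nat \<Rightarrow> 'u" where
  "root j = (if j mod 3 = 0 then ra (j div 3) else if j mod 3 = 1 then rb (j div 3) else rd (j div 3))"

definition height :: "nat \<Rightarrow> nat" where
  "height j = Suc (2 * j div 3)"

lemma root_simps: "root (3 * m) = ra m" "root (3 * m + 1) = rb m" "root (3 * m + 2) = rd m"
proof -
  have "3 * m div 3 = m" "(3 * m + 1) div 3 = m" "(3 * m + 2) div 3 = m"
    "3 * m mod 3 = 0" "(3 * m + 1) mod 3 = 1" "(3 * m + 2) mod 3 = 2"
    by presburger+
  then show "root (3 * m) = ra m" "root (3 * m + 1) = rb m" "root (3 * m + 2) = rd m"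
    by (simp_all only: root_def) simp_all
qed

lemma height_simps: "height (3 * m) = 2 * m + 1" "height (3 * m + 1) = 2 * m + 1"
  "height (3 * m + 2) = 2 * m + 2"
  unfolding height_def by presburger+

lemma less_height: "d < height (2 * d)"
  by (simp add: height_def)

lemma height_Suc_max: "height (Suc (max i j)) \<le> height i + height j"
proof -
  have "height (Suc m) \<le> Suc (height m)" for m
    using div_le_mono[of "2 * Suc m" "2 * m + 3" 3] by (simp add: height_def)
  from this[of i] this[of j] show ?thesis
    by (simp add: max_def) (simp add: height_def)
qed

lemma height_mono: "i \<le> j \<Longrightarrow> height i \<le> height j"
  by (simp add: height_def div_le_mono)

lemma comm_root:
  "\<exists>c k. comm (root i) (root j) = sc c * root k \<and> i < k \<and> j < k \<and> height k \<le> height i + height j"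
proof -
  define P where "P i j u \<longleftrightarrow>
    (\<exists>c k. u = sc c * root k \<and> i < k \<and> j < k \<and> height k \<le> height i + height j)" for i j u
  have P0: "P i j 0" for i j
    unfolding P_def by (rule exI[of _ 0], rule exI[of _ "Suc (max i j)"])
      (use height_Suc_max in \<open>simp add: sc_zero less_Suc_eq_le\<close>)
  have P1: "P i j (root k)" if "i < k" "j < k" "height k \<le> height i + height j" for i j k
    unfolding P_def using that by (intro exI[of _ 1] exI[of _ k]) (simp add: sc_one)
  have Pm: "P i j (- u)" if "P i j u" for i j u
    using that unfolding P_def by (metis mult_minus_left sc_minus)
  have Ps: "P j i (comm v u)" if "P i j (comm u v)" for i j u v
    using Pm[OF that] comm_swap[of v u] unfolding P_def by (auto simp: add.commute)
  have "P i j (comm (root i) (root j))"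
  proof (cases i rule: mod3_cases; cases j rule: mod3_cases)
    fix m n
    have aa: "P (3*m) (3*n) (comm (ra m) (ra n))" "P (3*m+1) (3*n+1) (comm (rb m) (rb n))"
      "P (3*m+2) (3*n+2) (comm (rd m) (rd n))" for m n
      by (simp_all only: comm_ra_ra comm_rb_rb comm_rd_rd P0)
    have ab: "P (3*m) (3*n+1) (comm (ra m) (rb n))" for m n
      using P1[of "3*m" "3*(m+n)+2" "3*n+1"] by (simp only: comm_ra_rb root_simps height_simps) simp
    have da: "P (3*m+2) (3*n) (comm (rd m) (ra n))" for m n
      using P1[of "3*m+2" "3*Suc(m+n)" "3*n"] by (simp only: comm_rd_ra root_simps height_simps) simp
    have db: "P (3*m+2) (3*n+1) (comm (rd m) (rb n))" for m n
      using Pm[OF P1[of "3*m+2" "3*Suc(m+n)+1" "3*n+1"]]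
      by (simp only: comm_rd_rb root_simps height_simps) simp
    note rules = aa ab da db ab[THEN Ps] da[THEN Ps] db[THEN Ps]
    show "i = 3*m \<Longrightarrow> j = 3*n \<Longrightarrow> ?thesis" "i = 3*m \<Longrightarrow> j = 3*n+1 \<Longrightarrow> ?thesis"
      "i = 3*m \<Longrightarrow> j = 3*n+2 \<Longrightarrow> ?thesis" "i = 3*m+1 \<Longrightarrow> j = 3*n \<Longrightarrow> ?thesis"
      "i = 3*m+1 \<Longrightarrow> j = 3*n+1 \<Longrightarrow> ?thesis" "i = 3*m+1 \<Longrightarrow> j = 3*n+2 \<Longrightarrow> ?thesis"
      "i = 3*m+2 \<Longrightarrow> j = 3*n \<Longrightarrow> ?thesis" "i = 3*m+2 \<Longrightarrow> j = 3*n+1 \<Longrightarrow> ?thesis"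
      "i = 3*m+2 \<Longrightarrow> j = 3*n+2 \<Longrightarrow> ?thesis"
      by (simp_all only: root_simps rules)
  qed
  then show ?thesis
    by (simp add: P_def)
qed

text \<open>
  Combinations of products of root vectors from the \<open>i\<close>-th on, of height at most \<open>d\<close>. The
  bound on the height serves one purpose: for fixed \<open>d\<close> and large \<open>i\<close> only scalars are left.
\<close>

inductive tail_span :: "nat \<Rightarrow> nat \<Rightarrow> 'u \<Rightarrow> bool" for i where
  scalar: "tail_span i d (sc c)"
| add: "tail_span i d u \<Longrightarrow> tail_span i d v \<Longrightarrow> tail_span i d (u + v)"
| root: "tail_span i e u \<Longrightarrow> i \<le> j \<Longrightarrow> height j + e \<le> d \<Longrightarrow> tail_span i d (root j * u)"

lemma tail_span_mono:
  assumes "tail_span i d u" "i' \<le> i" "d \<le> d'"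
  shows "tail_span i' d' u"
  using assms
proof (induction arbitrary: d' rule: tail_span.induct)
  case (root e u j d)
  have "tail_span i' (height j + e) (root j * u)"
    using root by (intro tail_span.root[of _ e u]) auto
  from tail_span.root[OF root.IH[OF root.prems(1) order_refl], of j] root show ?case
    by simp
qed (auto intro: tail_span.intros)

lemma tail_span_scale: "tail_span i d u \<Longrightarrow> tail_span i d (sc c * u)"
proof (induction rule: tail_span.induct)
  case (root e u j d)
  have "sc c * (root j * u) = root j * (sc c * u)"
    by (simp add: mult.assoc[symmetric] sc_central)
  with root show ?case
    by (auto intro: tail_span.root)
qed (auto simp: distrib_left sc_mult[symmetric] intro: tail_span.intros)

lemma tail_span_zero: "tail_span i d 0"
  using tail_span.scalar[where c = 0] by (simp add: sc_zero)

lemma tail_span_mult: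
  "tail_span i d u \<Longrightarrow> tail_span i e v \<Longrightarrow> tail_span i (d + e) (u * v)"
proof (induction rule: tail_span.induct)
  case (scalar d c)
  then show ?case
    by (intro tail_span_scale) (auto intro: tail_span_mono)
next
  case (root e' u j d)
  have "tail_span i (d + e) (root j * (u * v))"
    by (rule tail_span.root[OF root.IH[OF root.prems]]) (use root in auto)
  then show ?case
    by (simp add: mult.assoc)
qed (auto simp: distrib_right intro: tail_span.add)

lemma tail_span_root: "i \<le> j \<Longrightarrow> height j \<le> d \<Longrightarrow> tail_span i d (root j)"
  using tail_span.root[OF tail_span.scalar[of i 0 1], of j d] by (simp add: sc_one)

lemma tail_span_comm:
  "tail_span (Suc i) d u \<Longrightarrow> tail_span (Suc i) (d + height i) (comm u (root i))"
proof (induction rule: tail_span.induct)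
  case (scalar d c)
  then show ?case
    by (simp add: comm_def sc_central tail_span_zero)
next
  case (add d u v)
  then show ?case
    using tail_span.add[OF add.IH] by (simp add: comm_def algebra_simps)
next
  case (root e u j d)
  have eq: "comm (root j * u) (root i) = root j * comm u (root i) + comm (root j) (root i) * u"
    by (simp add: comm_def algebra_simps)
  obtain c k where k: "comm (root j) (root i) = sc c * root k" "j < k" "i < k"
      "height k \<le> height j + height i"
    using comm_root[of j i] by blast
  have "tail_span (Suc i) (height k) (sc c * root k)"
    using k by (intro tail_span_scale tail_span_root) auto
  then have "tail_span (Suc i) (height k + e) (comm (root j) (root i) * u)"
    unfolding k by (rule tail_span_mult) (rule root)
  then have "tail_span (Suc i) (d + height i) (comm (root j) (root i) * u)"
    by (rule tail_span_mono) (use k root in auto)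
  moreover have "tail_span (Suc i) (d + height i) (root j * comm u (root i))"
    by (rule tail_span.root[OF root.IH]) (use root in auto)
  ultimately show ?case
    unfolding eq by (intro tail_span.add)
qed

text \<open>
  The same span, now with all factors \<open>root i\<close> collected on the left. That every element of
  \<open>tail_span\<close> has this form holds because brackets with \<open>root i\<close> stay in the span of the
  later root vectors.
\<close>

inductive_set power_span :: "nat \<Rightarrow> nat \<Rightarrow> 'u set" for i d where
  power: "tail_span (Suc i) e u \<Longrightarrow> k * height i + e \<le> d \<Longrightarrow> root i ^ k * u \<in> power_span i d"
| add: "u \<in> power_span i d \<Longrightarrow> v \<in> power_span i d \<Longrightarrow> u + v \<in> power_span i d"

lemma power_span_root: "u \<in> power_span i d \<Longrightarrow> height i + d \<le> d' \<Longrightarrow> root i * u \<in> power_span i d'"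
proof (induction rule: power_span.induct)
  case (power e u k)
  then show ?case
    using power_span.power[of i e u "Suc k" d'] by (simp add: mult.assoc)
qed (auto simp: distrib_left intro: power_span.add)

lemma power_span_mult_power:
  "tail_span (Suc i) a w \<Longrightarrow> tail_span (Suc i) e u \<Longrightarrow> a + (k * height i + e) \<le> d \<Longrightarrow>
    w * (root i ^ k * u) \<in> power_span i d"
proof (induction k arbitrary: w a d)
  case 0
  then show ?case
    using power_span.power[OF tail_span_mult[of "Suc i" a w e u], of 0 d] by simp
next
  case (Suc k)
  have eq: "w * (root i ^ Suc k * u) = root i * (w * (root i ^ k * u)) + comm w (root i) * (root i ^ k * u)"
    by (simp add: comm_def algebra_simps)
  have "root i * (w * (root i ^ k * u)) \<in> power_span i d"
    by (rule power_span_root[OF Suc.IH[OF Suc.prems(1,2) order_refl]]) (use Suc.prems in auto)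
  moreover have "comm w (root i) * (root i ^ k * u) \<in> power_span i d"
    by (rule Suc.IH[OF tail_span_comm[OF Suc.prems(1)] Suc.prems(2)]) (use Suc.prems in auto)
  ultimately show ?case
    unfolding eq by (rule power_span.add)
qed

lemma tail_span_power_span: "tail_span i d u \<Longrightarrow> u \<in> power_span i d"
proof (induction rule: tail_span.induct)
  case (scalar d c)
  then show ?case
    using power_span.power[OF tail_span.scalar[of "Suc i" 0 c], of 0 d] by simp
next
  case (root e u j d)
  show ?case
  proof (cases "j = i")
    case True
    with root show ?thesis
      by (auto intro: power_span_root)
  next
    case False
    with root(2) have "tail_span (Suc i) (height j) (root j)"
      by (intro tail_span_root) auto
    with root.IH root(3) show ?thesis
    proof (induction rule: power_span.induct)
      case (power e' v k)
      then show ?case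
        by (intro power_span_mult_power) auto
    qed (auto simp: distrib_left intro: power_span.add)
  qed
qed (rule power_span.add)

lemma power_span_expand:
  "v \<in> power_span i d \<Longrightarrow>
    \<exists>n f. v = (\<Sum>k\<le>n. root i ^ k * f k) \<and> (\<forall>k. tail_span (Suc i) d (f k))"
proof (induction rule: power_span.induct)
  case (power e u k)
  let ?f = "\<lambda>l. if l = k then u else 0"
  have "root i ^ k * u = (\<Sum>l\<le>k. root i ^ l * ?f l)"
    by (simp add: if_distrib[of "(*) _"] cong: if_cong)
  moreover have "\<forall>l. tail_span (Suc i) d (?f l)"
    using power by (auto intro: tail_span_mono tail_span_zero)
  ultimately show ?case
    by (intro exI[of _ k] exI[of _ ?f] conjI)
next
  case (add u v)
  then obtain m n f g where f: "u = (\<Sum>k\<le>m. root i ^ k * f k)" "\<forall>k. tail_span (Suc i) d (f k)"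
    and g: "v = (\<Sum>k\<le>n. root i ^ k * g k)" "\<forall>k. tail_span (Suc i) d (g k)"
    by blast
  define h where "h k = (if k \<le> m then f k else 0) + (if k \<le> n then g k else 0)" for k
  have "(\<Sum>k\<le>m. root i ^ k * f k) = (\<Sum>k\<le>max m n. root i ^ k * (if k \<le> m then f k else 0))"
    "(\<Sum>k\<le>n. root i ^ k * g k) = (\<Sum>k\<le>max m n. root i ^ k * (if k \<le> n then g k else 0))"
    by (rule sum.mono_neutral_cong_left; simp)+
  then have "u + v = (\<Sum>k\<le>max m n. root i ^ k * h k)"
    by (simp add: f g h_def distrib_left sum.distrib)
  moreover have "\<forall>k. tail_span (Suc i) d (h k)"
    using f g by (auto simp: h_def intro!: tail_span.add tail_span_zero)
  ultimately show ?case
    by blast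
qed

section \<open>Operators dual to the root vectors\<close>

text \<open>
  Follow \<open>root n\<close> down to a simple root vector by operators \<open>sd\<close> and then delete that. With
  the indexing by \<open>root\<close>, \<open>sd Gen_A\<close> lowers the index by 1 and kills the indices congruent
  to 1 modulo 3, while \<open>sd Gen_B\<close> lowers it by 2 and kills the multiples of 3; the
  definition uses \<open>sd Gen_B\<close> where \<open>sd Gen_A\<close> would give zero.
\<close>

fun root_dual :: "nat \<Rightarrow> 'u \<Rightarrow> 'u" where
  "root_dual 0 u = pd Gen_A u"
| "root_dual (Suc 0) u = pd Gen_B u"
| "root_dual (Suc (Suc n)) u = (if n mod 3 = 2 then root_dual n (sd Gen_B u) else root_dual (Suc n) (sd Gen_A u))"

lemma root_dual_add: "root_dual n (u + v) = root_dual n u + root_dual n v"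
proof (induction n arbitrary: u v rule: less_induct)
  case (less n)
  then show ?case
    by (cases n rule: nat_2_cases) (simp_all add: pd_add sd_add)
qed

lemma root_dual_zero [simp]: "root_dual n 0 = 0"
  using root_dual_add[of n 0 0] by simp

lemma root_dual_sum: "root_dual n (\<Sum>k\<in>A. f k) = (\<Sum>k\<in>A. root_dual n (f k))"
  by (induction A rule: infinite_finite_induct) (simp_all add: root_dual_add)

definition tail :: "nat \<Rightarrow> 'u set" where
  "tail i = {u. \<exists>d. tail_span i d u}"

lemma tail_sc: "sc c \<in> tail i"
  by (auto simp: tail_def intro: tail_span.scalar)

lemma tail_zero: "0 \<in> tail i"
  using tail_sc[of 0] by (simp add: sc_zero)

lemma tail_add: "u \<in> tail i \<Longrightarrow> v \<in> tail i \<Longrightarrow> u + v \<in> tail i"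
  unfolding tail_def
  by (auto intro: tail_span.add[OF tail_span_mono[OF _ order_refl max.cobounded1]
        tail_span_mono[OF _ order_refl max.cobounded2]])

lemma tail_mult: "u \<in> tail i \<Longrightarrow> v \<in> tail i \<Longrightarrow> u * v \<in> tail i"
  unfolding tail_def by (auto intro: tail_span_mult)

lemma tail_mono: "u \<in> tail i \<Longrightarrow> i' \<le> i \<Longrightarrow> u \<in> tail i'"
  unfolding tail_def by (auto intro: tail_span_mono)

lemma tail_root: "i \<le> j \<Longrightarrow> root j \<in> tail i"
  unfolding tail_def by (auto intro: tail_span_root)

lemma tail_of_int: "of_int c \<in> tail i"
proof -
  have "of_nat n \<in> tail i" for n
    using tail_add[OF tail_sc[of 1 i]] by (induction n) (auto simp: sc_one tail_zero)
  moreover have "- u \<in> tail i" if "u \<in> tail i" for u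
    using tail_mult[OF tail_sc[of "- 1"] that] by (simp add: sc_minus sc_one)
  ultimately show ?thesis
    by (cases c) (auto simp del: of_nat_Suc)
qed

lemma tail_induct [consumes 1, case_names scalar add root]:
  assumes "u \<in> tail i" "\<And>c. P (sc c)" "\<And>u v. P u \<Longrightarrow> P v \<Longrightarrow> P (u + v)"
    "\<And>j u. i \<le> j \<Longrightarrow> u \<in> tail i \<Longrightarrow> P u \<Longrightarrow> P (root j * u)"
  shows "P u"
proof -
  obtain d where "tail_span i d u"
    using assms(1) by (auto simp: tail_def)
  then show ?thesis
    by (induction rule: tail_span.induct) (auto intro!: assms(2-4) simp: tail_def)
qed

lemma pd_root:
  assumes "2 \<le> j"
  shows "pd g (root j) = 0"
proof (cases j rule: mod3_cases)
  case (1 m)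
  with assms show ?thesis
    by (cases m) (simp, simp only: root_simps pd_ra_Suc)
next
  case (2 m)
  with assms show ?thesis
    by (cases m) (simp, simp only: root_simps pd_rb_Suc)
qed (simp only: root_simps pd_rd)

lemma pd_tail: "u \<in> tail 2 \<Longrightarrow> pd g u = 0"
  by (induction u rule: tail_induct) (simp_all add: pd_sc pd_add pd_mult pd_root)

lemma sd_mult_tail:
  "u \<in> tail 2 \<Longrightarrow> v \<in> tail 2 \<Longrightarrow> sd g (u * v) = sd g u * v + u * sd g v"
  by (simp add: sd_mult pd_tail)

lemma sd_A_root:
  assumes "2 \<le> j"
  shows "sd Gen_A (root j) =
    of_int (if j mod 3 = 1 then 0 else if j mod 3 = 0 then - 2 else 2) * root (j - 1)"
proof (cases j rule: mod3_cases)
  case (1 m)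
  with assms obtain n where m: "m = Suc n"
    by (cases m) auto
  have j: "j = 3 * Suc n" "j - 1 = 3 * n + 2"
    using 1 m by auto
  then have "j mod 3 = 0"
    by simp
  moreover have "sd Gen_A (root j) = - 2 * root (j - 1)"
    unfolding j(2) unfolding j(1) root_simps by (rule sd_A_ra_Suc)
  ultimately show ?thesis
    by simp
next
  case (2 m)
  then show ?thesis
    by (simp add: root_simps[simplified] sd_A_rb)
next
  case (3 m)
  have j: "j - 1 = 3 * m + 1" "j mod 3 = 2"
    using 3 by (simp, presburger)
  have "sd Gen_A (root j) = 2 * root (j - 1)"
    unfolding j(1) unfolding 3 root_simps by (rule sd_A_rd)
  with j(2) show ?thesis
    by simp
qed

lemma sd_B_root:
  assumes "2 \<le> j"
  shows "sd Gen_B (root j) =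
    of_int (if j mod 3 = 0 then 0 else if j mod 3 = 1 then 2 else - 2) * root (j - 2)"
proof (cases j rule: mod3_cases)
  case (1 m)
  then show ?thesis
    by (simp add: root_simps[simplified] sd_B_ra)
next
  case (2 m)
  with assms obtain n where m: "m = Suc n"
    by (cases m) auto
  have j: "j = 3 * Suc n + 1" "j - 2 = 3 * n + 2"
    using 2 m by auto
  then have "j mod 3 = 1"
    by simp
  moreover have "sd Gen_B (root j) = 2 * root (j - 2)"
    unfolding j(2) unfolding j(1) root_simps by (rule sd_B_rb_Suc)
  ultimately show ?thesis
    by simp
next
  case (3 m)
  have j: "j - 2 = 3 * m" "j mod 3 = 2"
    using 3 by (simp, presburger)
  have "sd Gen_B (root j) = - 2 * root (j - 2)"
    unfolding j(1) unfolding 3 root_simps by (rule sd_B_rd)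
  with j(2) show ?thesis
    by simp
qed

lemma exists_sd_root:
  assumes "2 \<le> j"
  shows "\<exists>c::int. sd Gen_A (root j) = of_int c * root (j - 1)"
    and "\<exists>c::int. sd Gen_B (root j) = of_int c * root (j - 2)"
  using sd_A_root[OF assms] sd_B_root[OF assms] by blast+

text \<open>
  The three properties that make \<open>L\<close> act as a non-zero multiple of the partial derivative by
  \<open>root n\<close> on polynomials in \<open>root n\<close> with coefficients in \<open>tail (Suc n)\<close>.
\<close>

definition triangular :: "nat \<Rightarrow> ('u \<Rightarrow> 'u) \<Rightarrow> bool" where
  "triangular n L \<longleftrightarrow>
     (\<forall>u\<in>tail n. \<forall>v\<in>tail n. L (u * v) = L u * v + u * L v) \<and>
     (\<forall>u\<in>tail (Suc n). L u = 0) \<and>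
     (\<exists>c::int. c \<noteq> 0 \<and> L (root n) = of_int c)"

lemma root_dual_of_int: "root_dual n (of_int c * u) = of_int c * root_dual n u"
proof -
  have minus: "root_dual n (- v) = - root_dual n v" for v
    using root_dual_add[of n v "- v"] by (simp add: eq_neg_iff_add_eq_0 add.commute)
  have nat: "root_dual n (of_nat k * v) = of_nat k * root_dual n v" for k v
    by (induction k) (simp_all add: distrib_right root_dual_add)
  show ?thesis
    by (cases c) (simp_all add: minus nat del: of_nat_Suc)
qed

text \<open>
  Composing with \<open>sd\<close> shifts all indices by the same \<open>s\<close>, so properties of \<open>root_dual n'\<close>
  carry over. For the product rule, \<open>sd\<close> is a derivation on \<open>tail 2\<close>, and the mixed terms
  vanish because \<open>root_dual n'\<close> kills the undifferentiated factor.
\<close>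

lemma triangular_step:
  assumes n': "triangular n' (root_dual n')" and n: "n = n' + s" "0 < s" "2 \<le> n"
    and sd: "\<And>j. n \<le> j \<Longrightarrow> \<exists>c::int. sd g (root j) = of_int c * root (j - s)"
    and sdn: "c \<noteq> 0" "sd g (root n) = of_int c * root n'"
  shows "triangular n (\<lambda>u. root_dual n' (sd g u))"
proof -
  have le: "u \<in> tail n \<Longrightarrow> u \<in> tail 2" "u \<in> tail n \<Longrightarrow> u \<in> tail (Suc n')"
    "u \<in> tail n \<Longrightarrow> u \<in> tail n'" "u \<in> tail (Suc n) \<Longrightarrow> u \<in> tail n" for u
    using n by (auto elim: tail_mono)
  have tl: "sd g u \<in> tail n'" if "u \<in> tail n" for u
    using that
  proof (induction u rule: tail_induct)
    case (root j u)
    obtain d where "sd g (root j) = of_int d * root (j - s)"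
      using sd root(1) by blast
    moreover have "root (j - s) \<in> tail n'"
      using root(1) n by (intro tail_root) auto
    ultimately have "sd g (root j) \<in> tail n'"
      by (simp add: tail_mult tail_of_int)
    moreover have "sd g (root j * u) = sd g (root j) * u + root j * sd g u"
      using root le(1) by (intro sd_mult_tail) (auto intro: tail_root)
    ultimately show ?case
      using root le(3) n by (auto intro!: tail_add tail_mult tail_root[of n' j])
  qed (auto simp: sd_sc sd_add tail_zero tail_add)
  have deriv: "root_dual n' (u * v) = root_dual n' u * v + u * root_dual n' v" if "u \<in> tail n'" "v \<in> tail n'" for u v
    using n' that by (auto simp: triangular_def)
  have kill: "root_dual n' u = 0" if "u \<in> tail (Suc n')" for u
    using n' that by (auto simp: triangular_def)
  have d: "root_dual n' (sd g (u * v)) = root_dual n' (sd g u) * v + u * root_dual n' (sd g v)"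
    if "u \<in> tail n" "v \<in> tail n" for u v
    using that by (simp add: sd_mult_tail le root_dual_add deriv tl kill)
  have "root_dual n' (sd g u) = 0" if "u \<in> tail (Suc n)" for u
    using that
  proof (induction u rule: tail_induct)
    case (root j u)
    obtain e where "sd g (root j) = of_int e * root (j - s)"
      using sd[of j] root(1) by auto
    moreover have "root (j - s) \<in> tail (Suc n')"
      using root(1) n by (intro tail_root) auto
    ultimately have "root_dual n' (sd g (root j)) = 0"
      by (simp add: root_dual_of_int kill)
    then show ?case
      using root le(4) by (simp add: d tail_root)
  qed (auto simp: sd_sc sd_add root_dual_add)
  moreover obtain e :: int where "e \<noteq> 0" "root_dual n' (root n') = of_int e"
    using n' by (auto simp: triangular_def)
  then have "\<exists>c::int. c \<noteq> 0 \<and> root_dual n' (sd g (root n)) = of_int c"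
    using sdn by (intro exI[of _ "c * e"]) (simp add: root_dual_of_int)
  ultimately show ?thesis
    using d by (simp add: triangular_def)
qed

lemma pd_triangular:
  assumes "pd g (root n) = 1" "\<And>j. n < j \<Longrightarrow> pd g (root j) = 0"
  shows "triangular n (pd g)"
proof -
  have "pd g u = 0" if "u \<in> tail (Suc n)" for u
    using that by (induction u rule: tail_induct) (simp_all add: pd_sc pd_add pd_mult assms(2))
  with assms(1) show ?thesis
    unfolding triangular_def by (auto simp: pd_mult intro!: exI[of _ 1])
qed

lemma root_dual_triangular: "triangular n (root_dual n)"
proof (induction n rule: less_induct)
  case (less n)
  show ?case
  proof (cases n rule: nat_2_cases)
    case 1
    have "pd Gen_A (root j) = 0" if "0 < j" for j
      using that pd_root[of j] root_simps(2)[of 0] by (cases "j = 1") (auto simp: pd_y)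
    then have "triangular 0 (pd Gen_A)"
      using root_simps(1)[of 0] by (auto intro!: pd_triangular simp: pd_x)
    then show ?thesis
      by (simp add: 1 triangular_def)
  next
    case 2
    have "triangular 1 (pd Gen_B)"
      using root_simps(2)[of 0] by (auto intro!: pd_triangular simp: pd_y pd_root)
    then show ?thesis
      by (simp add: 2 triangular_def)
  next
    case (3 k)
    show ?thesis
    proof (cases "k mod 3 = 2")
      case True
      then have "n mod 3 = 1"
        using 3 by presburger
      then have "triangular n (\<lambda>u. root_dual k (sd Gen_B u))"
        using less[of k] 3 exists_sd_root(2)
        by (intro triangular_step[where c = 2 and s = 2]) (simp_all add: sd_B_root)
      with True show ?thesis
        by (simp add: 3 triangular_def)
    next
      case False
      then have "n mod 3 \<noteq> 1"
        using 3 by presburger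
      then have "triangular n (\<lambda>u. root_dual (Suc k) (sd Gen_A u))"
        using less[of "Suc k"] 3 exists_sd_root(1)
        by (intro triangular_step[where c = "if n mod 3 = 0 then - 2 else 2" and s = 1])
          (simp_all add: sd_A_root)
      with False show ?thesis
        by (simp add: 3 triangular_def)
    qed
  qed
qed

lemma of_int_left_commute: "u * (of_int c * v) = of_int c * (u * (v :: 'u))"
  by (simp only: mult.assoc[symmetric] mult_of_int_commute[of c u])

lemma of_int_torsion_free:
  assumes "of_int c * u = (0 :: 'u)" "c \<noteq> 0"
  shows "u = 0"
proof -
  obtain n where "c = int (Suc n) \<or> c = - int (Suc n)"
    using assms(2) by (cases c) (auto dest: gr0_implies_Suc)
  with assms(1) have "of_nat (Suc n) * u = 0"
    by (auto simp del: of_nat_Suc)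
  then show ?thesis
    by (rule torsion_free)
qed

lemma root_dual_root_power:
  assumes "u \<in> tail (Suc n)" "root_dual n (root n) = of_int c"
  shows "root_dual n (root n ^ k * u) = of_int (int k * c) * (root n ^ (k - 1) * u)"
proof (induction k)
  case 0
  then show ?case
    using root_dual_triangular[of n] assms by (simp add: triangular_def)
next
  case (Suc k)
  have pow: "root n ^ k \<in> tail n" for k
    using tail_sc[of 1 n] by (induction k) (auto simp: sc_one intro: tail_mult tail_root)
  have "root_dual n (root n * (root n ^ k * u)) =
      root_dual n (root n) * (root n ^ k * u) + root n * root_dual n (root n ^ k * u)"
    using root_dual_triangular[of n] assms(1) pow
    by (auto simp: triangular_def tail_mult tail_root tail_mono[of u "Suc n" n])
  also have "\<dots> = of_int (int (Suc k) * c) * (root n ^ k * u)"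
  proof (cases k)
    case 0
    then show ?thesis
      using Suc assms(2) by simp
  next
    case k: (Suc l)
    have "root_dual n (root n) * (root n ^ k * u) + root n * root_dual n (root n ^ k * u) =
        of_int c * (root n ^ k * u) + root n * (of_int (int k * c) * (root n ^ l * u))"
      by (simp only: Suc.IH assms(2)) (simp only: k diff_Suc_1)
    also have "\<dots> = of_int c * (root n ^ k * u) + of_int (int k * c) * (root n ^ k * u)"
      by (simp only: of_int_left_commute[of "root n"] k power_Suc mult.assoc)
    also have "\<dots> = of_int (int (Suc k) * c) * (root n ^ k * u)"
      by (simp only: distrib_right[symmetric] of_int_add[symmetric]) (simp add: distrib_right)
    finally show ?thesis .
  qed
  finally show ?case
    by (simp only: power_Suc mult.assoc diff_Suc_1)
qed

lemma root_dual_power_sum: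
  assumes "\<And>k. f k \<in> tail (Suc n)" "root_dual n (root n) = of_int c"
  shows "root_dual n (\<Sum>k\<le>Suc m. root n ^ k * f k) =
    (\<Sum>k\<le>m. root n ^ k * (of_int (int (Suc k) * c) * f (Suc k)))"
proof -
  have "root_dual n (\<Sum>k\<le>Suc m. root n ^ k * f k) =
      (\<Sum>k\<le>Suc m. of_int (int k * c) * (root n ^ (k - 1) * f k))"
    by (simp only: root_dual_sum root_dual_root_power assms)
  then show ?thesis
    unfolding sum.atMost_Suc_shift
    by (simp add: of_int_left_commute mult.assoc del: of_int_mult of_int_add)
qed

text \<open>
  Polynomials in \<open>root n\<close> over \<open>tail (Suc n)\<close> are determined by their value: differentiate
  with \<open>root_dual n\<close> and induct on the degree.
\<close>

lemma power_coefficients_zero: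
  assumes "(\<Sum>k\<le>m. root n ^ k * f k) = 0" "\<And>k. f k \<in> tail (Suc n)" "k \<le> m"
  shows "f k = 0"
  using assms
proof (induction m arbitrary: f k)
  case (Suc m)
  obtain c :: int where c: "c \<noteq> 0" "root_dual n (root n) = of_int c"
    using root_dual_triangular[of n] by (auto simp: triangular_def)
  define g where "g k = of_int (int (Suc k) * c) * f (Suc k)" for k
  have "(\<Sum>k\<le>m. root n ^ k * g k) = 0"
    using root_dual_power_sum[where f = f and m = m, OF Suc.prems(2) c(2)] Suc.prems(1) by (simp only: g_def root_dual_zero)
  then have "g k = 0" if "k \<le> m" for k
    by (rule Suc.IH[OF _ _ that]) (auto simp: g_def simp del: of_int_mult intro: tail_mult tail_of_int Suc.prems)
  then have pos: "f (Suc k) = 0" if "k \<le> m" for k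
    using that c of_int_torsion_free[of "int (Suc k) * c" "f (Suc k)"] by (auto simp: g_def)
  then have "f 0 = 0"
    using Suc.prems(1) by (simp add: sum.atMost_Suc_shift del: sum.atMost_Suc)
  with pos Suc.prems(3) show ?case
    by (cases k) auto
qed simp

text \<open>
  A polynomial in \<open>root n\<close> whose derivative vanishes is constant.
\<close>

lemma root_dual_eq_zero_imp_tail:
  assumes "tail_span n d v" "root_dual n v = 0"
  shows "tail_span (Suc n) d v"
proof -
  obtain m f where v: "v = (\<Sum>k\<le>m. root n ^ k * f k)" and f: "\<And>k. tail_span (Suc n) d (f k)"
    using power_span_expand[OF tail_span_power_span[OF assms(1)]] by blast
  have ft: "f k \<in> tail (Suc n)" for k
    using f by (auto simp: tail_def)
  obtain c :: int where c: "c \<noteq> 0" "root_dual n (root n) = of_int c"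
    using root_dual_triangular[of n] by (auto simp: triangular_def)
  have "f (Suc k) = 0" if k: "Suc k \<le> m" for k
  proof -
    obtain m' where m: "m = Suc m'"
      using k by (cases m) auto
    have "of_int (int (Suc k) * c) * f (Suc k) = 0"
    proof (rule power_coefficients_zero[where f = "\<lambda>k. of_int (int (Suc k) * c) * f (Suc k)"])
      show "(\<Sum>k\<le>m'. root n ^ k * (of_int (int (Suc k) * c) * f (Suc k))) = 0"
        using root_dual_power_sum[where f = f and m = m', OF ft c(2)] assms(2) by (simp only: v m)
      show "of_int (int (Suc k) * c) * f (Suc k) \<in> tail (Suc n)" for k
        by (intro tail_mult tail_of_int ft)
      show "k \<le> m'"
        using k m by simp
    qed
    then show ?thesis
      by (rule of_int_torsion_free) (use c(1) in simp)
  qed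
  then have "f k = 0" if "k \<in> {..m} - {0}" for k
    using that by (cases k) auto
  then have "v = (\<Sum>k\<in>{0}. root n ^ k * f k)"
    unfolding v by (intro sum.mono_neutral_right) auto
  with f show ?thesis
    by simp
qed

text \<open>
  All operators \<open>root_dual n\<close> end in a \<open>pd\<close> and, for \<open>n \<ge> 2\<close>, start with an \<open>sd\<close>, hence kill
  \<open>v\<close>. So \<open>v\<close> lies in every \<open>tail_span n d\<close>, and for \<open>n = 2 * d\<close> this consists of scalars.
\<close>

theorem common_kernel_scalar:
  assumes "tail_span 0 d v" "\<And>g. pd g v = 0" "\<And>g. sd g v = 0"
  shows "\<exists>c. v = sc c"
proof -
  have "root_dual n v = 0" for n
    by (cases n rule: nat_2_cases) (simp_all add: assms)
  then have "tail_span n d v" for n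
    using assms(1) by (induction n) (auto intro: root_dual_eq_zero_imp_tail)
  then have "tail_span (2 * d) d v" .
  moreover have "\<exists>c. v = sc c" if "tail_span (2 * d) e v" "e \<le> d" for e v
    using that
  proof (induction rule: tail_span.induct)
    case (add e u v)
    then show ?case
      by (metis sc_add)
  next
    case (root e u j e')
    then show ?case
      using less_height[of d] height_mono[of "2 * d" j] by simp
  qed blast
  ultimately show ?thesis
    by blast
qed

end

section \<open>Linear maps on the algebra of words\<close>

abbreviation const :: "'k::zero \<Rightarrow> ('a word \<Rightarrow>\<^sub>0 'k)" where
  "const c \<equiv> Poly_Mapping.single 0 c"

abbreviation mon :: "'a list \<Rightarrow> ('a word \<Rightarrow>\<^sub>0 'k::zero_neq_one)" where
  "mon w \<equiv> Poly_Mapping.single (Word w) 1"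

lemma const_one: "const 1 = 1"
  by simp

lemma mono_Nil: "mon [] = 1"
  by (simp add: zero_word_def[symmetric])

lemma mono_append: "mon (u @ v) = mon u * (mon v :: 'a word \<Rightarrow>\<^sub>0 'k::comm_ring_1)"
  by (simp add: mult_single plus_word_def)

lemma mono_Cons: "mon (a # w) = mon [a] * (mon w :: 'a word \<Rightarrow>\<^sub>0 'k::comm_ring_1)"
  using mono_append[of "[a]" w] by simp

lemma lookup_const_mult:
  "Poly_Mapping.lookup (const c * p) w = c * Poly_Mapping.lookup (p :: 'a word \<Rightarrow>\<^sub>0 'k::comm_ring_1) w"
  by (simp add: mult_map_scale_conv_mult[symmetric] Poly_Mapping.map.rep_eq when_def)

lemma word_algebra_induct [case_names mono scale add]:
  fixes p :: "'a word \<Rightarrow>\<^sub>0 'k::comm_ring_1"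
  assumes mono: "\<And>w. P (mon w)"
    and scale: "\<And>c p. P p \<Longrightarrow> P (const c * p)"
    and add: "\<And>p r. P p \<Longrightarrow> P r \<Longrightarrow> P (p + r)"
  shows "P p"
proof -
  have zero: "P 0"
    using scale[OF mono, of 0] by simp
  have "P (\<Sum>w\<in>W. Poly_Mapping.single w (Poly_Mapping.lookup p w))" if "finite W" for W
    using that
  proof (induction W rule: finite_induct)
    case (insert w W)
    have "P (Poly_Mapping.single w (Poly_Mapping.lookup p w))"
      using scale[OF mono, of "Poly_Mapping.lookup p w" "letters w"] by (simp add: mult_single)
    with insert show ?case
      by (simp add: add)
  qed (simp add: zero)
  moreover have "p = (\<Sum>w\<in>Poly_Mapping.keys p. Poly_Mapping.single w (Poly_Mapping.lookup p w))"
    by (rule poly_mapping_eqI) (simp add: lookup_sum lookup_single when_def in_keys_iff cong: if_cong)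
  ultimately show ?thesis
    using finite_keys[of p] by metis
qed

lemma const_central: "p * const c = const c * (p :: 'a word \<Rightarrow>\<^sub>0 'k::comm_ring_1)"
proof (induction p rule: word_algebra_induct)
  case (scale d p)
  have "const d * p * const c = const d * const c * p"
    by (simp only: mult.assoc scale)
  also have "const d * const c = (const c * const d :: 'a word \<Rightarrow>\<^sub>0 'k)"
    by (simp add: mult_single mult.commute)
  finally show ?case
    by (simp only: mult.assoc)
qed (simp_all add: mult_single distrib_left distrib_right)

definition linext :: "('a list \<Rightarrow> ('b word \<Rightarrow>\<^sub>0 'k)) \<Rightarrow> ('a word \<Rightarrow>\<^sub>0 'k) \<Rightarrow> ('b word \<Rightarrow>\<^sub>0 'k::comm_ring_1)" where
  "linext f p = (\<Sum>w\<in>Poly_Mapping.keys p. const (Poly_Mapping.lookup p w) * f (letters w))"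

lemma linext_superset:
  assumes "finite W" "Poly_Mapping.keys p \<subseteq> W"
  shows "linext f p = (\<Sum>w\<in>W. const (Poly_Mapping.lookup p w) * f (letters w))"
  unfolding linext_def by (intro sum.mono_neutral_left assms) (auto simp: in_keys_iff)

lemma linext_add: "linext f (p + r) = linext f p + linext f r"
proof -
  let ?W = "Poly_Mapping.keys p \<union> Poly_Mapping.keys r"
  have "Poly_Mapping.keys (p + r) \<subseteq> ?W"
    by (rule keys_add)
  then show ?thesis
    by (simp add: linext_superset[of ?W] lookup_add single_add distrib_right sum.distrib)
qed

lemma linext_scale: "linext f (const c * p) = const c * linext f p"
proof -
  have "Poly_Mapping.keys (const c * p) \<subseteq> Poly_Mapping.keys p"
    by (auto simp: in_keys_iff lookup_const_mult)
  then have "linext f (const c * p) =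
      (\<Sum>w\<in>Poly_Mapping.keys p. const (Poly_Mapping.lookup (const c * p) w) * f (letters w))"
    by (intro linext_superset) auto
  also have "\<dots> = (\<Sum>w\<in>Poly_Mapping.keys p. const c * (const (Poly_Mapping.lookup p w) * f (letters w)))"
    by (simp add: lookup_const_mult mult_single mult.assoc[symmetric])
  finally show ?thesis
    by (simp add: linext_def sum_distrib_left)
qed

lemma linext_mono: "linext f (mon w) = f w"
  by (simp add: linext_def)

lemma linext_zero [simp]: "linext f 0 = 0"
  by (simp add: linext_def)

lemma linext_one: "linext f 1 = f []"
  using linext_mono[of f "[]"] by (simp only: mono_Nil)

lemma linext_minus: "linext f (- p) = - linext f p"
  using linext_add[of f p "- p"] by (simp add: eq_neg_iff_add_eq_0 add.commute)

lemma linext_diff: "linext f (p - r) = linext f p - linext f r"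
  using linext_add[of f p "- r"] by (simp add: linext_minus)

lemmas linext_simps = linext_add linext_scale linext_mono

lemma mult_const_left: "p * (const c * r) = const c * (p * (r :: 'a word \<Rightarrow>\<^sub>0 'k::comm_ring_1))"
  by (simp only: mult.assoc[symmetric] const_central)

lemma bilinear_induct [case_names mono scale_left scale_right add_left add_right]:
  fixes p :: "'a word \<Rightarrow>\<^sub>0 'k::comm_ring_1" and r :: "'b word \<Rightarrow>\<^sub>0 'k"
  assumes "\<And>u v. P (mon u) (mon v)"
    and "\<And>c p r. P p r \<Longrightarrow> P (const c * p) r" "\<And>c p r. P p r \<Longrightarrow> P p (const c * r)"
    and "\<And>p p' r. P p r \<Longrightarrow> P p' r \<Longrightarrow> P (p + p') r" "\<And>p r r'. P p r \<Longrightarrow> P p r' \<Longrightarrow> P p (r + r')"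
  shows "P p r"
proof (induction p rule: word_algebra_induct)
  case (mono w)
  show ?case
    by (induction r rule: word_algebra_induct) (fact assms)+
qed (fact assms)+

section \<open>The classical algebra\<close>

definition pairing :: "generator \<Rightarrow> generator \<Rightarrow> int" where
  "pairing g c = (if c = g then 1 else - 1)"

definition weight :: "generator \<Rightarrow> generator list \<Rightarrow> int" where
  "weight g w = (\<Sum>c\<leftarrow>w. pairing g c)"

lemma weight_simps [simp]: "weight g [] = 0" "weight g (c # w) = pairing g c + weight g w"
  "weight g (u @ v) = weight g u + weight g v"
  by (simp_all add: weight_def)

type_synonym classical_algebra = "generator word \<Rightarrow>\<^sub>0 complex"

primrec pd_word :: "generator \<Rightarrow> generator list \<Rightarrow> classical_algebra" where
  "pd_word g [] = 0"
| "pd_word g (c # w) = (if c = g then mon w else 0) + mon [c] * pd_word g w"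

definition wd_word :: "generator \<Rightarrow> generator list \<Rightarrow> classical_algebra" where
  "wd_word g w = const (of_int (weight g w)) * mon w"

text \<open>
  The recursion peels off the first letter \<open>c\<close>. Deleting it leaves minus the weight of the
  rest; deleting a later letter adds the weight of \<open>c\<close> to what precedes.
\<close>

primrec sd_word :: "generator \<Rightarrow> generator list \<Rightarrow> classical_algebra" where
  "sd_word g [] = 0"
| "sd_word g (c # w) = mon [c] * sd_word g w + const (of_int (pairing g c)) * (mon [c] * pd_word g w)
     - (if c = g then wd_word g w else 0)"

lemma const_of_int_add: "const (of_int (m + n)) * p = const (of_int m) * p + const (of_int n) * (p :: classical_algebra)"
  by (simp add: single_add distrib_right)

lemma pd_word_append: "pd_word g (u @ v) = pd_word g u * mon v + mon u * pd_word g v"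
proof (induction u)
  case (Cons c u)
  show ?case
    by (simp add: Cons mono_append mono_Cons[of c u] distrib_left distrib_right mult.assoc del: mult_single)
qed (simp add: mono_Nil)

lemma wd_word_append: "wd_word g (u @ v) = wd_word g u * mon v + mon u * wd_word g v"
  by (simp only: wd_word_def weight_simps const_of_int_add mono_append mult_const_left mult.assoc)

lemma sd_word_append:
  "sd_word g (u @ v) = sd_word g u * mon v + mon u * sd_word g v
     + wd_word g u * pd_word g v - pd_word g u * wd_word g v"
proof (induction u)
  case Nil
  show ?case
    by (simp add: mono_Nil wd_word_def)
next
  case (Cons c u)
  have wd: "wd_word g (c # u) = const (of_int (pairing g c)) * (mon [c] * mon u) + mon [c] * wd_word g u"
    by (simp only: wd_word_def weight_simps const_of_int_add mono_Cons[of c u] mult_const_left)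
  show ?case
    unfolding append_Cons sd_word.simps Cons pd_word_append wd_word_append wd pd_word.simps mono_Cons[of c u]
    by (simp add: distrib_left distrib_right mult.assoc left_diff_distrib right_diff_distrib)
qed

definition pd_free :: "generator \<Rightarrow> classical_algebra \<Rightarrow> classical_algebra" where
  "pd_free g = linext (pd_word g)"

definition wd_free :: "generator \<Rightarrow> classical_algebra \<Rightarrow> classical_algebra" where
  "wd_free g = linext (wd_word g)"

definition sd_free :: "generator \<Rightarrow> classical_algebra \<Rightarrow> classical_algebra" where
  "sd_free g = linext (sd_word g)"

lemmas op_free_defs = pd_free_def wd_free_def sd_free_def

lemma pd_free_mult: "pd_free g (p * r) = pd_free g p * r + p * pd_free g r"
proof (induction p r rule: bilinear_induct)
  case (mono u v)
  show ?case
    by (simp only: pd_free_def linext_mono mono_append[symmetric] pd_word_append)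
qed (simp_all only: pd_free_def linext_simps mult.assoc mult_const_left distrib_left distrib_right, simp_all)

lemma wd_free_mult: "wd_free g (p * r) = wd_free g p * r + p * wd_free g r"
proof (induction p r rule: bilinear_induct)
  case (mono u v)
  show ?case
    by (simp only: wd_free_def linext_mono mono_append[symmetric] wd_word_append)
qed (simp_all only: wd_free_def linext_simps mult.assoc mult_const_left distrib_left distrib_right, simp_all)

lemma sd_free_mult:
  "sd_free g (p * r) = sd_free g p * r + p * sd_free g r + wd_free g p * pd_free g r - pd_free g p * wd_free g r"
proof (induction p r rule: bilinear_induct)
  case (mono u v)
  show ?case
    by (simp only: op_free_defs linext_mono mono_append[symmetric] sd_word_append)
qed (simp_all only: op_free_defs linext_simps mult.assoc mult_const_left distrib_left distrib_right
      right_diff_distrib, simp_all)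

definition classical_relator :: "generator \<Rightarrow> classical_algebra" where
  "classical_relator g = comm (mon [g]) (comm (mon [g]) (comm (mon [g]) (mon [other g])))"

lemma comm_cubic:
  "comm a (comm a (comm a b)) = a * (a * (a * b)) - 3 * (a * (a * (b * a))) + 3 * (a * (b * (a * a)))
     - b * (a * (a * (a :: 'u :: ring_1)))"
proof -
  have "3 * u = u + u + u" for u :: 'u
    using distrib_right[of 2 1 u] by (simp add: mult_2)
  then show ?thesis
    by (simp add: comm_def algebra_simps)
qed

lemma classical_relator_expand:
  "classical_relator g = mon [g, g, g, other g] + const (- 3) * mon [g, g, other g, g]
     + const 3 * mon [g, other g, g, g] + const (- 1) * mon [other g, g, g, g]"
proof -
  have "const (- 3) = (- 3 :: classical_algebra)" "const 3 = (3 :: classical_algebra)"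
    "const (- 1) = (- 1 :: classical_algebra)"
    by (simp_all add: single_uminus)
  moreover have "mon [a, b, c, d] = mon [a] * (mon [b] * (mon [c] * (mon [d] :: classical_algebra)))" for a b c d
    by (simp add: mult_single plus_word_def)
  ultimately show ?thesis
    unfolding classical_relator_def comm_cubic by simp
qed

lemma pd_free_mon: "pd_free g (mon [c]) = (if c = g then 1 else 0)"
  by (simp add: pd_free_def linext_mono mono_Nil)

lemma wd_free_mon: "wd_free g (mon [c]) = (if c = g then mon [c] else - mon [c])"
  by (simp add: wd_free_def linext_mono wd_word_def pairing_def mult_single single_uminus)

lemma sd_free_mon: "sd_free g (mon [c]) = 0"
  by (simp add: sd_free_def linext_mono wd_word_def)

lemma pd_free_classical_relator: "pd_free g (classical_relator h) = 0"
proof -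
  have *: "pd_free g (comm p r) = comm (pd_free g p) r + comm p (pd_free g r)" for g p r
    by (simp add: comm_def pd_free_mult linext_diff[of "pd_word g", folded pd_free_def])
  show ?thesis
    by (cases g; cases h) (simp_all add: classical_relator_def * pd_free_mon)
qed

lemma wd_free_classical_relator: "wd_free g (classical_relator h) = const (of_int (weight g [h, h, h, other h])) * classical_relator h"
proof -
  define k where "k = weight g [h, h, h, other h]"
  have "weight g [h, h, other h, h] = k" "weight g [h, other h, h, h] = k" "weight g [other h, h, h, h] = k"
    by (simp_all add: k_def)
  then have wd: "wd_word g [h, h, h, other h] = const (of_int k) * mon [h, h, h, other h]"
    "wd_word g [h, h, other h, h] = const (of_int k) * mon [h, h, other h, h]"
    "wd_word g [h, other h, h, h] = const (of_int k) * mon [h, other h, h, h]"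
    "wd_word g [other h, h, h, h] = const (of_int k) * mon [other h, h, h, h]"
    by (simp_all only: wd_word_def k_def[symmetric])
  show ?thesis
    unfolding classical_relator_expand wd_free_def linext_simps wd k_def[symmetric] distrib_left
    by (simp only: mult_const_left[of "const (of_int k)"])
qed

text \<open>
  Zero in the free algebra, not only modulo the relators, so that \<open>sd_free\<close> preserves the
  ideal by its product rule.
\<close>

lemma sd_free_classical_relator: "sd_free g (classical_relator h) = 0"
proof (rule poly_mapping_eqI)
  fix w
  have "g = a \<Longrightarrow> h = b \<Longrightarrow> Poly_Mapping.lookup (sd_free g (classical_relator h)) w = Poly_Mapping.lookup 0 w" for a b
    unfolding classical_relator_expand sd_free_def linext_simps
    by (cases a; cases b) (auto simp: wd_word_def pairing_def mult_single plus_word_def zero_word_def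
        distrib_left distrib_right right_diff_distrib lookup_add lookup_minus lookup_single when_def)
  then show "Poly_Mapping.lookup (sd_free g (classical_relator h)) w = Poly_Mapping.lookup 0 w"
    by blast
qed

text \<open>
  Generated by linear combinations only, so that an element of bounded length can be matched
  with relators of bounded length (\<open>classical_ideal_short\<close>). Stability under multiplication
  is a consequence.
\<close>

inductive_set classical_ideal :: "classical_algebra set" where
  gen: "mon l * classical_relator g * mon r \<in> classical_ideal"
| add: "p \<in> classical_ideal \<Longrightarrow> r \<in> classical_ideal \<Longrightarrow> p + r \<in> classical_ideal"
| scale: "p \<in> classical_ideal \<Longrightarrow> const c * p \<in> classical_ideal"

lemma classical_ideal_zero: "0 \<in> classical_ideal"
  using classical_ideal.scale[OF classical_ideal.gen, of 0] by simp

lemma classical_ideal_uminus: "p \<in> classical_ideal \<Longrightarrow> - p \<in> classical_ideal"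
  using classical_ideal.scale[of p "- 1"] by (simp add: single_uminus)

lemma classical_ideal_diff: "p \<in> classical_ideal \<Longrightarrow> r \<in> classical_ideal \<Longrightarrow> p - r \<in> classical_ideal"
  using classical_ideal.add[OF _ classical_ideal_uminus] by fastforce

lemma classical_ideal_mult_left: "p \<in> classical_ideal \<Longrightarrow> u * p \<in> classical_ideal"
proof (induction p rule: classical_ideal.induct)
  case (gen l g r)
  show ?case
  proof (induction u rule: word_algebra_induct)
    case (mono w)
    show ?case
      using classical_ideal.gen[of "w @ l" g r] by (simp only: mono_append mult.assoc)
  qed (simp_all only: distrib_right mult.assoc classical_ideal.add classical_ideal.scale)
qed (simp_all only: distrib_left mult_const_left classical_ideal.add classical_ideal.scale)

lemma classical_ideal_mult_right: "p \<in> classical_ideal \<Longrightarrow> p * u \<in> classical_ideal"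
proof (induction p rule: classical_ideal.induct)
  case (gen l g r)
  show ?case
  proof (induction u rule: word_algebra_induct)
    case (mono w)
    show ?case
      using classical_ideal.gen[of l g "r @ w"] by (simp only: mono_append mult.assoc)
  qed (simp_all only: distrib_left mult_const_left classical_ideal.add classical_ideal.scale)
qed (simp_all only: distrib_right mult.assoc classical_ideal.add classical_ideal.scale)

lemma classical_relator_in_ideal: "classical_relator g \<in> classical_ideal"
  using classical_ideal.gen[of "[]" g "[]"] by (simp add: mono_Nil)

lemmas classical_ideal_intros = classical_ideal.add classical_ideal.scale classical_ideal_zero
  classical_ideal_diff classical_ideal_mult_left classical_ideal_mult_right classical_relator_in_ideal

lemma op_free_scale: "pd_free g (const c * p) = const c * pd_free g p"
  "wd_free g (const c * p) = const c * wd_free g p" "sd_free g (const c * p) = const c * sd_free g p"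
  by (simp_all only: op_free_defs linext_scale)

lemma op_free_add: "pd_free g (p + r) = pd_free g p + pd_free g r"
  "wd_free g (p + r) = wd_free g p + wd_free g r" "sd_free g (p + r) = sd_free g p + sd_free g r"
  by (simp_all only: op_free_defs linext_add)

lemma op_free_diff: "pd_free g (p - r) = pd_free g p - pd_free g r"
  "wd_free g (p - r) = wd_free g p - wd_free g r" "sd_free g (p - r) = sd_free g p - sd_free g r"
  by (simp_all only: op_free_defs linext_diff)

lemma pd_free_ideal: "p \<in> classical_ideal \<Longrightarrow> pd_free g p \<in> classical_ideal"
proof (induction p rule: classical_ideal.induct)
  case (gen l h r)
  have "pd_free g (mon l * classical_relator h * mon r) =
      pd_free g (mon l) * classical_relator h * mon r + mon l * classical_relator h * pd_free g (mon r)"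
    by (simp add: pd_free_mult pd_free_classical_relator)
  then show ?case
    by (simp add: classical_ideal_intros)
qed (simp_all only: op_free_add op_free_scale classical_ideal_intros)

lemma wd_free_ideal: "p \<in> classical_ideal \<Longrightarrow> wd_free g p \<in> classical_ideal"
proof (induction p rule: classical_ideal.induct)
  case (gen l h r)
  have "wd_free g (mon l * classical_relator h * mon r) =
      wd_free g (mon l) * classical_relator h * mon r + mon l * wd_free g (classical_relator h) * mon r
      + mon l * classical_relator h * wd_free g (mon r)"
    by (simp add: wd_free_mult distrib_left distrib_right mult.assoc)
  then show ?case
    by (simp add: wd_free_classical_relator classical_ideal_intros)
qed (simp_all only: op_free_add op_free_scale classical_ideal_intros)

lemma sd_free_ideal: "p \<in> classical_ideal \<Longrightarrow> sd_free g p \<in> classical_ideal"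
proof (induction p rule: classical_ideal.induct)
  case (gen l h r)
  have "sd_free g (mon l * classical_relator h * mon r) =
      (sd_free g (mon l) * classical_relator h - pd_free g (mon l) * wd_free g (classical_relator h)) * mon r
      + mon l * classical_relator h * sd_free g (mon r) + wd_free g (mon l * classical_relator h) * pd_free g (mon r)
      - pd_free g (mon l) * classical_relator h * wd_free g (mon r)"
    by (simp add: sd_free_mult pd_free_mult pd_free_classical_relator sd_free_classical_relator)
  then show ?case
    by (simp add: wd_free_classical_relator wd_free_ideal classical_ideal_intros)
qed (simp_all only: op_free_add op_free_scale classical_ideal_intros)

lemma lookup_mult_Nil:
  "Poly_Mapping.lookup (p * r) 0 = Poly_Mapping.lookup p 0 * Poly_Mapping.lookup (r :: 'a word \<Rightarrow>\<^sub>0 'k::comm_ring_1) 0"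
proof (induction p r rule: bilinear_induct)
  case (mono u v)
  show ?case
    by (auto simp: mult_single lookup_single when_def zero_word_def plus_word_def)
qed (simp_all add: lookup_const_mult lookup_add mult.assoc mult_const_left distrib_left distrib_right)

lemma lookup_mon_Cons: "Poly_Mapping.lookup (mon (c # w)) 0 = 0"
  by (simp add: lookup_single zero_word_def)

lemma classical_ideal_lookup_Nil: "p \<in> classical_ideal \<Longrightarrow> Poly_Mapping.lookup p 0 = 0"
proof (induction p rule: classical_ideal.induct)
  case (gen l g r)
  have "Poly_Mapping.lookup (classical_relator g) 0 = 0"
    by (simp only: classical_relator_expand lookup_add lookup_const_mult lookup_mon_Cons) simp
  then show ?case
    by (simp only: lookup_mult_Nil mult_zero_left mult_zero_right)
qed (simp_all add: lookup_add lookup_const_mult)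

quotient_type classical = classical_algebra / "\<lambda>p r. p - r \<in> classical_ideal"
proof (rule equivpI)
  show "reflp (\<lambda>p r. p - r \<in> classical_ideal)"
    by (rule reflpI) (simp add: classical_ideal_zero)
  show "symp (\<lambda>p r. p - r \<in> classical_ideal)"
    by (rule sympI) (metis minus_diff_eq classical_ideal_uminus)
  show "transp (\<lambda>p r. p - r \<in> classical_ideal)"
  proof (rule transpI)
    fix p r s :: classical_algebra
    assume "p - r \<in> classical_ideal" "r - s \<in> classical_ideal"
    then have "(p - r) + (r - s) \<in> classical_ideal"
      by (rule classical_ideal.add)
    then show "p - s \<in> classical_ideal"
      by simp
  qed
qed

instantiation classical :: ring_1
begin

lift_definition zero_classical :: classical is 0 .

lift_definition one_classical :: classical is 1 .

lift_definition plus_classical :: "classical \<Rightarrow> classical \<Rightarrow> classical" is "(+)"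
  by (drule classical_ideal.add, assumption) (simp add: algebra_simps)

lift_definition minus_classical :: "classical \<Rightarrow> classical \<Rightarrow> classical" is "(-)"
  by (drule classical_ideal_diff, assumption) (simp add: algebra_simps)

lift_definition uminus_classical :: "classical \<Rightarrow> classical" is uminus
  by (drule classical_ideal_uminus) (simp add: algebra_simps)

lift_definition times_classical :: "classical \<Rightarrow> classical \<Rightarrow> classical" is "(*)"
proof -
  fix p p' r r' :: classical_algebra
  assume "p - p' \<in> classical_ideal" "r - r' \<in> classical_ideal"
  then have "(p - p') * r + p' * (r - r') \<in> classical_ideal"
    by (intro classical_ideal.add classical_ideal_mult_left classical_ideal_mult_right)
  then show "p * r - p' * r' \<in> classical_ideal"
    by (simp add: algebra_simps)
qed

instance
proof
  show "(0::classical) \<noteq> 1"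
    by transfer (use classical_ideal_lookup_Nil in fastforce)
qed (transfer, simp add: algebra_simps classical_ideal_zero)+

end

lift_definition classical_gen :: "generator \<Rightarrow> classical" is "\<lambda>g. mon [g]" .

lift_definition classical_scalar :: "complex \<Rightarrow> classical" is const .

lift_definition pd :: "generator \<Rightarrow> classical \<Rightarrow> classical" is pd_free
  by (metis op_free_diff(1) pd_free_ideal)

lift_definition wd :: "generator \<Rightarrow> classical \<Rightarrow> classical" is wd_free
  by (metis op_free_diff(2) wd_free_ideal)

lift_definition sd :: "generator \<Rightarrow> classical \<Rightarrow> classical" is sd_free
  by (metis op_free_diff(3) sd_free_ideal)

lemma op_free_const: "pd_free g (const c) = 0" "sd_free g (const c) = 0"
  using linext_scale[of "pd_word g" c 1] linext_scale[of "sd_word g" c 1]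
  by (simp_all add: op_free_defs linext_one)

lemma comm_lift: "comm (abs_classical p) (abs_classical r) = abs_classical (comm p r)"
  by (simp add: comm_def times_classical.abs_eq minus_classical.abs_eq)

lemma classical_serre: "comm (classical_gen g) (comm (classical_gen g) (comm (classical_gen g) (classical_gen (other g)))) = 0"
  unfolding classical_gen.abs_eq comm_lift zero_classical.abs_eq classical.abs_eq_iff
  using classical_relator_in_ideal[of g] by (simp add: classical_relator_def)

lemma classical_torsion_free:
  fixes u :: classical
  assumes "of_nat (Suc n) * u = 0"
  shows "u = 0"
proof -
  have nat: "of_nat k = classical_scalar (of_nat k)" for k
  proof (induction k)
    case 0
    show ?case
      by (simp add: classical_scalar.abs_eq zero_classical.abs_eq)
  next
    case (Suc k)
    then show ?case
      by (simp add: classical_scalar.abs_eq one_classical.abs_eq plus_classical.abs_eq single_add)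
  qed
  have "inverse (of_nat (Suc n)) * of_nat (Suc n) = (1 :: complex)"
    by (simp del: of_nat_Suc)
  then have "classical_scalar (inverse (of_nat (Suc n))) * classical_scalar (of_nat (Suc n)) = 1"
    by (simp only: classical_scalar.abs_eq times_classical.abs_eq one_classical.abs_eq mult_single add_0_left const_one)
  then have "u = classical_scalar (inverse (of_nat (Suc n))) * (of_nat (Suc n) * u)"
    by (simp add: nat mult.assoc[symmetric] del: of_nat_Suc)
  then show ?thesis
    using assms by simp
qed

interpretation classical: serre_operators "classical_gen Gen_A" "classical_gen Gen_B" classical_scalar pd wd sd
proof
  show "of_nat (Suc n) * u = 0 \<Longrightarrow> u = 0" for n and u :: classical
    by (rule classical_torsion_free)
  show "comm (classical_gen Gen_A) (comm (classical_gen Gen_A) (comm (classical_gen Gen_A) (classical_gen Gen_B))) = 0"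
    "comm (classical_gen Gen_B) (comm (classical_gen Gen_B) (comm (classical_gen Gen_B) (classical_gen Gen_A))) = 0"
    using classical_serre[of Gen_A] classical_serre[of Gen_B] by simp_all
  show "u * classical_scalar c = classical_scalar c * u" for u c
    by transfer (simp only: const_central diff_self classical_ideal_zero)
  show "pd g (u * v) = pd g u * v + u * pd g v" "wd g (u * v) = wd g u * v + u * wd g v"
    "sd g (u * v) = sd g u * v + u * sd g v + wd g u * pd g v - pd g u * wd g v" for g u v
    by (transfer, simp only: pd_free_mult wd_free_mult sd_free_mult diff_self classical_ideal_zero)+
qed (transfer, simp add: single_add mult_single op_free_add op_free_const pd_free_mon wd_free_mon
    sd_free_mon classical_ideal_zero)+

lemma classical_in_tail: "abs_classical p \<in> classical.tail 0"
proof (induction p rule: word_algebra_induct)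
  case (mono w)
  show ?case
  proof (induction w)
    case Nil
    have "abs_classical (mon []) = classical_scalar 1"
      by (simp only: mono_Nil classical_scalar.abs_eq const_one)
    then show ?case
      by (simp only: classical.tail_sc)
  next
    case (Cons c w)
    have "classical_gen c \<in> classical.tail 0"
      using classical.tail_root[of 0 0] classical.tail_root[of 0 1] classical.root_simps(1)[of 0]
        classical.root_simps(2)[of 0]
      by (cases c) simp_all
    moreover have "abs_classical (mon (c # w)) = classical_gen c * abs_classical (mon w)"
      by (simp only: mono_Cons[of c w] classical_gen.abs_eq times_classical.abs_eq)
    ultimately show ?case
      using Cons by (simp only: classical.tail_mult)
  qed
next
  case (scale c p)
  have "abs_classical (const c * p) = classical_scalar c * abs_classical p"
    by (simp only: classical_scalar.abs_eq times_classical.abs_eq)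
  with scale show ?case
    by (simp only: classical.tail_mult classical.tail_sc)
next
  case (add p r)
  then show ?case
    by (simp only: plus_classical.abs_eq[symmetric] classical.tail_add)
qed

text \<open>
  This is \<open>common_kernel_scalar\<close> for the quotient by the classical Serre relations; the
  coefficient of the empty word excludes non-zero scalars.
\<close>

theorem classical_ideal_criterion:
  assumes "Poly_Mapping.lookup p 0 = 0"
    and "\<And>g. pd_free g p \<in> classical_ideal" "\<And>g. sd_free g p \<in> classical_ideal"
  shows "p \<in> classical_ideal"
proof -
  have "pd g (abs_classical p) = 0" "sd g (abs_classical p) = 0" for g
    using assms(2,3) by (simp_all add: pd.abs_eq sd.abs_eq zero_classical.abs_eq classical.abs_eq_iff)
  moreover obtain d where "classical.tail_span 0 d (abs_classical p)"
    using classical_in_tail[of p] by (auto simp: classical.tail_def)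
  ultimately obtain c where "abs_classical p = classical_scalar c"
    using classical.common_kernel_scalar by blast
  then have *: "p - const c \<in> classical_ideal"
    by (simp add: classical_scalar.abs_eq classical.abs_eq_iff)
  from classical_ideal_lookup_Nil[OF this] assms(1) have "c = 0"
    by (simp add: lookup_minus)
  with * show ?thesis
    by simp
qed

section \<open>Deletion operators on the kernel\<close>

primrec letter_of :: "generator \<Rightarrow> letter" where
  "letter_of Gen_A = Letter_x" | "letter_of Gen_B = Letter_y"

abbreviation gen_image :: "generator \<Rightarrow> shuffle_space" where
  "gen_image g \<equiv> of_word [letter_of g]"

definition tq :: qfield where
  "tq = - (q ^ 2)"

definition braid :: "generator \<Rightarrow> generator \<Rightarrow> qfield" where
  "braid g c = (if c = g then tq else inverse tq)"

lemma tq_neq_0: "tq \<noteq> 0"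
  by (simp add: tq_def q_neq_0)

lemma cross_letter: "cross (letter_of g) [letter_of c] = braid g c"
  by (cases g; cases c) (simp_all add: cross_def braid_def form_def tq_def power_int_minus)

lemma fscale_eq: "fscale c p = const c * p"
  by (rule fscale_conv_mult)

lemma of_word_eq_mon: "of_word w = mon w"
  by (rule of_word_def)

text \<open>
  The letter \<open>b\<close> comes first in a product with \<open>a\<close> on the left only after passing \<open>a\<close>.
\<close>

lemma shuffle_letter_left:
  "of_word [a] \<star> (of_word [b] * f) = of_word [a] * (of_word [b] * f)
     + const (cross b [a]) * (of_word [b] * (of_word [a] \<star> f))"
  using shuffle_rec[of a 1 b f]
  by (simp add: shuffle_one_left twist_of_word shuffle_scale_left fscale_mult_right fscale_eq[symmetric])

lemma shuffle_letter_right: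
  "(f * of_word [a]) \<star> of_word [b] = f * of_word [a] * of_word [b]
     + const (cross b [a]) * ((f \<star> of_word [b]) * of_word [a])"
proof (induction f rule: free_algebra_induct)
  case (mono w)
  show ?case
  proof (induction w)
    case Nil
    show ?case
      using shuffle_letter_left[of a b 1] by (simp add: of_word_Nil shuffle_one_left shuffle_one_right)
  next
    case (Cons c w)
    have W: "of_word (c # w) = of_word [c] * of_word w"
      using of_word_append[of "[c]" w] by simp
    have *: "(of_word [c] * f) \<star> of_word [b] =
        of_word [c] * (f \<star> of_word [b]) + of_word [b] * twist b (of_word [c] * f)" for f
      using shuffle_rec[of c f b 1] by (simp add: shuffle_one_right)
    show ?case
      unfolding W mult.assoc * Cons[unfolded mult.assoc]
      by (simp add: twist_mult twist_of_word distrib_left distrib_right fscale_mult_left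
        fscale_mult_right mult.assoc fscale_eq[symmetric])
  qed
qed (simp_all add: shuffle_bilinear fscale_mult_left fscale_mult_right distrib_right
    fvs.scale_right_distrib fscale_eq[symmetric] fvs.scale_left_commute)

primrec shuffle_gens :: "generator list \<Rightarrow> shuffle_space" where
  "shuffle_gens [] = 1"
| "shuffle_gens (c # w) = gen_image c \<star> shuffle_gens w"

definition phi :: "generator free_algebra \<Rightarrow> shuffle_space" where
  "phi = linext shuffle_gens"

lemma phi_simps: "phi (p + r) = phi p + phi r" "phi (const c * p) = const c * phi p"
  "phi (mon w) = shuffle_gens w" "phi 0 = 0" "phi 1 = 1"
  by (simp_all add: phi_def linext_simps linext_one)

lemma phi_diff: "phi (p - r) = phi p - phi r"
  by (simp add: phi_def linext_diff)

lemma shuffle_const: "(const c * f) \<star> g = const c * (f \<star> g)" "f \<star> (const c * g) = const c * (f \<star> g)"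
  by (simp_all only: fscale_eq[symmetric] shuffle_bilinear)

lemma shuffle_gens_append: "shuffle_gens (u @ v) = shuffle_gens u \<star> shuffle_gens v"
  by (induction u) (simp_all add: shuffle_one_left shuffle_assoc)

lemma phi_mult: "phi (p * r) = phi p \<star> phi r"
proof (induction p r rule: bilinear_induct)
  case (mono u v)
  show ?case
    by (simp only: mono_append[symmetric] phi_simps shuffle_gens_append)
qed (simp_all only: distrib_left distrib_right mult.assoc mult_const_left phi_simps shuffle_const
    shuffle_bilinear)

lemma phi_gen: "phi (mon [c]) = gen_image c"
  by (simp only: phi_simps shuffle_gens.simps shuffle_one_right)

lemma phi_zero_mult: "phi p = 0 \<Longrightarrow> phi (p * r) = 0" "phi r = 0 \<Longrightarrow> phi (p * r) = 0"
  using shuffle_scale_left[of 0] shuffle_scale_right[of _ 0] by (simp_all add: phi_mult)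

text \<open>
  Deleting an occurrence of \<open>g\<close> costs the factor of \<open>g\<close> moving left through everything
  before it. In \<open>del_right_word\<close> it is the factor for moving right through everything after
  it.
\<close>

primrec del_left_word :: "generator \<Rightarrow> generator list \<Rightarrow> generator free_algebra" where
  "del_left_word g [] = 0"
| "del_left_word g (c # w) = (if c = g then mon w else 0) + const (braid g c) * (mon [c] * del_left_word g w)"

definition braid_word :: "generator \<Rightarrow> generator list \<Rightarrow> qfield" where
  "braid_word g w = (\<Prod>c\<leftarrow>w. braid g c)"

primrec del_right_word :: "generator \<Rightarrow> generator list \<Rightarrow> generator free_algebra" where
  "del_right_word g [] = 0"
| "del_right_word g (c # w) = (if c = g then const (braid_word g w) * mon w else 0) + mon [c] * del_right_word g w"

lemma del_right_word_snoc:
  "del_right_word g (w @ [c]) = (if c = g then mon w else 0) + const (braid g c) * (del_right_word g w * mon [c])"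
proof (induction w)
  case (Cons d w)
  have "const (braid_word g (w @ [c])) * mon (w @ [c]) =
      const (braid g c) * (const (braid_word g w) * (mon w * (mon [c] :: generator free_algebra)))"
    by (simp add: mult_single plus_word_def zero_word_def braid_word_def mult.commute)
  moreover have "mon [d] * mon w = (mon (d # w) :: generator free_algebra)"
    by (simp add: mono_Cons[of d w])
  ultimately show ?case
    unfolding append_Cons del_right_word.simps Cons
    by (cases "c = g"; cases "d = g") (simp_all only: simp_thms if_True if_False distrib_left distrib_right
        mult.assoc mult_const_left[of "mon [a]" for a] mult_zero_left mult_zero_right add_0_left add_0_right add_ac)
qed (simp add: braid_word_def mono_Nil)

definition del_left :: "generator \<Rightarrow> generator free_algebra \<Rightarrow> generator free_algebra" where
  "del_left g = linext (del_left_word g)"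

definition del_right :: "generator \<Rightarrow> generator free_algebra \<Rightarrow> generator free_algebra" where
  "del_right g = linext (del_right_word g)"

text \<open>
  Every letter of \<open>w\<close> is the first letter of some of the terms of the shuffle product of all
  letters, and what remains is the product of the other letters.
\<close>

lemma shuffle_gens_left:
  "shuffle_gens w = (if w = [] then 1 else 0)
     + gen_image Gen_A * phi (del_left_word Gen_A w) + gen_image Gen_B * phi (del_left_word Gen_B w)"
proof (induction w)
  case (Cons c w)
  have step: "gen_image c \<star> (gen_image g * phi (del_left_word g w)) =
      gen_image c * (gen_image g * phi (del_left_word g w))
      + gen_image g * phi (const (braid g c) * (mon [c] * del_left_word g w))" for g
    unfolding phi_simps(2) phi_mult[of "mon [c]"] phi_gen shuffle_letter_left cross_letter
      mult_const_left[of "gen_image g"] ..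
  have "gen_image c \<star> shuffle_gens w = gen_image c * shuffle_gens w
      + gen_image Gen_A * phi (const (braid Gen_A c) * (mon [c] * del_left_word Gen_A w))
      + gen_image Gen_B * phi (const (braid Gen_B c) * (mon [c] * del_left_word Gen_B w))"
  proof -
    let ?e = "if w = [] then 1 else 0 :: shuffle_space"
    have e: "gen_image c \<star> ?e = gen_image c * ?e"
      using shuffle_scale_right[of _ 0] by (simp add: shuffle_one_right)
    show ?thesis
      by (subst (1 2) Cons) (simp only: shuffle_add_right e step distrib_left add_ac)
  qed
  then show ?case
    by (cases c) (simp_all add: phi_simps distrib_left add_ac)
qed (simp add: phi_simps)

lemma shuffle_gens_right:
  "shuffle_gens w = (if w = [] then 1 else 0)
     + phi (del_right_word Gen_A w) * gen_image Gen_A + phi (del_right_word Gen_B w) * gen_image Gen_B"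
proof (induction w rule: rev_induct)
  case (snoc c w)
  have step: "(phi (del_right_word g w) * gen_image g) \<star> gen_image c =
      phi (del_right_word g w) * gen_image g * gen_image c
      + phi (const (braid c g) * (del_right_word g w * mon [c])) * gen_image g" for g
    unfolding phi_simps(2) phi_mult[of _ "mon [c]"] phi_gen shuffle_letter_right cross_letter
      mult.assoc[of "const _"] ..
  have "shuffle_gens w \<star> gen_image c = shuffle_gens w * gen_image c
      + phi (const (braid c Gen_A) * (del_right_word Gen_A w * mon [c])) * gen_image Gen_A
      + phi (const (braid c Gen_B) * (del_right_word Gen_B w * mon [c])) * gen_image Gen_B"
  proof -
    let ?e = "if w = [] then 1 else 0 :: shuffle_space"
    have e: "?e \<star> gen_image c = ?e * gen_image c"
      using shuffle_scale_left[of 0] by (simp add: shuffle_one_left)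
    show ?thesis
      by (subst (1 2) snoc) (simp only: shuffle_add_left e step distrib_right add_ac)
  qed
  then show ?case
    by (cases c) (simp_all add: shuffle_gens_append shuffle_one_right del_right_word_snoc braid_def
      phi_simps distrib_right add_ac)
qed (simp add: phi_simps)

lemma phi_left: "phi u = const (Poly_Mapping.lookup u 0)
     + gen_image Gen_A * phi (del_left Gen_A u) + gen_image Gen_B * phi (del_left Gen_B u)"
proof (induction u rule: word_algebra_induct)
  case (mono w)
  show ?case
    using shuffle_gens_left[of w]
    by (cases w) (simp_all add: del_left_def linext_mono linext_one phi_simps zero_word_def[symmetric] lookup_mon_Cons)
qed (simp_all only: del_left_def linext_simps phi_simps lookup_const_mult lookup_add single_add mult_single[symmetric]
    distrib_left mult_const_left, simp_all add: mult_single)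

lemma phi_right: "phi u = const (Poly_Mapping.lookup u 0)
     + phi (del_right Gen_A u) * gen_image Gen_A + phi (del_right Gen_B u) * gen_image Gen_B"
proof (induction u rule: word_algebra_induct)
  case (mono w)
  show ?case
    using shuffle_gens_right[of w]
    by (cases w) (simp_all add: del_right_def linext_mono linext_one phi_simps zero_word_def[symmetric] lookup_mon_Cons)
qed (simp_all only: del_right_def linext_simps phi_simps lookup_const_mult lookup_add single_add mult_single[symmetric]
    distrib_left distrib_right mult.assoc, simp_all add: mult_single)

lemma lookup_mon_mult_left:
  "Poly_Mapping.lookup (mon [a] * p) (Word (b # w)) =
     (if a = b then Poly_Mapping.lookup p (Word w) else (0 :: 'k :: comm_ring_1))"
proof (induction p rule: word_algebra_induct)
  case (mono v)
  show ?case
    by (auto simp: mult_single plus_word_def lookup_single when_def)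
qed (simp_all add: mult_const_left lookup_const_mult distrib_left lookup_add)

lemma lookup_mon_mult_right:
  "Poly_Mapping.lookup (p * mon [a]) (Word (w @ [b])) =
     (if a = b then Poly_Mapping.lookup p (Word w) else (0 :: 'k :: comm_ring_1))"
proof (induction p rule: word_algebra_induct)
  case (mono v)
  show ?case
    by (auto simp: mult_single plus_word_def lookup_single when_def)
qed (simp_all add: mult.assoc lookup_const_mult distrib_right lookup_add)

lemma poly_mapping_word_eqI:
  "(\<And>w. Poly_Mapping.lookup p (Word w) = Poly_Mapping.lookup r (Word w)) \<Longrightarrow> p = r"
  by (rule poly_mapping_eqI) (metis word.exhaust)

lemma lookup_const_Word: "w \<noteq> [] \<Longrightarrow> Poly_Mapping.lookup (const c) (Word w) = 0"
  by (simp add: lookup_single zero_word_def)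

text \<open>
  The terms of \<open>phi u\<close> that start with a given letter are independent of those that start
  with the other one, so each part of \<open>phi_left\<close> vanishes separately.
\<close>

lemma phi_del_left:
  assumes "phi u = 0"
  shows "phi (del_left g u) = 0"
proof (rule poly_mapping_word_eqI)
  fix w
  have "Poly_Mapping.lookup (phi u) (Word (letter_of g # w)) = Poly_Mapping.lookup (phi (del_left g u)) (Word w)"
    by (subst phi_left) (cases g; simp only: lookup_add of_word_eq_mon lookup_mon_mult_left, simp add: lookup_const_Word)
  then show "Poly_Mapping.lookup (phi (del_left g u)) (Word w) = Poly_Mapping.lookup 0 (Word w)"
    using assms by simp
qed

lemma phi_del_right:
  assumes "phi u = 0"
  shows "phi (del_right g u) = 0"
proof (rule poly_mapping_word_eqI)
  fix w
  have "Poly_Mapping.lookup (phi u) (Word (w @ [letter_of g])) = Poly_Mapping.lookup (phi (del_right g u)) (Word w)"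
    by (subst phi_right) (cases g; simp only: lookup_add of_word_eq_mon lookup_mon_mult_right, simp add: lookup_const_Word)
  then show "Poly_Mapping.lookup (phi (del_right g u)) (Word w) = Poly_Mapping.lookup 0 (Word w)"
    using assms by simp
qed

lemma phi_zero_lookup_Nil:
  assumes "phi u = 0"
  shows "Poly_Mapping.lookup u 0 = 0"
  using phi_left[of u] phi_del_left[OF assms] assms by (metis add.right_neutral lookup_single_eq lookup_zero mult_zero_right)

lemma phi_zeroI:
  assumes "Poly_Mapping.lookup u 0 = 0" "\<And>g. phi (del_left g u) = 0"
  shows "phi u = 0"
  by (subst phi_left) (simp add: assms)

section \<open>Evaluation of rational functions at the imaginary unit\<close>

definition at_i :: "rat poly \<Rightarrow> complex" where
  "at_i p = poly (map_poly of_rat p) \<i>"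

lemma at_i_0 [simp]: "at_i 0 = 0"
  by (simp add: at_i_def)

lemma at_i_pCons: "at_i (pCons c p) = of_rat c + \<i> * at_i p"
  by (simp add: at_i_def map_poly_pCons)

lemma at_i_add: "at_i (p + r) = at_i p + at_i r"
  by (induction p r rule: poly_induct2) (simp_all add: at_i_pCons of_rat_add algebra_simps)

lemma at_i_smult: "at_i (smult c p) = of_rat c * at_i p"
  by (induction p) (simp_all add: at_i_pCons of_rat_mult algebra_simps)

lemma at_i_mult: "at_i (p * r) = at_i p * at_i r"
  by (induction p) (simp_all add: at_i_pCons at_i_add at_i_smult algebra_simps)

lemma at_i_uminus: "at_i (- p) = - at_i p"
  using at_i_add[of p "- p"] by (simp add: eq_neg_iff_add_eq_0 add.commute)

lemma at_i_one [simp]: "at_i 1 = 1"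
  using at_i_pCons[of 1 0] by (simp add: one_pCons)

definition min_poly_i :: "rat poly" where
  "min_poly_i = [:1, 0, 1:]"

lemma at_i_min_poly: "at_i min_poly_i = 0"
  by (simp add: min_poly_i_def at_i_pCons)

lemma at_i_eq_0_imp_dvd:
  assumes "at_i p = 0"
  shows "min_poly_i dvd p"
proof -
  define r where "r = p mod min_poly_i"
  have deg: "degree r < 2"
    using degree_mod_less'[of min_poly_i p] unfolding r_def
    by (cases "p mod min_poly_i = 0") (auto simp: min_poly_i_def)
  have "p = p div min_poly_i * min_poly_i + r"
    by (simp add: r_def)
  then have "at_i r = 0"
    using assms at_i_min_poly by (metis add.left_neutral at_i_add at_i_mult mult_zero_right)
  moreover have r: "r = [:coeff r 0, coeff r 1:]"
    using deg by (intro poly_eqI) (auto simp: coeff_pCons coeff_eq_0 split: nat.split)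
  moreover have "at_i [:a, b:] = of_rat a + \<i> * of_rat b" for a b
    by (simp add: at_i_pCons)
  ultimately have "of_rat (coeff r 0) + \<i> * of_rat (coeff r 1) = (0 :: complex)"
    by metis
  moreover have "of_rat a = complex_of_real (of_rat a)" for a
    by (cases a) (simp add: of_rat_rat)
  ultimately have "complex_of_real (of_rat (coeff r 0)) + \<i> * complex_of_real (of_rat (coeff r 1)) = 0"
    by metis
  then have "coeff r 0 = 0" "coeff r 1 = 0"
    by (simp_all add: complex_eq_iff)
  with r have "r = 0"
    by simp
  then show ?thesis
    by (simp add: r_def dvd_eq_mod_eq_0)
qed

lemma at_i_factor:
  assumes "p \<noteq> 0"
  shows "\<exists>k r. p = min_poly_i ^ k * r \<and> at_i r \<noteq> 0"
  using assms
proof (induction "degree p" arbitrary: p rule: less_induct)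
  case less
  show ?case
  proof (cases "at_i p = 0")
    case True
    then obtain s where s: "p = min_poly_i * s"
      using at_i_eq_0_imp_dvd by blast
    have "min_poly_i \<noteq> 0" "degree min_poly_i = 2"
      by (simp_all add: min_poly_i_def)
    with less.prems s have "s \<noteq> 0" "degree s < degree p"
      by (auto simp: degree_mult_eq)
    with less.hyps obtain k r where "s = min_poly_i ^ k * r" "at_i r \<noteq> 0"
      by blast
    with s show ?thesis
      by (intro exI[of _ "Suc k"] exI[of _ r]) (simp add: mult.assoc)
  next
    case False
    then show ?thesis
      by (intro exI[of _ 0] exI[of _ p]) simp
  qed
qed

text \<open>
  The local ring at the place \<open>q\<^sup>2 + 1\<close> of the rational function field, with \<open>ev\<close> its
  residue map.
\<close>

definition regular :: "qfield \<Rightarrow> bool" where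
  "regular c \<longleftrightarrow> (\<exists>a b. c = Fract a b \<and> at_i b \<noteq> 0)"

definition ev :: "qfield \<Rightarrow> complex" where
  "ev c = (SOME z. \<exists>a b. c = Fract a b \<and> at_i b \<noteq> 0 \<and> z = at_i a / at_i b)"

lemma at_i_neq_0: "at_i b \<noteq> 0 \<Longrightarrow> b \<noteq> 0"
  by auto

lemma regular_Fract: "at_i b \<noteq> 0 \<Longrightarrow> regular (Fract a b)"
  by (auto simp: regular_def)

lemma ev_Fract:
  assumes "at_i b \<noteq> 0"
  shows "ev (Fract a b) = at_i a / at_i b"
  unfolding ev_def
proof (rule some_equality)
  show "\<exists>a' b'. Fract a b = Fract a' b' \<and> at_i b' \<noteq> 0 \<and> at_i a / at_i b = at_i a' / at_i b'"
    using assms by blast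
next
  fix z assume "\<exists>a' b'. Fract a b = Fract a' b' \<and> at_i b' \<noteq> 0 \<and> z = at_i a' / at_i b'"
  then obtain a' b' where *: "Fract a b = Fract a' b'" "at_i b' \<noteq> 0" "z = at_i a' / at_i b'"
    by blast
  then have "a * b' = a' * b"
    using assms by (simp add: eq_fract at_i_neq_0)
  then have "at_i a * at_i b' = at_i a' * at_i b"
    by (metis at_i_mult)
  with * assms show "z = at_i a / at_i b"
    by (simp add: frac_eq_eq)
qed

lemma regularE:
  assumes "regular c"
  obtains a b where "c = Fract a b" "at_i b \<noteq> 0"
  using assms by (auto simp: regular_def)

lemma regular_add: "regular c \<Longrightarrow> regular d \<Longrightarrow> regular (c + d)"
  and ev_add: "regular c \<Longrightarrow> regular d \<Longrightarrow> ev (c + d) = ev c + ev d"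
  by (elim regularE; simp add: at_i_neq_0 regular_Fract ev_Fract at_i_mult at_i_add field_simps)+

lemma regular_mult: "regular c \<Longrightarrow> regular d \<Longrightarrow> regular (c * d)"
  and ev_mult: "regular c \<Longrightarrow> regular d \<Longrightarrow> ev (c * d) = ev c * ev d"
  by (elim regularE; simp add: at_i_neq_0 regular_Fract ev_Fract at_i_mult)+

lemma regular_0 [simp]: "regular 0" and ev_0 [simp]: "ev 0 = 0"
  and regular_1 [simp]: "regular 1" and ev_1 [simp]: "ev 1 = 1"
  using regular_Fract[of 1 0] ev_Fract[of 1 0] regular_Fract[of 1 1] ev_Fract[of 1 1]
  by (simp_all add: Zero_fract_def One_fract_def)

lemma regular_uminus: "regular c \<Longrightarrow> regular (- c)" and ev_uminus: "regular c \<Longrightarrow> ev (- c) = - ev c"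
  by (elim regularE; simp add: regular_Fract ev_Fract at_i_uminus)+

lemma regular_diff: "regular c \<Longrightarrow> regular d \<Longrightarrow> regular (c - d)"
  and ev_diff: "regular c \<Longrightarrow> regular d \<Longrightarrow> ev (c - d) = ev c - ev d"
  using regular_add[of c "- d"] ev_add[of c "- d"] by (simp_all add: regular_uminus ev_uminus)

lemma regular_inverse: "regular c \<Longrightarrow> ev c \<noteq> 0 \<Longrightarrow> regular (inverse c)"
  and ev_inverse: "regular c \<Longrightarrow> ev c \<noteq> 0 \<Longrightarrow> ev (inverse c) = inverse (ev c)"
  by (elim regularE; simp add: regular_Fract ev_Fract)+

lemma regular_power: "regular c \<Longrightarrow> regular (c ^ n)"
  by (induction n) (simp_all add: regular_mult)

lemma regular_q: "regular q" and ev_q: "ev q = \<i>"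
  unfolding q_def using regular_Fract[of 1 "[:0, 1:]"] ev_Fract[of 1 "[:0, 1:]"]
  by (simp_all add: at_i_pCons)

lemma Fract_min_poly: "Fract min_poly_i 1 = q ^ 2 + 1"
  by (simp add: q_def One_fract_def power2_eq_square min_poly_i_def one_pCons)

lemma q2_plus_1_neq_0: "q ^ 2 + 1 \<noteq> 0"
  unfolding Fract_min_poly[symmetric] by (simp add: Zero_fract_def eq_fract min_poly_i_def)

text \<open>
  \<open>q\<^sup>2 + 1\<close> is a uniformiser of the local ring, being irreducible over the rationals.
\<close>

lemma normalize_pole:
  assumes "c \<noteq> 0"
  shows "\<exists>n::int. regular (c * (q ^ 2 + 1) powi n) \<and> ev (c * (q ^ 2 + 1) powi n) \<noteq> 0"
proof -
  obtain a b where c: "c = Fract a b" "b \<noteq> 0"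
    by (cases c) auto
  with assms have "a \<noteq> 0"
    by (auto simp: Zero_fract_def eq_fract)
  obtain k a' where a: "a = min_poly_i ^ k * a'" "at_i a' \<noteq> 0"
    using at_i_factor[OF \<open>a \<noteq> 0\<close>] by blast
  obtain l b' where b: "b = min_poly_i ^ l * b'" "at_i b' \<noteq> 0"
    using at_i_factor[OF \<open>b \<noteq> 0\<close>] by blast
  have pow: "Fract (min_poly_i ^ m) 1 = (q ^ 2 + 1) ^ m" for m
  proof (induction m)
    case (Suc m)
    have "Fract (min_poly_i ^ Suc m) 1 = Fract min_poly_i 1 * Fract (min_poly_i ^ m) 1"
      by simp
    then show ?case
      by (simp only: Suc Fract_min_poly power_Suc)
  qed (simp add: One_fract_def)
  have "c = Fract (min_poly_i ^ k) 1 / Fract (min_poly_i ^ l) 1 * Fract a' b'"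
    using a b c by (simp add: mult.commute)
  then have "c * (q ^ 2 + 1) powi (int l - int k) = Fract a' b'"
    using q2_plus_1_neq_0 by (simp add: pow power_int_diff field_simps)
  with a b show ?thesis
    by (intro exI[of _ "int l - int k"]) (simp add: regular_Fract ev_Fract)
qed

section \<open>Reduction of the kernel at the imaginary unit\<close>

lemma regular_tq: "regular tq" and ev_tq: "ev tq = 1"
  by (simp_all add: tq_def regular_uminus regular_q regular_power ev_uminus power2_eq_square ev_mult
      regular_mult ev_q)

lemma tq_neq_1: "tq - 1 \<noteq> 0"
  using q2_plus_1_neq_0 unfolding tq_def by (metis add.commute diff_minus_eq_add minus_diff_eq neg_equal_0_iff_equal)

lemma regular_braid: "regular (braid g c)" and ev_braid: "ev (braid g c) = 1"
  by (simp_all add: braid_def regular_tq ev_tq regular_inverse ev_inverse)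

definition integral :: "'a free_algebra \<Rightarrow> bool" where
  "integral u \<longleftrightarrow> (\<forall>w. regular (Poly_Mapping.lookup u w))"

definition red :: "'a free_algebra \<Rightarrow> ('a word \<Rightarrow>\<^sub>0 complex)" where
  "red = Poly_Mapping.map ev"

lemma lookup_red: "Poly_Mapping.lookup (red u) w = ev (Poly_Mapping.lookup u w)"
  by (simp add: red_def Poly_Mapping.map.rep_eq when_def)

lemma integral_simps:
  "integral 0" "integral (mon w)" "integral u \<Longrightarrow> integral v \<Longrightarrow> integral (u + v)"
  "integral u \<Longrightarrow> integral v \<Longrightarrow> integral (u - v)" "regular c \<Longrightarrow> integral u \<Longrightarrow> integral (const c * u)"
  by (auto simp: integral_def lookup_add lookup_minus lookup_const_mult lookup_single when_def
      intro: regular_add regular_diff regular_mult)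

lemma red_simps:
  "red 0 = 0" "red (mon w) = mon w"
  "integral u \<Longrightarrow> integral v \<Longrightarrow> red (u + v) = red u + red v"
  "integral u \<Longrightarrow> integral v \<Longrightarrow> red (u - v) = red u - red v"
  "regular c \<Longrightarrow> integral u \<Longrightarrow> red (const c * u) = const (ev c) * red u"
  by (auto simp: integral_def lookup_add lookup_minus lookup_const_mult lookup_single when_def lookup_red
      ev_add ev_diff ev_mult intro!: poly_mapping_eqI)

lemma integral_induct [consumes 1, case_names zero add]:
  assumes "integral u" and zero: "P 0"
    and add: "\<And>c w u. regular c \<Longrightarrow> integral u \<Longrightarrow> P u \<Longrightarrow> P (const c * mon w + u)"
  shows "P u"
proof -
  have "P (\<Sum>w\<in>W. Poly_Mapping.single w (Poly_Mapping.lookup u w))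
      \<and> integral (\<Sum>w\<in>W. Poly_Mapping.single w (Poly_Mapping.lookup u w))" if "finite W" for W
    using that
  proof (induction W rule: finite_induct)
    case (insert w W)
    have *: "Poly_Mapping.single w (Poly_Mapping.lookup u w) = const (Poly_Mapping.lookup u w) * mon (letters w)"
      by (simp add: mult_single)
    have "regular (Poly_Mapping.lookup u w)"
      using assms(1) by (simp add: integral_def)
    with insert show ?case
      unfolding sum.insert[OF insert.hyps] * by (blast intro: add integral_simps)
  qed (simp add: zero integral_simps)
  moreover have "u = (\<Sum>w\<in>Poly_Mapping.keys u. Poly_Mapping.single w (Poly_Mapping.lookup u w))"
    by (rule poly_mapping_eqI) (simp add: lookup_sum lookup_single when_def in_keys_iff cong: if_cong)
  ultimately show ?thesis
    using finite_keys[of u] by metis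
qed

lemma linext_red:
  assumes "\<And>w. integral (f w)" "\<And>w. red (f w) = g w" "integral u"
  shows "integral (linext f u) \<and> red (linext f u) = linext g (red u)"
  using assms(3)
proof (induction u rule: integral_induct)
  case (add c w u)
  then show ?case
    by (simp only: linext_simps red_simps integral_simps assms)
qed (simp add: integral_simps red_simps)

lemma red_mon_mult:
  assumes "integral u"
  shows "integral (mon [c] * u)" "red (mon [c] * u) = mon [c] * red u"
proof -
  have *: "mon [c] * v = linext (\<lambda>w. mon (c # w)) v" for v :: "'a word \<Rightarrow>\<^sub>0 'k :: comm_ring_1"
  proof (induction v rule: word_algebra_induct)
    case (mono w)
    show ?case
      unfolding linext_mono by (rule mono_Cons[symmetric])
  next
    case (scale d v)
    have "mon [c] * (const d * v) = const d * (mon [c] * v)"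
      by (rule mult_const_left)
    with scale show ?case
      by (simp only: linext_scale)
  qed (simp only: linext_add distrib_left)
  show "integral (mon [c] * u)" "red (mon [c] * u) = mon [c] * red u"
    unfolding * using linext_red[of "\<lambda>w. mon (c # w)" "\<lambda>w. mon (c # w)", OF _ _ assms]
    by (simp_all add: integral_simps red_simps)
qed

text \<open>
  At \<open>tq = 1\<close> left and right deletion agree, so the division costs no integrality. In the
  limit the two powers of \<open>tq\<close> are replaced by their exponents, the weight before and the
  weight after the deleted letter; this is \<open>sd_word\<close>.
\<close>

definition del_diff_word :: "generator \<Rightarrow> generator list \<Rightarrow> generator free_algebra" where
  "del_diff_word g w = const (1 / (tq - 1)) * (del_left_word g w - del_right_word g w)"

definition del_diff :: "generator \<Rightarrow> generator free_algebra \<Rightarrow> generator free_algebra" where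
  "del_diff g u = const (1 / (tq - 1)) * (del_left g u - del_right g u)"

lemma del_diff_eq_linext: "del_diff g u = linext (del_diff_word g) u"
proof (induction u rule: word_algebra_induct)
  case (scale c p)
  have "del_diff g (const c * p) = const (1 / (tq - 1)) * (const c * (del_left g p - del_right g p))"
    by (simp only: del_diff_def del_left_def del_right_def linext_scale right_diff_distrib)
  also have "\<dots> = const c * del_diff g p"
    unfolding del_diff_def by (rule mult_const_left)
  finally show ?case
    by (simp only: scale linext_scale)
next
  case (add p r)
  have "del_diff g (p + r) = del_diff g p + del_diff g r"
    by (simp only: del_diff_def del_left_def del_right_def linext_add distrib_left add_diff_add)
  with add show ?case
    by (simp only: linext_add)
qed (simp only: del_diff_def del_left_def del_right_def linext_mono del_diff_word_def)

lemma del_left_word_red: "integral (del_left_word g w)" "red (del_left_word g w) = pd_word g w"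
  by (induction w) (simp_all add: integral_simps red_simps red_mon_mult regular_braid ev_braid)

lemma del_diff_word_Cons: "del_diff_word g (c # w) = mon [c] * del_diff_word g w
    + const ((braid g c - 1) / (tq - 1)) * (mon [c] * del_left_word g w)
    - (if c = g then const ((braid_word g w - 1) / (tq - 1)) * mon w else 0)"
proof -
  have "const ((a - 1) / (tq - 1)) * p = const (1 / (tq - 1)) * (const a * p - p)"
    for a and p :: "generator free_algebra"
    by (rule poly_mapping_eqI) (simp add: lookup_const_mult lookup_minus algebra_simps diff_divide_distrib)
  then show ?thesis
    unfolding del_diff_word_def del_left_word.simps del_right_word.simps
    by (simp add: mult_const_left[of "mon [a]" for a] right_diff_distrib distrib_left)
qed

lemma braid_quotient: "regular ((braid g c - 1) / (tq - 1))" "ev ((braid g c - 1) / (tq - 1)) = of_int (pairing g c)"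
proof -
  have "(inverse tq - 1) / (tq - 1) = - inverse tq"
    using tq_neq_0 tq_neq_1 by (simp add: field_simps)
  then show "regular ((braid g c - 1) / (tq - 1))" "ev ((braid g c - 1) / (tq - 1)) = of_int (pairing g c)"
    using tq_neq_1
    by (simp_all add: braid_def pairing_def regular_uminus ev_uminus regular_inverse ev_inverse regular_tq ev_tq)
qed

lemma braid_word_quotient:
  "regular ((braid_word g w - 1) / (tq - 1)) \<and> ev ((braid_word g w - 1) / (tq - 1)) = of_int (weight g w)"
proof (induction w)
  case (Cons c w)
  have "(braid_word g (c # w) - 1) / (tq - 1) =
      braid g c * ((braid_word g w - 1) / (tq - 1)) + (braid g c - 1) / (tq - 1)"
    by (simp add: braid_word_def diff_divide_distrib[symmetric] add_divide_distrib[symmetric] right_diff_distrib)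
  then show ?case
    using Cons braid_quotient[of g c]
    by (simp add: regular_add regular_mult ev_add ev_mult regular_braid ev_braid
        del: times_divide_eq_right)
qed (simp add: braid_word_def)

lemma del_diff_word_red: "integral (del_diff_word g w) \<and> red (del_diff_word g w) = sd_word g w"
proof (induction w)
  case Nil
  show ?case
    by (simp add: del_diff_word_def integral_simps red_simps)
next
  case (Cons c w)
  have 1: "integral (mon [c] * del_diff_word g w)" "red (mon [c] * del_diff_word g w) = mon [c] * sd_word g w"
    by (simp_all only: Cons red_mon_mult)
  have 2: "integral (const ((braid g c - 1) / (tq - 1)) * (mon [c] * del_left_word g w))"
    "red (const ((braid g c - 1) / (tq - 1)) * (mon [c] * del_left_word g w)) =
      const (of_int (pairing g c)) * (mon [c] * pd_word g w)"
    by (simp_all only: integral_simps red_simps braid_quotient red_mon_mult del_left_word_red)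
  have 3: "integral (if c = g then const ((braid_word g w - 1) / (tq - 1)) * mon w else 0)"
    "red (if c = g then const ((braid_word g w - 1) / (tq - 1)) * mon w else 0) =
      (if c = g then wd_word g w else 0)"
    using braid_word_quotient[of g w]
    by (simp_all only: integral_simps red_simps wd_word_def split: if_split) auto
  show ?case
    unfolding del_diff_word_Cons sd_word.simps
    by (simp only: integral_simps red_simps 1 2 3)
qed

lemma del_left_red: "integral u \<Longrightarrow> integral (del_left g u) \<and> red (del_left g u) = pd_free g (red u)"
  unfolding del_left_def pd_free_def by (rule linext_red) (simp_all add: del_left_word_red)

lemma del_diff_red: "integral u \<Longrightarrow> integral (del_diff g u) \<and> red (del_diff g u) = sd_free g (red u)"
  unfolding del_diff_eq_linext sd_free_def by (rule linext_red) (simp_all add: del_diff_word_red)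

lemma phi_del_diff: "phi u = 0 \<Longrightarrow> phi (del_diff g u) = 0"
  by (simp add: del_diff_def phi_simps phi_diff phi_del_left phi_del_right)

definition below :: "nat \<Rightarrow> ('a word \<Rightarrow>\<^sub>0 'k::zero) \<Rightarrow> bool" where
  "below n u \<longleftrightarrow> (\<forall>w. n \<le> length (letters w) \<longrightarrow> Poly_Mapping.lookup u w = 0)"

lemma below_simps:
  fixes u v :: "'a word \<Rightarrow>\<^sub>0 'k::comm_ring_1"
  shows "below n (0 :: 'a word \<Rightarrow>\<^sub>0 'k)" "below n u \<Longrightarrow> below n v \<Longrightarrow> below n (u + v)"
    "below n u \<Longrightarrow> below n v \<Longrightarrow> below n (u - v)" "below n u \<Longrightarrow> below n (const c * u)"
    "length w < n \<Longrightarrow> below n (mon w :: 'a word \<Rightarrow>\<^sub>0 'k)"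
  by (auto simp: below_def lookup_add lookup_minus lookup_const_mult lookup_single when_def)

lemma below_mono: "below m u \<Longrightarrow> m \<le> n \<Longrightarrow> below n u"
  by (auto simp: below_def)

lemma below_0: "below 0 u \<Longrightarrow> u = 0"
  by (auto simp: below_def intro: poly_mapping_eqI)

lemma below_mon_mult:
  fixes u :: "'a word \<Rightarrow>\<^sub>0 'k::comm_ring_1"
  assumes "below n u"
  shows "below (Suc n) (mon [c] * u)"
  unfolding below_def
proof (intro allI impI)
  fix w :: "'a word" assume "Suc n \<le> length (letters w)"
  then obtain d v where "w = Word (d # v)" "n \<le> length v"
    by (cases w; cases "letters w") auto
  then show "Poly_Mapping.lookup (mon [c] * u) w = 0"
    using assms by (simp add: lookup_mon_mult_left below_def)
qed

lemma below_linext: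
  fixes f :: "'a list \<Rightarrow> ('b word \<Rightarrow>\<^sub>0 'k::comm_ring_1)"
  assumes "\<And>w. below (length w) (f w)" "below (Suc n) u"
  shows "below n (linext f u)"
proof -
  have "below n (\<Sum>w\<in>W. const (Poly_Mapping.lookup u w) * f (letters w))"
    if "finite W" "W \<subseteq> Poly_Mapping.keys u" for W
    using that
  proof (induction W rule: finite_induct)
    case (insert w W)
    then have "length (letters w) \<le> n"
      using assms(2) by (auto simp: below_def in_keys_iff not_less_eq_eq)
    then have "below n (f (letters w))"
      using assms(1) below_mono by blast
    with insert show ?case
      by (simp add: below_simps)
  qed (simp add: below_simps)
  then show ?thesis
    by (simp add: linext_def)
qed

lemma below_del_left_word: "below (length w) (del_left_word g w)" and below_del_right_word: "below (length w) (del_right_word g w)"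
  by (induction w) (simp_all add: below_simps below_mon_mult del: mult_single)

lemma below_del_left: "below (Suc n) u \<Longrightarrow> below n (del_left g u)" and below_del_right: "below (Suc n) u \<Longrightarrow> below n (del_right g u)"
  unfolding del_left_def del_right_def by (rule below_linext; simp add: below_del_left_word below_del_right_word)+

text \<open>
  Induction on the length: the deletion operators shorten words, preserve the kernel and
  integrality, and reduce to the operators of \<open>classical_ideal_criterion\<close>.
\<close>

theorem red_kernel:
  assumes "phi u = 0" "integral u" "below n u"
  shows "red u \<in> classical_ideal"
  using assms
proof (induction n arbitrary: u)
  case 0
  then show ?case
    using below_0[of u] by (simp add: red_simps classical_ideal_zero)
next
  case (Suc n)
  show ?case
  proof (rule classical_ideal_criterion)
    show "Poly_Mapping.lookup (red u) 0 = 0"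
      using Suc.prems(1) by (simp add: lookup_red phi_zero_lookup_Nil)
  next
    fix g
    have "below n (del_diff g u)"
      unfolding del_diff_def by (intro below_simps below_del_left below_del_right Suc.prems)
    then show "pd_free g (red u) \<in> classical_ideal" "sd_free g (red u) \<in> classical_ideal"
      using Suc.IH[of "del_left g u"] Suc.IH[of "del_diff g u"] Suc.prems del_left_red[of u g] del_diff_red[of u g]
      by (simp_all add: phi_del_left phi_del_diff below_del_left)
  qed
qed

section \<open>Lifting from the imaginary unit to the ground field\<close>

lemma normalize_integral:
  assumes "u \<noteq> 0"
  shows "\<exists>c. c \<noteq> 0 \<and> integral (const c * u) \<and> red (const c * u) \<noteq> 0"
proof -
  have "\<exists>n::int. Poly_Mapping.lookup u w \<noteq> 0 \<longrightarrow>
      regular (Poly_Mapping.lookup u w * (q ^ 2 + 1) powi n) \<and> ev (Poly_Mapping.lookup u w * (q ^ 2 + 1) powi n) \<noteq> 0" for w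
    using normalize_pole by blast
  then obtain n :: "'a word \<Rightarrow> int" where n: "\<And>w. Poly_Mapping.lookup u w \<noteq> 0 \<Longrightarrow>
      regular (Poly_Mapping.lookup u w * (q ^ 2 + 1) powi n w) \<and> ev (Poly_Mapping.lookup u w * (q ^ 2 + 1) powi n w) \<noteq> 0"
    by metis
  (* The worst pole among the coefficients clears all the others and leaves a unit at its own word. *)
  define m where "m = Max (n ` Poly_Mapping.keys u)"
  have ne: "Poly_Mapping.keys u \<noteq> {}"
    using assms by simp
  have "m \<in> n ` Poly_Mapping.keys u"
    unfolding m_def using ne by (intro Max_in) auto
  then obtain w where w: "w \<in> Poly_Mapping.keys u" "m = n w"
    by blast
  have "regular (Poly_Mapping.lookup u v * (q ^ 2 + 1) powi m)" for v
  proof (cases "Poly_Mapping.lookup u v = 0")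
    case False
    then have "n v \<le> m"
      unfolding m_def by (intro Max_ge) (auto simp: in_keys_iff)
    then obtain d where "m = n v + int d"
      using zle_iff_zadd by blast
    then have "(q ^ 2 + 1) powi m = (q ^ 2 + 1) powi n v * (q ^ 2 + 1) ^ d"
      using q2_plus_1_neq_0 by (simp add: power_int_add)
    moreover have "regular ((q ^ 2 + 1) ^ d)"
      by (intro regular_power regular_add regular_q regular_1)
    ultimately show ?thesis
      using n[OF False] by (simp add: mult.assoc[symmetric] regular_mult)
  qed simp
  then have "integral (const ((q ^ 2 + 1) powi m) * u)"
    by (simp add: integral_def lookup_const_mult mult.commute)
  moreover have "Poly_Mapping.lookup (red (const ((q ^ 2 + 1) powi m) * u)) w \<noteq> 0"
    using n[of w] w by (simp add: lookup_red lookup_const_mult in_keys_iff mult.commute)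
  then have "red (const ((q ^ 2 + 1) powi m) * u) \<noteq> 0"
    by auto
  ultimately show ?thesis
    using q2_plus_1_neq_0 by (intro exI[of _ "(q ^ 2 + 1) powi m"]) simp
qed

text \<open>
  Gaussian elimination. If all \<open>red (s j)\<close> vanish, then so does the reduction of every
  integral element of \<open>K\<close>; but a non-zero element could be rescaled to one with non-zero
  reduction. Otherwise some \<open>s i\<close> has a coefficient that is a unit of the local ring, which
  eliminates the corresponding word from the other \<open>s j\<close> and from \<open>K\<close>.
\<close>

lemma span_lift:
  fixes s :: "'i \<Rightarrow> 'a free_algebra"
  assumes "finite J"
    and "\<And>u v. u \<in> K \<Longrightarrow> v \<in> K \<Longrightarrow> u + v \<in> K" "\<And>c u. u \<in> K \<Longrightarrow> const c * u \<in> K"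
    and "\<And>j. j \<in> J \<Longrightarrow> s j \<in> K" "\<And>j. j \<in> J \<Longrightarrow> integral (s j)"
    and "\<And>u. u \<in> K \<Longrightarrow> integral u \<Longrightarrow> \<exists>c. red u = (\<Sum>j\<in>J. const (c j) * red (s j))"
    and "u \<in> K"
  shows "\<exists>c. u = (\<Sum>j\<in>J. const (c j) * s j)"
  using assms
proof (induction "card J" arbitrary: J K s u rule: less_induct)
  case less
  note fin = less.prems(1) and K = less.prems(2-4) and int = less.prems(5) and span = less.prems(6)
  show ?case
  proof (cases "\<forall>j\<in>J. red (s j) = 0")
    case True
    have "u = 0"
    proof (rule ccontr)
      assume "u \<noteq> 0"
      then obtain c where c: "integral (const c * u)" "red (const c * u) \<noteq> 0"
        using normalize_integral by blast
      with span[of "const c * u"] K(2)[OF less.prems(7)] True show False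
        by auto
    qed
    then show ?thesis
      by (intro exI[of _ "\<lambda>_. 0"]) simp
  next
    case False
    then obtain i where i: "i \<in> J" "red (s i) \<noteq> 0"
      by blast
    then obtain w where "Poly_Mapping.lookup (red (s i)) w \<noteq> 0"
      by (metis poly_mapping_eqI lookup_zero)
    define e where "e j = Poly_Mapping.lookup (s j) w" for j
    have e: "regular (e j)" if "j \<in> J" for j
      using int[OF that] by (simp add: e_def integral_def)
    have ei: "ev (e i) \<noteq> 0" "e i \<noteq> 0"
      using \<open>Poly_Mapping.lookup (red (s i)) w \<noteq> 0\<close> by (auto simp: e_def lookup_red)
    define s' where "s' j = s j - const (e j / e i) * s i" for j
    define K' where "K' = {u \<in> K. Poly_Mapping.lookup u w = 0}"
    have regq: "regular (e j / e i)" "ev (e j / e i) = ev (e j) / ev (e i)" if "j \<in> J" for j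
      using e[OF that] e[OF i(1)] ei
      by (simp_all add: divide_inverse regular_mult regular_inverse ev_mult ev_inverse)
    have minus: "u - const c * v \<in> K" if "u \<in> K" "v \<in> K" for u v c
      using K(1)[OF that(1) K(2)[OF that(2), of "- c"]] by (simp add: single_uminus)
    have elim: "\<exists>c. v = (\<Sum>j\<in>J - {i}. const (c j) * s' j)" if "v \<in> K'" for v
    proof (rule less.hyps[of "J - {i}" K'])
      show "card (J - {i}) < card J" "finite (J - {i})"
        using fin i(1) by (simp_all only: card_Diff1_less finite_Diff)
      show "u \<in> K' \<Longrightarrow> v \<in> K' \<Longrightarrow> u + v \<in> K'" "u \<in> K' \<Longrightarrow> const c * u \<in> K'" for u v c
        using K by (auto simp: K'_def lookup_add lookup_const_mult)
      show "s' j \<in> K'" if "j \<in> J - {i}" for j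
        using that i ei minus K(3) by (auto simp: K'_def s'_def lookup_minus lookup_const_mult e_def)
      show "integral (s' j)" if "j \<in> J - {i}" for j
        using that i int regq by (auto simp: s'_def intro!: integral_simps)
      show "v \<in> K'" by fact
    next
      fix v assume v: "v \<in> K'" "integral v"
      then obtain c where c: "red v = (\<Sum>j\<in>J. const (c j) * red (s j))"
        using span[of v] by (auto simp: K'_def)
      have split: "(\<Sum>j\<in>J. f j) = f i + (\<Sum>j\<in>J - {i}. f j)" for f :: "'i \<Rightarrow> 'z::comm_monoid_add"
        by (rule sum.remove[OF fin i(1)])
      have "0 = Poly_Mapping.lookup (red v) w"
        using v by (simp add: K'_def lookup_red)
      also have "\<dots> = (\<Sum>j\<in>J. c j * ev (e j))"
        by (simp add: c lookup_sum lookup_const_mult lookup_red e_def)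
      finally have "c i * ev (e i) = - (\<Sum>j\<in>J - {i}. c j * ev (e j))"
        by (simp add: split eq_neg_iff_add_eq_0)
      then have ci: "c i = - (\<Sum>j\<in>J - {i}. c j * (ev (e j) / ev (e i)))"
        using ei by (simp add: sum_divide_distrib[symmetric] field_simps)
      have "red v = (\<Sum>j\<in>J - {i}. const (c j) * red (s' j))"
      proof (rule poly_mapping_eqI)
        fix x
        have "Poly_Mapping.lookup (red (s' j)) x = Poly_Mapping.lookup (red (s j)) x
            - ev (e j) / ev (e i) * Poly_Mapping.lookup (red (s i)) x" if "j \<in> J - {i}" for j
          using that i int regq
          by (simp add: s'_def red_simps integral_simps lookup_minus lookup_const_mult)
        then have "Poly_Mapping.lookup (\<Sum>j\<in>J - {i}. const (c j) * red (s' j)) x =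
            (\<Sum>j\<in>J - {i}. c j * Poly_Mapping.lookup (red (s j)) x)
            - (\<Sum>j\<in>J - {i}. c j * (ev (e j) / ev (e i))) * Poly_Mapping.lookup (red (s i)) x"
          by (simp add: lookup_sum lookup_const_mult right_diff_distrib sum_subtractf sum_distrib_right
              mult.assoc)
        then show "Poly_Mapping.lookup (red v) x =
            Poly_Mapping.lookup (\<Sum>j\<in>J - {i}. const (c j) * red (s' j)) x"
          by (simp add: c split lookup_add lookup_sum lookup_const_mult ci)
      qed
      then show "\<exists>c. red v = (\<Sum>j\<in>J - {i}. const (c j) * red (s' j))"
        by blast
    qed
    (* The coefficient a may have a pole: the element u itself need not be integral. *)
    define a where "a = Poly_Mapping.lookup u w / e i"
    have "u - const a * s i \<in> K'"
      using less.prems(7) i K(3) minus ei by (auto simp: K'_def lookup_minus lookup_const_mult e_def a_def)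
    then obtain c where c: "u - const a * s i = (\<Sum>j\<in>J - {i}. const (c j) * s' j)"
      using elim by blast
    define b where "b = (\<lambda>j. if j = i then a - (\<Sum>j\<in>J - {i}. c j * (e j / e i)) else c j)"
    have "u = (\<Sum>j\<in>J. const (b j) * s j)"
    proof (rule poly_mapping_eqI)
      fix x
      have "Poly_Mapping.lookup u x = a * Poly_Mapping.lookup (s i) x
          + (\<Sum>j\<in>J - {i}. c j * Poly_Mapping.lookup (s' j) x)"
        using arg_cong[OF c, of "\<lambda>p. Poly_Mapping.lookup p x"]
        by (simp add: lookup_minus lookup_const_mult lookup_sum algebra_simps)
      also have "(\<Sum>j\<in>J - {i}. c j * Poly_Mapping.lookup (s' j) x) =
          (\<Sum>j\<in>J - {i}. c j * Poly_Mapping.lookup (s j) x)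
          - (\<Sum>j\<in>J - {i}. c j * (e j / e i)) * Poly_Mapping.lookup (s i) x"
        by (simp add: s'_def lookup_minus lookup_const_mult right_diff_distrib sum_subtractf
            sum_distrib_right mult.assoc)
      also have "(\<Sum>j\<in>J - {i}. c j * Poly_Mapping.lookup (s j) x) =
          (\<Sum>j\<in>J - {i}. b j * Poly_Mapping.lookup (s j) x)"
        by (intro sum.cong) (auto simp: b_def)
      finally show "Poly_Mapping.lookup u x = Poly_Mapping.lookup (\<Sum>j\<in>J. const (b j) * s j) x"
        by (simp add: sum.remove[OF fin i(1)] lookup_add lookup_sum lookup_const_mult b_def[THEN fun_cong, of i]
            left_diff_distrib)
    qed
    then show ?thesis
      by blast
  qed
qed

section \<open>The Serre relators and the kernel\<close>

definition quantum_relator :: "generator \<Rightarrow> generator free_algebra" where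
  "quantum_relator g = serre_relator (of_word [g]) (of_word [other g])"

lemma qbrace_3: "qbrace 3 = - (tq + 1 + inverse tq)"
proof -
  have *: "q + inverse q \<noteq> 0"
    using q2_plus_1_neq_0 q_neq_0 by (simp add: field_simps power2_eq_square)
  have "(q + inverse q) * (- (tq + 1 + inverse tq)) = q powi (- 3) - (-1) ^ 3 * q ^ 3"
    using q_neq_0 by (simp add: tq_def power_int_minus field_simps power2_eq_square power3_eq_cube)
  with * show ?thesis
    unfolding qbrace_def by (simp add: field_simps)
qed

lemma quantum_relator_expand:
  "quantum_relator g = mon [g, g, g, other g] + const (qbrace 3) * mon [g, g, other g, g]
     + const (- qbrace 3) * mon [g, other g, g, g] + const (- 1) * mon [other g, g, g, g]"
  by (simp add: quantum_relator_def serre_relator_def of_word_eq_mon fscale_eq power2_eq_square power3_eq_cube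
      mult_single plus_word_def zero_word_def single_uminus)

text \<open>
  Left deletion kills the relator already in the free algebra, which by \<open>phi_zeroI\<close>
  suffices.
\<close>

lemma phi_quantum_relator: "phi (quantum_relator g) = 0"
proof (rule phi_zeroI)
  show "Poly_Mapping.lookup (quantum_relator g) 0 = 0"
    by (simp only: quantum_relator_expand lookup_add lookup_const_mult lookup_mon_Cons mult_zero_right add_0_left)
next
  fix h
  have nz: "tq \<noteq> 0" by (rule tq_neq_0)
  have "del_left h (quantum_relator g) = 0"
  proof (rule poly_mapping_eqI)
    fix w
    have "h = a \<Longrightarrow> g = b \<Longrightarrow> Poly_Mapping.lookup (del_left h (quantum_relator g)) w = Poly_Mapping.lookup 0 w" for a b
      unfolding quantum_relator_expand del_left_def linext_simps
      by (cases a; cases b) (use nz in \<open>auto simp: braid_def mult_single plus_word_def zero_word_def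
          distrib_left lookup_add lookup_single when_def qbrace_3 field_simps\<close>)
    then show "Poly_Mapping.lookup (del_left h (quantum_relator g)) w = Poly_Mapping.lookup 0 w"
      by blast
  qed
  then show "phi (del_left h (quantum_relator g)) = 0"
    by (simp add: phi_simps)
qed

lemma quantum_relator_in_serre_ideal: "quantum_relator g \<in> serre_ideal"
  by (cases g) (simp_all add: quantum_relator_def serre_ideal.relator_AB serre_ideal.relator_BA)

lemma phi_serre_ideal: "p \<in> serre_ideal \<Longrightarrow> phi p = 0"
proof (induction p rule: serre_ideal.induct)
  case relator_AB
  show ?case
    using phi_quantum_relator[of Gen_A] by (simp add: quantum_relator_def)
next
  case relator_BA
  show ?case
    using phi_quantum_relator[of Gen_B] by (simp add: quantum_relator_def)
qed (simp_all add: phi_simps phi_zero_mult)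

definition quantum_relator_mult :: "generator list \<times> generator \<times> generator list \<Rightarrow> generator free_algebra" where
  "quantum_relator_mult = (\<lambda>(l, g, r). mon l * quantum_relator g * mon r)"

definition classical_relator_mult :: "generator list \<times> generator \<times> generator list \<Rightarrow> classical_algebra" where
  "classical_relator_mult = (\<lambda>(l, g, r). mon l * classical_relator g * mon r)"

lemma mult_words_expand:
  "mon l * (mon a + const x * mon b + const y * mon c + const z * mon d) * mon r =
     mon (l @ a @ r) + const x * mon (l @ b @ r) + const y * mon (l @ c @ r)
     + const z * (mon (l @ d @ r) :: 'a word \<Rightarrow>\<^sub>0 'k::comm_ring_1)"
  by (simp add: mono_append distrib_left distrib_right mult.assoc mult_const_left[of "mon l"])

lemma quantum_relator_mult_red: "integral (quantum_relator_mult j)" "red (quantum_relator_mult j) = classical_relator_mult j"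
proof -
  obtain l g r where j: "j = (l, g, r)"
    by (cases j) auto
  have c: "regular (qbrace 3)" "ev (qbrace 3) = - 3"
    unfolding qbrace_3 by (simp_all add: regular_uminus ev_uminus regular_diff ev_diff regular_tq ev_tq
      regular_inverse ev_inverse)
  then have "regular (- qbrace 3)" "ev (- qbrace 3) = 3" "regular (- 1)" "ev (- 1) = - 1"
    by (simp_all add: regular_uminus ev_uminus)
  with c show "integral (quantum_relator_mult j)" "red (quantum_relator_mult j) = classical_relator_mult j"
    by (simp_all only: j quantum_relator_mult_def classical_relator_mult_def prod.case quantum_relator_expand classical_relator_expand
        mult_words_expand integral_simps red_simps)
qed

lemma lookup_classical_relator_mult:
  assumes "length (letters w) \<noteq> length l + 4 + length r"
  shows "Poly_Mapping.lookup (classical_relator_mult (l, g, r)) w = 0"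
  unfolding classical_relator_mult_def prod.case classical_relator_expand mult_words_expand lookup_add lookup_const_mult
  using assms by (auto simp: lookup_single when_def)

lemma below_quantum_relator_mult:
  "length l + 4 + length r < n \<Longrightarrow> below n (quantum_relator_mult (l, g, r))"
  by (simp only: quantum_relator_mult_def prod.case quantum_relator_expand mult_words_expand)
    (intro below_simps; simp)

definition short_relators :: "nat \<Rightarrow> (generator list \<times> generator \<times> generator list) set" where
  "short_relators n = {(l, g, r). length l + 4 + length r < n}"

lemma finite_generators: "finite (UNIV :: generator set)"
proof -
  have "(UNIV :: generator set) = {Gen_A, Gen_B}"
    using generator.exhaust by auto
  then show ?thesis
    by (metis finite.emptyI finite.insertI)
qed

lemma finite_short_relators: "finite (short_relators n)"
proof -
  have "finite {w :: generator list. length w \<le> n}"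
    using finite_lists_length_le[OF finite_generators, of n] by simp
  then have "finite ({w :: generator list. length w \<le> n} \<times> (UNIV :: generator set) \<times> {w :: generator list. length w \<le> n})"
    by (intro finite_cartesian_product) (simp_all only: finite_generators)
  then show ?thesis
    by (rule rev_finite_subset) (auto simp: short_relators_def)
qed

text \<open>
  Products of relators with words are homogeneous, so the long ones in a combination do not
  affect short words. Restricting to words of bounded length makes the set of generators
  finite and independent of \<open>p\<close>, as \<open>span_lift\<close> demands.
\<close>

lemma classical_ideal_short:
  assumes "p \<in> classical_ideal"
  shows "\<exists>c. \<forall>w. length (letters w) < n \<longrightarrow> Poly_Mapping.lookup p w =
    (\<Sum>j\<in>short_relators n. c j * Poly_Mapping.lookup (classical_relator_mult j) w)"
  using assms
proof (induction p rule: classical_ideal.induct)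
  case (gen l g r)
  let ?c = "\<lambda>j. if j = (l, g, r) then 1 else 0 :: complex"
  have "Poly_Mapping.lookup (mon l * classical_relator g * mon r) w =
      (\<Sum>j\<in>short_relators n. ?c j * Poly_Mapping.lookup (classical_relator_mult j) w)" if "length (letters w) < n" for w
  proof (cases "length l + 4 + length r < n")
    case True
    then have "(l, g, r) \<in> short_relators n"
      by (simp add: short_relators_def)
    then show ?thesis
      by (simp add: if_distrib[of "\<lambda>c. c * _"] finite_short_relators classical_relator_mult_def cong: if_cong)
  next
    case False
    then have "(l, g, r) \<notin> short_relators n" "length (letters w) \<noteq> length l + 4 + length r"
      using that by (auto simp: short_relators_def)
    then show ?thesis
      using lookup_classical_relator_mult[of w l r g]
      by (simp add: if_distrib[of "\<lambda>c. c * _"] finite_short_relators classical_relator_mult_def cong: if_cong)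
  qed
  then show ?case
    by (intro exI[of _ ?c] allI impI)
next
  case (add p r)
  then obtain c d where "\<forall>w. length (letters w) < n \<longrightarrow> Poly_Mapping.lookup p w =
      (\<Sum>j\<in>short_relators n. c j * Poly_Mapping.lookup (classical_relator_mult j) w)"
    "\<forall>w. length (letters w) < n \<longrightarrow> Poly_Mapping.lookup r w =
      (\<Sum>j\<in>short_relators n. d j * Poly_Mapping.lookup (classical_relator_mult j) w)"
    by blast
  then show ?case
    by (intro exI[of _ "\<lambda>j. c j + d j"]) (simp add: lookup_add distrib_right sum.distrib)
next
  case (scale p a)
  then obtain c where "\<forall>w. length (letters w) < n \<longrightarrow> Poly_Mapping.lookup p w =
      (\<Sum>j\<in>short_relators n. c j * Poly_Mapping.lookup (classical_relator_mult j) w)"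
    by blast
  then show ?case
    by (intro exI[of _ "\<lambda>j. a * c j"]) (simp add: lookup_const_mult sum_distrib_left mult.assoc)
qed

text \<open>
  \<open>red_kernel\<close> and \<open>classical_ideal_short\<close> verify the hypothesis of \<open>span_lift\<close> for the
  elements of the kernel of bounded length.
\<close>

theorem kernel_phi:
  assumes "phi u = 0"
  shows "u \<in> serre_ideal"
proof -
  define n where "n = Suc (Max (insert 0 ((length \<circ> letters) ` Poly_Mapping.keys u)))"
  have len: "length (letters w) < n" if "w \<in> Poly_Mapping.keys u" for w
    unfolding n_def less_Suc_eq_le using that by (intro Max_ge) auto
  then have u: "below n u"
    unfolding below_def by (metis in_keys_iff leD)
  define K where "K = {v. phi v = 0 \<and> below n v}"
  have "\<exists>c. u = (\<Sum>j\<in>short_relators n. const (c j) * quantum_relator_mult j)"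
  proof (rule span_lift[of _ K])
    show "finite (short_relators n)"
      by (rule finite_short_relators)
    show "v \<in> K \<Longrightarrow> v' \<in> K \<Longrightarrow> v + v' \<in> K" "v \<in> K \<Longrightarrow> const c * v \<in> K" for v v' c
      by (simp_all add: K_def phi_simps below_simps)
    show "quantum_relator_mult j \<in> K" if "j \<in> short_relators n" for j
      using that by (auto simp: K_def short_relators_def below_quantum_relator_mult)
        (simp add: quantum_relator_mult_def phi_zero_mult phi_quantum_relator)
    show "integral (quantum_relator_mult j)" for j
      by (rule quantum_relator_mult_red)
    show "u \<in> K"
      using assms u by (simp add: K_def)
  next
    fix v assume v: "v \<in> K" "integral v"
    then have "red v \<in> classical_ideal"
      using red_kernel[of v n] by (simp add: K_def)
    then obtain c where c: "\<And>w. length (letters w) < n \<Longrightarrow> Poly_Mapping.lookup (red v) w =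
        (\<Sum>j\<in>short_relators n. c j * Poly_Mapping.lookup (classical_relator_mult j) w)"
      using classical_ideal_short by blast
    have "red v = (\<Sum>j\<in>short_relators n. const (c j) * red (quantum_relator_mult j))"
    proof (rule poly_mapping_eqI)
      fix w
      show "Poly_Mapping.lookup (red v) w =
          Poly_Mapping.lookup (\<Sum>j\<in>short_relators n. const (c j) * red (quantum_relator_mult j)) w"
      proof (cases "length (letters w) < n")
        case True
        then show ?thesis
          by (simp add: c lookup_sum lookup_const_mult quantum_relator_mult_red)
      next
        case False
        then have "Poly_Mapping.lookup (classical_relator_mult j) w = 0" if "j \<in> short_relators n" for j
          using that by (auto simp: short_relators_def intro!: lookup_classical_relator_mult)
        moreover have "Poly_Mapping.lookup v w = 0"
          using v False by (auto simp: K_def below_def)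
        ultimately show ?thesis
          by (simp add: lookup_red[of v] lookup_sum lookup_const_mult quantum_relator_mult_red)
      qed
    qed
    then show "\<exists>c. red v = (\<Sum>j\<in>short_relators n. const (c j) * red (quantum_relator_mult j))"
      by blast
  qed
  then obtain c where c: "u = (\<Sum>j\<in>short_relators n. const (c j) * quantum_relator_mult j)"
    by blast
  have *: "const (c j) * quantum_relator_mult j \<in> serre_ideal" for j
    by (cases j) (simp only: quantum_relator_mult_def prod.case serre_ideal.mult_left serre_ideal.mult_right
        quantum_relator_in_serre_ideal)
  have "(\<Sum>j\<in>J. const (c j) * quantum_relator_mult j) \<in> serre_ideal" if "finite J" for J
    using that by (induction J rule: finite_induct) (simp_all add: serre_ideal.zero serre_ideal.add *)
  then show ?thesis
    unfolding c using finite_short_relators by blast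
qed

section \<open>The embedding\<close>

lemma phi_fpart: "p \<in> fpart i \<Longrightarrow> phi p \<in> fpart i"
proof -
  assume p: "p \<in> fpart i"
  have "shuffle_gens w \<in> fpart (of_nat (length w))" for w
  proof (induction w)
    case Nil
    show ?case
      using of_word_fpart[of "[]"] by (simp add: of_word_Nil)
  next
    case (Cons c w)
    show ?case
      using shuffle_fpart[OF of_word_fpart[of "[letter_of c]"] Cons] by simp
  qed
  moreover have "of_nat (length (letters w)) = i" if "w \<in> Poly_Mapping.keys p" for w
    using p that by (simp add: fpart_def)
  ultimately have "shuffle_gens (letters w) \<in> fpart i" if "w \<in> Poly_Mapping.keys p" for w
    using that by metis
  then show ?thesis
    unfolding phi_def linext_def fscale_eq[symmetric]
    by (intro fvs.subspace_sum fpart_subspace fvs.subspace_scale)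
qed

lift_definition shuffle_embedding :: "uqplus \<Rightarrow> shuffle_space" is phi
  using phi_serre_ideal by (fastforce simp: phi_diff)

lemma superalgebra_hom_shuffle_embedding:
  "superalgebra_hom uq_scale (*) 1 uq_part fscale (\<star>) 1 fpart shuffle_embedding"
proof -
  interpret U: superalgebra uq_scale "(*)" 1 uq_part
    by (rule superalgebra_uqplus)
  interpret V: superalgebra fscale "(\<star>)" 1 fpart
    by (rule superalgebra_shuffle)
  show ?thesis
  proof
    fix x y :: uqplus and c i
    obtain p where x: "x = abs_uqplus p"
      by (rule uqplus_cases)
    obtain r where y: "y = abs_uqplus r"
      by (rule uqplus_cases)
    show "shuffle_embedding (x + y) = shuffle_embedding x + shuffle_embedding y"
      "shuffle_embedding (uq_scale c x) = fscale c (shuffle_embedding x)"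
      by (simp_all only: x y plus_uqplus.abs_eq uq_scale.abs_eq shuffle_embedding.abs_eq phi_simps fscale_eq)
    show "shuffle_embedding (x * y) = shuffle_embedding x \<star> shuffle_embedding y"
      by (simp only: x y times_uqplus.abs_eq shuffle_embedding.abs_eq phi_mult)
    show "shuffle_embedding 1 = 1"
      by (simp add: one_uqplus.abs_eq shuffle_embedding.abs_eq phi_simps)
    show "shuffle_embedding x \<in> fpart i" if "x \<in> uq_part i"
      using that by (auto simp: uq_part_def shuffle_embedding.abs_eq phi_fpart)
  qed
qed

lemma inj_shuffle_embedding: "inj shuffle_embedding"
proof (rule injI)
  fix x y assume eq: "shuffle_embedding x = shuffle_embedding y"
  obtain p where x: "x = abs_uqplus p"
    by (rule uqplus_cases)
  obtain r where y: "y = abs_uqplus r"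
    by (rule uqplus_cases)
  have "phi (p - r) = 0"
    using eq by (simp add: x y shuffle_embedding.abs_eq phi_diff)
  then show "x = y"
    by (simp add: x y uqplus.abs_eq_iff kernel_phi)
qed

theorem corollary11:
  shows "\<exists>\<phi> :: uqplus \<Rightarrow> shuffle_space.
    superalgebra_hom uq_scale (*) 1 uq_part fscale (\<star>) 1 fpart \<phi> \<and>
    inj \<phi> \<and> \<phi> uq_A = of_word [Letter_x] \<and> \<phi> uq_B = of_word [Letter_y]"
proof (intro exI conjI)
  show "shuffle_embedding uq_A = of_word [Letter_x]" "shuffle_embedding uq_B = of_word [Letter_y]"
    using phi_gen[of Gen_A] phi_gen[of Gen_B]
    by (simp_all add: uq_A.abs_eq uq_B.abs_eq shuffle_embedding.abs_eq of_word_def)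
qed (rule superalgebra_hom_shuffle_embedding inj_shuffle_embedding)+

end
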